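(* There is a deterministic $\mathsf{CONGEST}$ algorithm that solves the list-coloring problem on every instance consisting of an $n$-node graph $G=(V,E)$ with diameter $D$ and maximum degree $\Delta$, a color space $[C]$, and lists $L(v)\subseteq[C]$ with $|L(v)|\ge \deg(v)+1$ for all $v\in V$, in $$O\bigl(D\cdot \log n\cdot \log C\cdot(\log\Delta+\log\log C)\bigr)$$ rounds. (In particular, if $C\le \mathrm{poly}(\Delta)$, the number of rounds is $O(D\cdot\log n\cdot\log^2\Delta)$.)
   Context: $[C]:=\{0,\dots,C-1\}$. Given a graph $G=(V,E)$, a color space $[C]$ and lists $L(v)\subseteq[C]$ for $v\in V$, a list-coloring is a map $\phi:V\to[C]$ with $\phi(v)\in L(v)$ for all $v\in V$ and $\phi(u)\ne\phi(v)$ for every edge $\{u,v\}\in E$. $\mathsf{CONGEST}$ model: the communication network is the $n$-node (connected) graph $G$; nodes have unique identifiers of $O(\log n)$ bits. Time proceeds in synchronous rounds; in each round every node performs arbitrary internal computation and sends a message of $O(\log n)$ bits to each of its neighbors. Initially a node knows only its own input (its identifier, its list $L(v)$), the identifiers of its neighbors, and global parameters; at the end each node must know its own color. The time complexity is the number of rounds. Standing assumption: $C\le\mathrm{poly}(n)$, so that a color fits into $O(1)$ messages. In asymptotic bounds, logarithmic factors are read as being at least $1$. *)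

theory Defs
  imports Complex_Main "Graph_Theory.Pair_Digraph" "Graph_Theory.Digraph_Component"
begin

section \<open>Graphs\<close>

text \<open>
  A finite simple graph is a \<^locale>\<open>pair_graph\<close>: a finite, loop-free, symmetric set of pairs,
  in which an undirected edge appears as two opposite arcs. Degrees are therefore out-degrees.
\<close>

definition neighbors :: "'a pair_pre_digraph \<Rightarrow> 'a \<Rightarrow> 'a set" where
  "neighbors G v = {u. (v, u) \<in> parcs G}"

abbreviation deg :: "'a pair_pre_digraph \<Rightarrow> 'a \<Rightarrow> nat" where
  "deg G v \<equiv> out_degree (with_proj G) v"

definition max_degree :: "'a pair_pre_digraph \<Rightarrow> nat" where
  "max_degree G = Max (deg G ` pverts G)"

text \<open>The next two definitions are meaningful for finite connected graphs only.\<close>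

definition graph_dist :: "'a pair_pre_digraph \<Rightarrow> 'a \<Rightarrow> 'a \<Rightarrow> nat" where
  "graph_dist G u v = (LEAST k. \<exists>p. pre_digraph.awalk (with_proj G) u p v \<and> length p = k)"

definition diameter :: "'a pair_pre_digraph \<Rightarrow> nat" where
  "diameter G = Max {graph_dist G u v | u v. u \<in> pverts G \<and> v \<in> pverts G}"

definition list_coloring :: "'a pair_pre_digraph \<Rightarrow> ('a \<Rightarrow> nat set) \<Rightarrow> ('a \<Rightarrow> nat) \<Rightarrow> bool" where
  "list_coloring G L \<phi> \<longleftrightarrow>
     (\<forall>v\<in>pverts G. \<phi> v \<in> L v) \<and> (\<forall>(u, v)\<in>parcs G. \<phi> u \<noteq> \<phi> v)"

section \<open>Logarithmic factors\<close>

text \<open>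
  Logarithmic factors in asymptotic bounds are read as being at least 1; in particular
  \<open>log log C\<close> is \<open>lg (lg C)\<close>.
\<close>

definition lg :: "real \<Rightarrow> real" where
  "lg x = max 1 (log 2 x)"

text \<open>The number of bits meant by \<open>O(log n)\<close> when \<open>b\<close> is the hidden constant.\<close>

definition log_bits :: "nat \<Rightarrow> nat \<Rightarrow> nat" where
  "log_bits b n = b * nat \<lceil>lg (real n)\<rceil>"

section \<open>The CONGEST model\<close>

text \<open>
  The nodes of a network are natural numbers, and each node is its own unique identifier.
  The diameter is not among the global parameters.
\<close>

record global_params =
  num_nodes :: nat
  num_colors :: nat
  max_deg :: nat

record node_input =
  own_id :: nat
  neighbor_ids :: "nat set"
  color_list :: "nat set"

type_synonym message = "bool list"

text \<open>
  What a node has received in one round, indexed by the identifier of the sender;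
  entries for non-neighbors are empty.
\<close>

type_synonym inbox = "nat \<Rightarrow> message"

text \<open>
  Internal computation is unrestricted and deterministic, so the state of a node may be taken to be
  the list of all inboxes so far (oldest first) together with its input and the global
  parameters. From these, \<open>send\<close> computes the message for each neighbor (given by identifier) in
  the next round. The result of \<open>color_output\<close> is the color of the node, or \<^term>\<open>None\<close> as long as the
  node has not determined it.
\<close>

record algorithm =
  send :: "global_params \<Rightarrow> node_input \<Rightarrow> inbox list \<Rightarrow> nat \<Rightarrow> message"
  color_output :: "global_params \<Rightarrow> node_input \<Rightarrow> inbox list \<Rightarrow> nat option"

definition params_of :: "nat pair_pre_digraph \<Rightarrow> nat \<Rightarrow> global_params" where
  "params_of G C =
     \<lparr>num_nodes = card (pverts G), num_colors = C, max_deg = max_degree G\<rparr>"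

definition input_of :: "nat pair_pre_digraph \<Rightarrow> (nat \<Rightarrow> nat set) \<Rightarrow> nat \<Rightarrow> node_input" where
  "input_of G L v = \<lparr>own_id = v, neighbor_ids = neighbors G v, color_list = L v\<rparr>"

text \<open>\<open>history A G C L t v\<close> are the inboxes of node \<open>v\<close> in the first \<open>t\<close> rounds.\<close>

primrec history ::
  "algorithm \<Rightarrow> nat pair_pre_digraph \<Rightarrow> nat \<Rightarrow> (nat \<Rightarrow> nat set) \<Rightarrow> nat \<Rightarrow> nat \<Rightarrow> inbox list" where
  "history A G C L 0 v = []"
| "history A G C L (Suc t) v = history A G C L t v @
     [\<lambda>u. if u \<in> neighbors G v
          then send A (params_of G C) (input_of G L u) (history A G C L t u) v
          else []]"

definition message_at ::
  "algorithm \<Rightarrow> nat pair_pre_digraph \<Rightarrow> nat \<Rightarrow> (nat \<Rightarrow> nat set) \<Rightarrow> nat \<Rightarrow> nat \<Rightarrow> nat \<Rightarrow> message" where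
  "message_at A G C L t u v = send A (params_of G C) (input_of G L u) (history A G C L t u) v"

definition output_at ::
  "algorithm \<Rightarrow> nat pair_pre_digraph \<Rightarrow> nat \<Rightarrow> (nat \<Rightarrow> nat set) \<Rightarrow> nat \<Rightarrow> nat \<Rightarrow> nat option" where
  "output_at A G C L t v = color_output A (params_of G C) (input_of G L v) (history A G C L t v)"

definition respects_bandwidth ::
  "nat \<Rightarrow> algorithm \<Rightarrow> nat pair_pre_digraph \<Rightarrow> nat \<Rightarrow> (nat \<Rightarrow> nat set) \<Rightarrow> bool" where
  "respects_bandwidth \<beta> A G C L \<longleftrightarrow>
     (\<forall>t. \<forall>(u, v)\<in>parcs G. length (message_at A G C L t u v) \<le> log_bits \<beta> (card (pverts G)))"

text \<open>
  Outputs are irrevocable: the color of a node is its first output, and it counts only if it is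
  produced after at most \<open>T\<close> rounds.
\<close>

definition solves_within ::
  "algorithm \<Rightarrow> nat pair_pre_digraph \<Rightarrow> nat \<Rightarrow> (nat \<Rightarrow> nat set) \<Rightarrow> real \<Rightarrow> bool" where
  "solves_within A G C L T \<longleftrightarrow>
     (\<exists>\<phi>. list_coloring G L \<phi> \<and>
        (\<forall>v\<in>pverts G. \<exists>t. real t \<le> T \<and>
           output_at A G C L t v = Some (\<phi> v) \<and> (\<forall>s<t. output_at A G C L s v = None)))"

section \<open>Problem instances\<close>

text \<open>
  The constants \<open>a\<close> and \<open>b\<close> are those hidden in \<open>C \<le> poly(n)\<close> and in the \<open>O(log n)\<close> bits
  of the identifiers; every polynomial in \<open>n \<ge> 1\<close> is at most \<open>a * n ^ a\<close> for some \<open>a\<close>.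
\<close>

definition coloring_instance ::
  "nat \<Rightarrow> nat \<Rightarrow> nat pair_pre_digraph \<Rightarrow> nat \<Rightarrow> (nat \<Rightarrow> nat set) \<Rightarrow> bool" where
  "coloring_instance a b G C L \<longleftrightarrow>
     pair_graph G \<and> connected (with_proj G) \<and>
     (\<forall>v\<in>pverts G. v < 2 ^ log_bits b (card (pverts G))) \<and>
     C \<le> a * card (pverts G) ^ a \<and>
     (\<forall>v\<in>pverts G. L v \<subseteq> {..<C} \<and> card (L v) \<ge> deg G v + 1)"

end

theory Submission
  imports Defs "HOL-Library.FuncSet" "HOL-Number_Theory.Cong"
begin

text \<open>
  Uncolored nodes pick a color of their list bit by bit, starting with the leading bit. If the next
  bit is random, with probabilities proportional to the numbers of colors that remain, then the
  expectation of the potential \<open>\<Sum> 1 / |S v|\<close>, summed over ordered pairs \<open>(v, u)\<close> of neighbors with the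
  same prefix, where \<open>S v\<close> is the set of colors that remain for \<open>v\<close>, does not increase. It is at
  most the number \<open>m\<close> of uncolored nodes at first, and at the end it counts the conflicts twice. So there
  are at most about \<open>m / 2\<close> conflicts, and if a node keeps its color whenever it has the largest
  identifier among the nodes it conflicts with, then each conflict costs at most one node.
  A constant fraction of the nodes is colored, and \<open>O(log n)\<close> repetitions suffice.

  Pairwise independence of the choices of neighbors is enough. A coloring with \<open>poly(\<Delta>)\<close>
  colors, computed with Linial's method, replaces the identifiers as input of a hash function with a seed of
  \<open>O(log \<Delta> + log log C)\<close> bits. These bits are fixed one by one with the method of conditional
  expectations; each of them takes two sums over all nodes, computed in \<open>O(D)\<close> rounds along a spanning tree.

  The diameter is guessed as 1, 2, 4 and so on. A guess \<open>R\<close> is accepted if following the parent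
  pointers \<open>R\<close> times leads all nodes to the same root, which is tested by counting, so that wrong
  guesses do no harm, and the running times of the attempts form a geometric series.
\<close>

section \<open>Bit lengths and multiply-shift hashing\<close>

text \<open>The seed length is the quantity to control, since every seed bit costs two sums of O(D)
  rounds. With identifiers as hash keys it would be of order log n; keys that only have to differ
  between neighbors bring it down to O(log \<Delta>) bits. The summand log log C comes from
  rounding: bit probabilities are multiples of \<open>1 / 2 ^ r\<close> and weights are integers, so
  each of the l = O(log C) phases may raise the potential by
  \<open>m * (\<Delta> + 1) / 2 ^ r\<close>. A hash width r with
  \<open>2 * l * (\<Delta> + 1) \<le> 2 ^ r\<close> keeps the total increase within m / 2. This
  leaves at most 3 m / 4 unordered conflicts and hence at least m / 4 newly colored nodes. The other
  obstacle is that pointers and sums are unreliable while the guess of D is too small. Facts about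
  aggregation are therefore stated for all pointer functions along edges, in terms of their
  iterates. The coloring itself is verified on a higher level, where an operation acts on the ideal
  global state, and the one obligation towards the network is that every transmitted number fits
  into a message.\<close>

definition bits :: "nat \<Rightarrow> nat" where
  "bits x = (LEAST k. x < 2 ^ k)"

lemma less_two_power_bits: "x < 2 ^ bits x"
  unfolding bits_def by (rule LeastI_ex) (use less_exp in blast)

lemma bits_le: "x < 2 ^ k \<Longrightarrow> bits x \<le> k"
  unfolding bits_def by (rule Least_le)

lemma bits_mono: "x \<le> y \<Longrightarrow> bits x \<le> bits y"
  by (rule bits_le) (use less_two_power_bits[of y] in simp)

lemma two_power_bits_le: "0 < x \<Longrightarrow> 2 ^ bits x \<le> 2 * x"
proof -
  assume "0 < x"
  with less_two_power_bits[of x] have "bits x \<noteq> 0" by (metis less_one neq0_conv power_0)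
  then obtain k where k: "bits x = Suc k" by (cases "bits x") auto
  have "\<not> x < 2 ^ k" using bits_le[of x k] k by auto
  then show ?thesis using k by simp
qed

section \<open>Pairwise independence of multiply-shift hashing\<close>

definition ihash :: "nat \<Rightarrow> int \<Rightarrow> int \<Rightarrow> int \<Rightarrow> int" where
  "ihash r a b x = ((a * x + b) mod 4 ^ r) div 2 ^ r"

text \<open>Adding a multiple of \<open>2 ^ r\<close> leaves the lower half of a word of 2 r bits
  alone and causes no carry, so the upper half moves by exactly k modulo
  \<open>2 ^ r\<close>.\<close>

lemma ihash_shift:
  assumes "[a' * x + b' = a * x + b + 2 ^ r * k] (mod 4 ^ r)"
  shows "ihash r a' b' x = (ihash r a b x + k) mod 2 ^ r"
proof -
  have m: "(w mod 4 ^ r) div 2 ^ r = (w div 2 ^ r) mod (2 ^ r)" for w :: int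
  proof -
    have "w mod (2 ^ r * 2 ^ r) = 2 ^ r * (w div 2 ^ r mod 2 ^ r) + w mod 2 ^ r"
      by (rule zmod_zmult2_eq) simp
    then show ?thesis by (simp add: power_mult_distrib[symmetric])
  qed
  have "ihash r a' b' x = ((a * x + b + 2 ^ r * k) mod 4 ^ r) div 2 ^ r"
    using assms unfolding ihash_def cong_def by simp
  also have "\<dots> = ((a * x + b) div 2 ^ r + k) mod 2 ^ r"
    by (simp add: m add.commute)
  finally show ?thesis by (simp add: ihash_def m mod_simps)
qed

text \<open>This is the purpose of the modulus \<open>4 ^ r\<close>: a nonzero z below
  \<open>2 ^ r\<close> in absolute value has fewer than r factors 2, so its gcd with the modulus
  divides \<open>2 ^ r\<close> even if z is not invertible.\<close>

lemma shift_solvable: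
  fixes z :: int
  assumes "z \<noteq> 0" "\<bar>z\<bar> < 2 ^ r"
  obtains d where "[d * z = 2 ^ r] (mod 4 ^ r)"
proof -
  have "gcd z (4 ^ r) dvd (2 ^ (2 * r) :: int)" by (simp add: power_mult)
  then obtain i where i: "gcd z (4 ^ r) = 2 ^ i" "i \<le> 2 * r"
    using divides_primepow[of "2::int" "gcd z (4 ^ r)" "2 * r"] by auto
  have "gcd z (4 ^ r) \<le> \<bar>z\<bar>" using assms(1) by (intro zdvd_imp_le) auto
  then have "(2::int) ^ i < 2 ^ r" using i assms by linarith
  then have "i < r" by simp
  then have "gcd z (4 ^ r) dvd 2 ^ r" using i by (simp add: le_imp_power_dvd)
  then obtain c where c: "2 ^ r = gcd z (4 ^ r) * c" by (auto simp: dvd_def)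
  obtain u where u: "[z * u = gcd z (4 ^ r)] (mod 4 ^ r)" using cong_solve_int by blast
  have "[(u * c) * z = 2 ^ r] (mod 4 ^ r)"
    using cong_scalar_right[OF u, of c] unfolding c[symmetric] by (simp add: mult_ac)
  then show ?thesis using that by blast
qed

text \<open>Translations of the coefficient pair map each fibre of the pair of hash values
  injectively into each other one. So all \<open>4 ^ r\<close> fibres have the same size, and
  together they contain \<open>16 ^ r\<close> pairs.\<close>

lemma card_ihash:
  fixes x y :: int
  assumes xy: "x \<noteq> y" "0 \<le> x" "x < 2 ^ r" "0 \<le> y" "y < 2 ^ r"
    and ij: "i \<in> {0..<2 ^ r}" "j \<in> {0..<2 ^ r}"
  shows "card {(a, b). a \<in> {0..<4 ^ r} \<and> b \<in> {0..<4 ^ r} \<and> ihash r a b x = i \<and> ihash r a b y = j} = 4 ^ r"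
proof -
  define A where "A = ({0..<4 ^ r} :: int set)"
  define S where "S i j = {(a, b). a \<in> A \<and> b \<in> A \<and> ihash r a b x = i \<and> ihash r a b y = j}" for i j
  define Q where "Q = ({0..<2 ^ r} :: int set)"
  have fA: "finite A" by (simp add: A_def)
  have fin: "finite (S i j)" for i j
    by (rule finite_subset[of _ "A \<times> A"]) (auto simp: S_def A_def)
  obtain d where d: "[d * (y - x) = 2 ^ r] (mod 4 ^ r)"
  proof -
    have "y - x \<noteq> 0" "\<bar>y - x\<bar> < 2 ^ r" using xy by linarith+
    from shift_solvable[OF this] show ?thesis using that by blast
  qed
  have le: "card (S i j) \<le> card (S i' j')" if "i \<in> Q" "j \<in> Q" "i' \<in> Q" "j' \<in> Q" for i j i' j'
  proof -
    \<comment> \<open>\<open>D\<close> and \<open>E\<close> satisfy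
      \<open>D * x + E = 2 ^ r * (i' - i)\<close> and, modulo \<open>4 ^ r\<close>, also
      \<open>D * y + E = 2 ^ r * (j' - j)\<close>: the shifts wanted at the two keys.\<close>
    define D where "D = d * ((j' - j) - (i' - i))"
    define E where "E = 2 ^ r * (i' - i) - D * x"
    have ci: "[((a + D) mod 4 ^ r) * x + (b + E) mod 4 ^ r = a * x + b + 2 ^ r * (i' - i)] (mod 4 ^ r)" for a b
    proof -
      have "[((a + D) mod 4 ^ r) * x + (b + E) mod 4 ^ r = (a + D) * x + (b + E)] (mod 4 ^ r)"
        by (intro cong_add cong_mult cong_refl) (simp_all add: cong_def)
      then show ?thesis by (simp add: E_def algebra_simps)
    qed
    have cj: "[((a + D) mod 4 ^ r) * y + (b + E) mod 4 ^ r = a * y + b + 2 ^ r * (j' - j)] (mod 4 ^ r)" for a b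
    proof -
      have "[((a + D) mod 4 ^ r) * y + (b + E) mod 4 ^ r = (a + D) * y + (b + E)] (mod 4 ^ r)"
        by (intro cong_add cong_mult cong_refl) (simp_all add: cong_def)
      also have "(a + D) * y + (b + E) = (a * y + b + 2 ^ r * (i' - i)) + (d * (y - x)) * ((j' - j) - (i' - i))"
        by (simp add: E_def D_def algebra_simps)
      also have "[\<dots> = (a * y + b + 2 ^ r * (i' - i)) + 2 ^ r * ((j' - j) - (i' - i))] (mod 4 ^ r)"
        by (intro cong_add cong_mult d cong_refl)
      also have "(a * y + b + 2 ^ r * (i' - i)) + 2 ^ r * ((j' - j) - (i' - i)) = a * y + b + 2 ^ r * (j' - j)"
        by (simp add: algebra_simps)
      finally show ?thesis .
    qed
    let ?f = "\<lambda>(a, b). ((a + D) mod 4 ^ r, (b + E) mod 4 ^ r)"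
    have "inj_on ?f (S i j)"
    proof (rule inj_onI, clarify)
      fix a b a' b'
      assume *: "(a, b) \<in> S i j" "(a', b') \<in> S i j"
        "(a + D) mod 4 ^ r = (a' + D) mod 4 ^ r" "(b + E) mod 4 ^ r = (b' + E) mod 4 ^ r"
      have "[a = a'] (mod 4 ^ r)" "[b = b'] (mod 4 ^ r)"
        using cong_add_rcancel[of a D a' "4 ^ r"] cong_add_rcancel[of b E b' "4 ^ r"] *(3,4)
        unfolding cong_def[of "a + D"] cong_def[of "b + E"] by simp_all
      then show "a = a' \<and> b = b'"
        using *(1,2) by (auto simp: S_def A_def cong_def)
    qed
    moreover have "?f ` S i j \<subseteq> S i' j'"
      using that ihash_shift[OF ci] ihash_shift[OF cj]
      by (auto simp: S_def A_def Q_def)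
    ultimately show ?thesis using card_inj_on_le fin by blast
  qed
  have eq: "card (S i' j') = card (S i j)" if "i' \<in> Q" "j' \<in> Q" for i' j'
    using le[OF that, of i j] le[of i j i' j'] that ij by (auto simp: Q_def)
  have hQ: "ihash r a b w \<in> Q" for a b w
  proof -
    have "ihash r a b w = (ihash r a b w + 0) mod 2 ^ r" by (rule ihash_shift) simp
    moreover have "(ihash r a b w + 0) mod 2 ^ r \<in> Q" by (simp add: Q_def)
    ultimately show ?thesis by (simp only:)
  qed
  have un: "A \<times> A = (\<Union>p\<in>Q \<times> Q. S (fst p) (snd p))"
  proof (intro equalityI subsetI)
    fix p assume "p \<in> A \<times> A"
    then have "p \<in> S (ihash r (fst p) (snd p) x) (ihash r (fst p) (snd p) y)"
      by (auto simp: S_def)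
    then show "p \<in> (\<Union>p\<in>Q \<times> Q. S (fst p) (snd p))"
      using hQ by (intro UN_I[of "(ihash r (fst p) (snd p) x, ihash r (fst p) (snd p) y)"]) auto
  qed (auto simp: S_def)
  have "card (\<Union>p\<in>Q \<times> Q. S (fst p) (snd p)) = (\<Sum>p\<in>Q \<times> Q. card (S (fst p) (snd p)))"
  proof (rule card_UN_disjoint)
    show "finite (Q \<times> Q)" by (simp add: Q_def)
    show "\<forall>p\<in>Q \<times> Q. finite (S (fst p) (snd p))" using fin by blast
    show "\<forall>p\<in>Q \<times> Q. \<forall>q\<in>Q \<times> Q. p \<noteq> q \<longrightarrow> S (fst p) (snd p) \<inter> S (fst q) (snd q) = {}"
      by (auto simp: S_def)
  qed
  then have "card (A \<times> A) = (\<Sum>p\<in>Q \<times> Q. card (S (fst p) (snd p)))"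
    unfolding un .
  also have "\<dots> = (\<Sum>p\<in>Q \<times> Q. card (S i j))"
    by (rule sum.cong) (auto intro: eq)
  also have "\<dots> = 2 ^ r * 2 ^ r * card (S i j)"
    by (simp add: Q_def card_cartesian_product nat_power_eq)
  finally have "4 ^ r * 4 ^ r = 4 ^ r * card (S i j)"
    by (simp add: A_def card_cartesian_product nat_power_eq power_mult_distrib[symmetric])
  then show ?thesis unfolding S_def A_def by simp
qed

text \<open>The seed of 4 r bits packs multiplier and offset of \<open>ihash\<close> into one
  number, so that its bits can be fixed one by one from the top.\<close>

definition hash :: "nat \<Rightarrow> nat \<Rightarrow> nat \<Rightarrow> nat" where
  "hash r s x = (((s div 4 ^ r) * x + s mod 4 ^ r) mod 4 ^ r) div 2 ^ r"

lemma hash_less: "hash r s x < 2 ^ r"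
proof -
  have "((s div 4 ^ r) * x + s mod 4 ^ r) mod 4 ^ r < 2 ^ r * (2 ^ r :: nat)"
    by (simp add: power_mult_distrib[symmetric])
  then show ?thesis unfolding hash_def by (simp add: less_mult_imp_div_less)
qed

lemma card_hash_eq:
  assumes "x \<noteq> y" "x < 2 ^ r" "y < 2 ^ r" "i < 2 ^ r" "j < 2 ^ r"
  shows "card {s. s < 16 ^ r \<and> hash r s x = i \<and> hash r s y = j} = 4 ^ r"
proof -
  have ih: "int (hash r s x) = ihash r (int (s div 4 ^ r)) (int (s mod 4 ^ r)) (int x)" for s x
    by (simp add: hash_def ihash_def zdiv_int zmod_int)
  have e: "(16::nat) ^ r = 4 ^ r * 4 ^ r" by (simp add: power_mult_distrib[symmetric])
  let ?T = "{(a, b). a \<in> {0..<4 ^ r} \<and> b \<in> {0..<4 ^ r} \<and> ihash r a b (int x) = int i \<and> ihash r a b (int y) = int j}"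
  have "bij_betw (\<lambda>s. (int (s div 4 ^ r), int (s mod 4 ^ r)))
    {s. s < 16 ^ r \<and> hash r s x = i \<and> hash r s y = j} ?T"
  proof (rule bij_betw_byWitness[where f' = "\<lambda>(a, b). nat a * 4 ^ r + nat b"], goal_cases)
    case 1 show ?case by (auto simp del: of_nat_div of_nat_mod simp add: div_mult_mod_eq)
  next
    case 2 then show ?case by (auto simp: zdiv_int[symmetric] zmod_int[symmetric] nat_less_iff)
  next
    case 3
    then show ?case by (auto simp: ih[symmetric] e less_mult_imp_div_less simp flip: of_nat_div of_nat_mod)
  next
    case 4
    show ?case
    proof (clarify, intro CollectI conjI)
      fix a b :: int assume ab: "a \<in> {0..<4 ^ r}" "b \<in> {0..<4 ^ r}"
        and h: "ihash r a b (int x) = int i" "ihash r a b (int y) = int j"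
      define s where "s = nat a * 4 ^ r + nat b"
      have na: "nat a < 4 ^ r" "nat b < 4 ^ r" using ab by (auto simp: nat_less_iff)
      have sd: "s div 4 ^ r = nat a" "s mod 4 ^ r = nat b" using na by (auto simp: s_def)
      have "Suc (nat a) * 4 ^ r \<le> 4 ^ r * 4 ^ r" using na(1) by (intro mult_le_mono1 Suc_leI)
      then show "nat a * 4 ^ r + nat b < 16 ^ r" using na(2) unfolding e mult_Suc by linarith
      have "int (hash r s x) = int i" "int (hash r s y) = int j"
        unfolding ih sd using ab h by auto
      then show "hash r (nat a * 4 ^ r + nat b) x = i" "hash r (nat a * 4 ^ r + nat b) y = j"
        by (auto simp: s_def)
    qed
  qed
  then have "card {s. s < 16 ^ r \<and> hash r s x = i \<and> hash r s y = j} = card ?T"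
    by (rule bij_betw_same_card)
  also have "\<dots> = 4 ^ r"
    using card_ihash[of "int x" "int y" r "int i" "int j"] assms by simp
  finally show ?thesis .
qed

lemma card_hash:
  assumes "x \<noteq> y" "x < 2 ^ r" "y < 2 ^ r" "I \<subseteq> {..<2 ^ r}" "J \<subseteq> {..<2 ^ r}"
  shows "card {s. s < 16 ^ r \<and> hash r s x \<in> I \<and> hash r s y \<in> J} = card I * card J * 4 ^ r"
proof -
  let ?S = "\<lambda>p. {s. s < 16 ^ r \<and> hash r s x = fst p \<and> hash r s y = snd p}"
  have fin: "finite I" "finite J" using assms finite_subset by blast+
  have "{s. s < 16 ^ r \<and> hash r s x \<in> I \<and> hash r s y \<in> J} = (\<Union>p\<in>I \<times> J. ?S p)" by auto
  then have "card {s. s < 16 ^ r \<and> hash r s x \<in> I \<and> hash r s y \<in> J} = (\<Sum>p\<in>I \<times> J. card (?S p))"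
    by (simp only:) (rule card_UN_disjoint, auto simp: fin)
  also have "\<dots> = (\<Sum>p\<in>I \<times> J. 4 ^ r)"
    by (rule sum.cong) (use assms in \<open>auto intro!: card_hash_eq\<close>)
  finally show ?thesis by (simp add: card_cartesian_product)
qed

section \<open>Linial's color reduction\<close>

lemma card_agreeing_words:
  fixes w :: "nat \<Rightarrow> nat"
  assumes J: "J \<subseteq> {..<t}"
  shows "card {f \<in> {..<t} \<rightarrow>\<^sub>E {..<k}. \<forall>i\<in>J. f i = w i} \<le> k ^ (t - card J)"
proof -
  have fJ: "finite J" using J finite_subset by blast
  let ?B = "\<lambda>i. if i \<in> J then {w i} else {..<k}"
  have sub: "{f \<in> {..<t} \<rightarrow>\<^sub>E {..<k}. \<forall>i\<in>J. f i = w i} \<subseteq> (\<Pi>\<^sub>E i\<in>{..<t}. ?B i)"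
    by (auto simp: PiE_def Pi_def)
  have "card (\<Pi>\<^sub>E i\<in>{..<t}. ?B i) = (\<Prod>i\<in>{..<t}. card (?B i))" by (simp add: card_PiE)
  also have "\<dots> = (\<Prod>i\<in>{..<t} - J. card (?B i)) * (\<Prod>i\<in>J. card (?B i))"
    by (rule prod.subset_diff[OF J]) simp
  also have "\<dots> = k ^ (t - card J)" using J fJ by (simp add: card_Diff_subset)
  finally have "card (\<Pi>\<^sub>E i\<in>{..<t}. ?B i) = k ^ (t - card J)" .
  moreover have "finite (\<Pi>\<^sub>E i\<in>{..<t}. ?B i)" by (intro finite_PiE) auto
  ultimately show ?thesis using card_mono[OF _ sub] by simp
qed

text \<open>A union bound over the j positions of agreement: a word excludes at most the fraction
  \<open>(t / k) ^ j\<close> of all words.\<close>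

lemma card_words_agreeing_often:
  fixes w :: "nat \<Rightarrow> nat"
  assumes "j \<le> t"
  shows "card {f \<in> {..<t} \<rightarrow>\<^sub>E {..<k}. j \<le> card {i \<in> {..<t}. f i = w i}} \<le> t ^ j * k ^ (t - j)"
proof -
  let ?W = "{..<t} \<rightarrow>\<^sub>E {..<k}"
  let ?JJ = "{J. J \<subseteq> {..<t} \<and> card J = j}"
  have fW: "finite ?W" by (intro finite_PiE) auto
  have fJ: "finite ?JJ" by (rule finite_subset[of _ "Pow {..<t}"]) auto
  have "{f \<in> ?W. j \<le> card {i \<in> {..<t}. f i = w i}} \<subseteq> (\<Union>J\<in>?JJ. {f \<in> ?W. \<forall>i\<in>J. f i = w i})"
  proof
    fix f assume f: "f \<in> {f \<in> ?W. j \<le> card {i \<in> {..<t}. f i = w i}}"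
    then have "j \<le> card {i \<in> {..<t}. f i = w i}" by blast
    then obtain J where "J \<subseteq> {i \<in> {..<t}. f i = w i}" "card J = j"
      by (rule obtain_subset_with_card_n)
    then show "f \<in> (\<Union>J\<in>?JJ. {f \<in> ?W. \<forall>i\<in>J. f i = w i})" using f by blast
  qed
  then have "card {f \<in> ?W. j \<le> card {i \<in> {..<t}. f i = w i}}
      \<le> card (\<Union>J\<in>?JJ. {f \<in> ?W. \<forall>i\<in>J. f i = w i})"
    by (rule card_mono[rotated]) (use fJ fW in auto)
  also have "\<dots> \<le> (\<Sum>J\<in>?JJ. card {f \<in> ?W. \<forall>i\<in>J. f i = w i})"
    by (rule card_UN_le[OF fJ])
  also have "\<dots> \<le> (\<Sum>J\<in>?JJ. k ^ (t - j))"
    by (rule sum_mono) (use card_agreeing_words in auto)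
  also have "\<dots> = (t choose j) * k ^ (t - j)" by (simp add: n_subsets)
  also have "\<dots> \<le> t ^ j * k ^ (t - j)" by (simp add: binomial_le_pow[OF assms])
  finally show ?thesis .
qed

text \<open>Words are chosen greedily, as in the Gilbert--Varshamov bound.\<close>

lemma code_exists:
  assumes "j \<le> t" "0 < t" "n \<le> 2 ^ j"
  shows "\<exists>cw :: nat \<Rightarrow> nat \<Rightarrow> nat. (\<forall>x<n. cw x \<in> {..<t} \<rightarrow>\<^sub>E {..<2 * t}) \<and>
    (\<forall>x<n. \<forall>y<n. x \<noteq> y \<longrightarrow> card {i \<in> {..<t}. cw x i = cw y i} < j)"
  using assms(3)
proof (induction n)
  case 0
  then show ?case by simp
next
  case (Suc n)
  let ?W = "{..<t} \<rightarrow>\<^sub>E {..<2 * t}"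
  obtain cw where cw: "\<forall>x<n. cw x \<in> ?W"
    "\<forall>x<n. \<forall>y<n. x \<noteq> y \<longrightarrow> card {i \<in> {..<t}. cw x i = cw y i} < j"
    using Suc by auto
  let ?bad = "\<lambda>x. {f \<in> ?W. j \<le> card {i \<in> {..<t}. f i = cw x i}}"
  have fW: "finite ?W" by (intro finite_PiE) auto
  have "card (\<Union>x\<in>{..<n}. ?bad x) \<le> (\<Sum>x\<in>{..<n}. card (?bad x))"
    by (rule card_UN_le) simp
  also have "\<dots> \<le> (\<Sum>x\<in>{..<n}. t ^ j * (2 * t) ^ (t - j))"
    by (rule sum_mono) (rule card_words_agreeing_often[OF assms(1)])
  also have "\<dots> = n * (t ^ j * (2 * t) ^ (t - j))" by simp
  \<comment> \<open>With alphabet size \<open>2 * t\<close> each earlier word excludes at most the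
    fraction \<open>1 / 2 ^ j\<close>, so fewer than \<open>2 ^ j\<close> words leave one
    free.\<close>
  also have "\<dots> < 2 ^ j * (t ^ j * (2 * t) ^ (t - j))"
    using Suc.prems assms(2) by (intro mult_strict_right_mono) auto
  also have "\<dots> = (2 * t) ^ j * (2 * t) ^ (t - j)" by (simp add: power_mult_distrib)
  also have "\<dots> = (2 * t) ^ t" using assms(1) by (metis le_add_diff_inverse power_add)
  also have "\<dots> = card ?W" by (simp add: card_PiE)
  finally have "card (\<Union>x\<in>{..<n}. ?bad x) < card ?W" .
  then have "\<not> ?W \<subseteq> (\<Union>x\<in>{..<n}. ?bad x)"
    using card_mono[of "\<Union>x\<in>{..<n}. ?bad x" ?W] fW by fastforce
  then obtain f where f: "f \<in> ?W" and nf: "f \<notin> (\<Union>x\<in>{..<n}. ?bad x)" by blast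
  have f2: "card {i \<in> {..<t}. f i = cw x i} < j" if "x < n" for x
  proof (rule ccontr)
    assume "\<not> ?thesis"
    with f that have "f \<in> (\<Union>x\<in>{..<n}. ?bad x)" by (intro UN_I[of x]) auto
    with nf show False by contradiction
  qed
  have f': "\<forall>x<n. card {i \<in> {..<t}. cw x i = f i} < j"
    using f2 by (simp add: eq_commute)
  show ?case
    by (rule exI[of _ "cw(n := f)"]) (use cw f f2 f' in \<open>auto simp: less_Suc_eq\<close>)
qed

section \<open>One step of Linial's reduction\<close>

definition codeword :: "nat \<Rightarrow> nat \<Rightarrow> nat \<Rightarrow> nat \<Rightarrow> nat" where
  "codeword d w = (SOME cw. (\<forall>x<2 ^ w. cw x \<in> {..<d * Suc w} \<rightarrow>\<^sub>E {..<2 * (d * Suc w)}) \<and>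
    (\<forall>x<2 ^ w. \<forall>y<2 ^ w. x \<noteq> y \<longrightarrow> card {i \<in> {..<d * Suc w}. cw x i = cw y i} < Suc w))"

lemma codeword:
  assumes "0 < d"
  shows "x < 2 ^ w \<Longrightarrow> codeword d w x \<in> {..<d * Suc w} \<rightarrow>\<^sub>E {..<2 * (d * Suc w)}"
    "x < 2 ^ w \<Longrightarrow> y < 2 ^ w \<Longrightarrow> x \<noteq> y \<Longrightarrow>
      card {i \<in> {..<d * Suc w}. codeword d w x i = codeword d w y i} < Suc w"
proof -
  have "Suc w \<le> d * Suc w" "0 < d * Suc w" "(2::nat) ^ w \<le> 2 ^ Suc w"
    using assms by (cases d; simp)+
  from someI_ex[OF code_exists[OF this]]
  have c: "(\<forall>x<2 ^ w. codeword d w x \<in> {..<d * Suc w} \<rightarrow>\<^sub>E {..<2 * (d * Suc w)}) \<and>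
    (\<forall>x<2 ^ w. \<forall>y<2 ^ w. x \<noteq> y \<longrightarrow>
      card {i \<in> {..<d * Suc w}. codeword d w x i = codeword d w y i} < Suc w)"
    unfolding codeword_def[symmetric] .
  show "x < 2 ^ w \<Longrightarrow> codeword d w x \<in> {..<d * Suc w} \<rightarrow>\<^sub>E {..<2 * (d * Suc w)}"
    using c by blast
  show "x < 2 ^ w \<Longrightarrow> y < 2 ^ w \<Longrightarrow> x \<noteq> y \<Longrightarrow>
      card {i \<in> {..<d * Suc w}. codeword d w x i = codeword d w y i} < Suc w"
    using c by blast
qed

text \<open>The new color encodes a position together with the symbol there, at which the own
  codeword differs from those of all neighbors. Each of at most d neighbors spoils at most w of the
  \<open>d * Suc w\<close> positions, so one is left.\<close>

definition reduce_color :: "nat \<Rightarrow> nat \<Rightarrow> nat \<Rightarrow> nat set \<Rightarrow> nat" where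
  "reduce_color d w x Y =
     (let i = (LEAST i. i < d * Suc w \<and> (\<forall>y\<in>Y. codeword d w y i \<noteq> codeword d w x i))
      in i * (2 * (d * Suc w)) + codeword d w x i)"

definition reduced_width :: "nat \<Rightarrow> nat \<Rightarrow> nat" where
  "reduced_width d w = bits (2 * (d * Suc w)\<^sup>2)"

lemma reduce_color_index:
  assumes "0 < d" "x < 2 ^ w" "Y \<subseteq> {..<2 ^ w} - {x}" "card Y \<le> d"
  obtains i where "reduce_color d w x Y = i * (2 * (d * Suc w)) + codeword d w x i"
    "i < d * Suc w" "\<forall>y\<in>Y. codeword d w y i \<noteq> codeword d w x i"
proof -
  have fY: "finite Y" using assms(3) finite_subset by blast
  let ?A = "\<lambda>y. {i \<in> {..<d * Suc w}. codeword d w x i = codeword d w y i}"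
  have "card (\<Union>y\<in>Y. ?A y) \<le> (\<Sum>y\<in>Y. card (?A y))" by (rule card_UN_le[OF fY])
  also have "\<dots> \<le> (\<Sum>y\<in>Y. w)"
  proof (rule sum_mono)
    fix y assume "y \<in> Y"
    then have "card (?A y) < Suc w" using assms by (intro codeword) auto
    then show "card (?A y) \<le> w" by simp
  qed
  also have "\<dots> \<le> d * w" using assms(4) by simp
  also have "\<dots> < d * Suc w" using assms(1) by simp
  finally have "card (\<Union>y\<in>Y. ?A y) < card {..<d * Suc w}" by simp
  then have "\<not> {..<d * Suc w} \<subseteq> (\<Union>y\<in>Y. ?A y)"
    using card_mono[of "\<Union>y\<in>Y. ?A y" "{..<d * Suc w}"] fY by fastforce
  then have "\<exists>i. i < d * Suc w \<and> (\<forall>y\<in>Y. codeword d w y i \<noteq> codeword d w x i)" by fastforce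
  from LeastI_ex[OF this] show ?thesis by (intro that) (auto simp: reduce_color_def Let_def)
qed

lemma reduce_color_less:
  assumes "0 < d" "x < 2 ^ w" "Y \<subseteq> {..<2 ^ w} - {x}" "card Y \<le> d"
  shows "reduce_color d w x Y < 2 ^ reduced_width d w"
proof -
  obtain i where i: "reduce_color d w x Y = i * (2 * (d * Suc w)) + codeword d w x i"
    "i < d * Suc w" using reduce_color_index[OF assms] by blast
  have "codeword d w x i < 2 * (d * Suc w)"
    using codeword(1)[OF assms(1,2)] i(2) by (auto simp: PiE_def Pi_def)
  then have "reduce_color d w x Y < Suc i * (2 * (d * Suc w))" using i(1) by simp
  also have "\<dots> \<le> d * Suc w * (2 * (d * Suc w))" using i(2) by (intro mult_right_mono) auto
  also have "\<dots> = 2 * (d * Suc w)\<^sup>2" by (simp add: power2_eq_square)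
  also have "\<dots> < 2 ^ reduced_width d w"
    unfolding reduced_width_def by (rule less_two_power_bits)
  finally show ?thesis .
qed

text \<open>Equal new colors would name the same position and the same symbol, but x has chosen a
  position where its symbol differs from that of y.\<close>

lemma reduce_color_proper:
  assumes d: "0 < d" and x: "x < 2 ^ w" "X \<subseteq> {..<2 ^ w} - {x}" "card X \<le> d"
    and y: "y < 2 ^ w" "Y \<subseteq> {..<2 ^ w} - {y}" "card Y \<le> d" and "y \<in> X"
  shows "reduce_color d w x X \<noteq> reduce_color d w y Y"
proof
  assume eq: "reduce_color d w x X = reduce_color d w y Y"
  obtain i where i: "reduce_color d w x X = i * (2 * (d * Suc w)) + codeword d w x i"
    "i < d * Suc w" "\<forall>y\<in>X. codeword d w y i \<noteq> codeword d w x i"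
    using reduce_color_index[OF d x] by blast
  obtain k where k: "reduce_color d w y Y = k * (2 * (d * Suc w)) + codeword d w y k"
    "k < d * Suc w"
    using reduce_color_index[OF d y] by blast
  have l: "codeword d w x i < 2 * (d * Suc w)" "codeword d w y k < 2 * (d * Suc w)"
    using codeword(1)[OF d x(1)] codeword(1)[OF d y(1)] i(2) k(2) by (auto simp: PiE_def Pi_def)
  define m where "m = 2 * (d * Suc w)"
  have e: "i * m + codeword d w x i = k * m + codeword d w y k"
    using eq i(1) k(1) by (simp add: m_def)
  have "(i * m + codeword d w x i) div m = i" "(k * m + codeword d w y k) div m = k"
    using l unfolding m_def[symmetric] by simp_all
  then have "i = k" using e by simp
  with e i(3) \<open>y \<in> X\<close> show False by auto
qed

lemma reduced_width_mono: "w \<le> w' \<Longrightarrow> reduced_width d w \<le> reduced_width d w'"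
  unfolding reduced_width_def by (intro bits_mono mult_left_mono power_mono) auto

lemma Suc_less_two_power_quarter: "28 \<le> w \<Longrightarrow> Suc w < 2 ^ (w div 4 - 1)"
proof -
  assume "28 \<le> w"
  then have k: "7 \<le> w div 4" by simp
  have "4 * k + 4 < 2 ^ (k - 1)" if "7 \<le> k" for k :: nat
    using that
  proof (induction k rule: nat_induct_at_least)
    case (Suc k)
    then show ?case by (cases k) auto
  qed simp
  from this[OF k] show ?thesis by linarith
qed

text \<open>A step turns w bits into about 2 log d + 2 log w bits. From 28 on, \<open>Suc w\<close>
  is below \<open>2 ^ (w div 4 - 1)\<close>, so that each of the two terms stays within half of
  w.\<close>

lemma reduced_width_less:
  assumes "4 * bits d + 28 \<le> w"
  shows "reduced_width d w < w"
proof -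
  have w: "7 \<le> w div 4" "bits d \<le> w div 4 - 7" using assms by auto
  let ?k = "w div 4"
  have "d * Suc w \<le> 2 ^ bits d * 2 ^ (?k - 1)"
    using less_two_power_bits[of d] Suc_less_two_power_quarter[of w] assms by (intro mult_mono) auto
  then have "(d * Suc w)\<^sup>2 \<le> (2 ^ bits d * 2 ^ (?k - 1))\<^sup>2" by (intro power_mono) auto
  then have "2 * (d * Suc w)\<^sup>2 \<le> 2 * (2 ^ (bits d + (?k - 1)))\<^sup>2" by (simp add: power_add)
  also have "\<dots> = 2 ^ (1 + 2 * (bits d + (?k - 1)))" by (simp add: power_mult[symmetric] mult.commute)
  also have "\<dots> < 2 ^ (2 + 2 * (bits d + (?k - 1)))" by simp
  finally have "reduced_width d w \<le> 2 + 2 * (bits d + (?k - 1))"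
    unfolding reduced_width_def by (rule bits_le)
  then show ?thesis using w div_times_less_eq_dividend[of w 4] by arith
qed

text \<open>Above the bound a step saves at least one bit, and below it monotonicity keeps the width
  there. The w = O(log n) steps this takes are of the order of the number of coloring
  iterations.\<close>

lemma reduced_width_iterate_le:
  "(reduced_width d ^^ i) w \<le> max (4 * bits d + 28) (w - i)"
proof (induction i)
  case (Suc i)
  let ?B = "4 * bits d + 28" and ?v = "(reduced_width d ^^ i) w"
  show ?case
  proof (cases "?v \<le> ?B")
    case True
    then have "reduced_width d ?v \<le> reduced_width d ?B" by (rule reduced_width_mono)
    also have "\<dots> < ?B" by (rule reduced_width_less) simp
    finally show ?thesis by simp
  next
    case False
    then have "reduced_width d ?v < ?v" by (intro reduced_width_less) simp
    then show ?thesis using Suc False by simp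
  qed
qed simp

section \<open>Resolving conflicts and derandomized choice of one bit\<close>

text \<open>Each unordered conflict is charged to its smaller endpoint, so at most
  \<open>card E / 2\<close> nodes give way, which is at most three quarters of
  \<open>U\<close>.\<close>

lemma card_keep_larger:
  fixes U :: "nat set"
  assumes U: "finite U" and E: "E \<subseteq> U \<times> U" "sym E" "irrefl E"
    and c: "2 * card E \<le> 3 * card U"
  shows "card U \<le> 4 * card {v \<in> U. \<forall>u. (v, u) \<in> E \<longrightarrow> u < v}"
proof -
  let ?K = "{v \<in> U. \<forall>u. (v, u) \<in> E \<longrightarrow> u < v}"
  let ?A = "{(v, u) \<in> E. v < u}" and ?B = "{(v, u) \<in> E. u < v}"
  have fE: "finite E" using E(1) U by (simp add: finite_subset)
  have fA: "finite ?A" and fB: "finite ?B" by (rule finite_subset[OF _ fE], auto)+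
  have "bij_betw prod.swap ?A ?B"
    by (rule bij_betwI[where g = prod.swap]) (use E(2) in \<open>auto dest: symD\<close>)
  then have "card ?A = card ?B" by (rule bij_betw_same_card)
  moreover have EAB: "E = ?A \<union> ?B"
  proof (intro equalityI subsetI)
    fix p assume p: "p \<in> E"
    obtain v u where vu: "p = (v, u)" by (cases p)
    have "v \<noteq> u" using p vu E(3) by (auto simp: irrefl_def)
    then show "p \<in> ?A \<union> ?B" using p vu by auto
  qed auto
  have "card (?A \<union> ?B) = card ?A + card ?B"
    by (rule card_Un_disjoint[OF fA fB]) auto
  then have "card E = card ?A + card ?B" using EAB by argo
  ultimately have cA: "card E = 2 * card ?A" by simp
  have "U - ?K \<subseteq> fst ` ?A"
  proof
    fix v assume "v \<in> U - ?K"
    then obtain u where "(v, u) \<in> E" "\<not> u < v" by auto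
    moreover then have "u \<noteq> v" using E(3) by (auto simp: irrefl_def)
    ultimately have "(v, u) \<in> ?A" by auto
    then show "v \<in> fst ` ?A" by force
  qed
  then have "card (U - ?K) \<le> card ?A" using surj_card_le[OF fA] by blast
  moreover have "card (U - ?K) = card U - card ?K" using U by (intro card_Diff_subset) auto
  ultimately show ?thesis using cA c by linarith
qed

section \<open>One bit with rounded probabilities\<close>

definition choose_bit :: "nat \<Rightarrow> nat \<Rightarrow> nat \<Rightarrow> nat \<Rightarrow> nat \<Rightarrow> bool" where
  "choose_bit r x a b s \<longleftrightarrow> hash r s x < (2 ^ r * b) div (a + b)"

lemma real_div_ge: "0 < k \<Longrightarrow> real m / real k \<le> real (m div k) + 1"
proof -
  assume k: "0 < k"
  then have "m \<le> (m div k + 1) * k"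
    by (metis Suc_eq_plus1 dividend_less_div_times less_imp_le mult_Suc add.commute)
  then have "real m \<le> real ((m div k + 1) * k)" by (simp only: of_nat_le_iff)
  then have "real m \<le> (real (m div k) + 1) * real k" by (simp only: of_nat_mult of_nat_add of_nat_1)
  then show ?thesis using k by (simp add: divide_le_eq)
qed

lemma threshold_le: "(2 ^ r * b) div (a + b) \<le> (2::nat) ^ r"
proof (cases "a + b = 0")
  case False
  have "(2 ^ r * b) div (a + b) \<le> (2 ^ r * (a + b)) div (a + b)" by (intro div_le_mono mult_left_mono) auto
  with False show ?thesis by simp
qed simp

text \<open>Rounding never drives a node into an empty half: for b = 0 the threshold is 0, and for a
  = 0 it exceeds all hash values.\<close>

lemma choose_bit_pos:
  assumes "0 < a + b"
  shows "0 < (if choose_bit r x a b s then b else a)"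
proof (cases "choose_bit r x a b s")
  case True
  then show ?thesis by (cases b) (auto simp: choose_bit_def)
next
  case False
  have "a \<noteq> 0"
  proof
    assume "a = 0"
    then have "choose_bit r x a b s" using assms hash_less[of r s x] by (simp add: choose_bit_def)
    with False show False by simp
  qed
  with False show ?thesis by simp
qed

text \<open>For either bit, its probability divided by the number of colors it leaves is about
  \<open>1 / (a + b)\<close>. By independence the probabilities of the two bits of the neighbor then
  add up to 1, whatever they are. The summand 1 pays for the rounded threshold.\<close>

lemma sum_same_bit_le:
  fixes x y r a b a' b' :: nat
  assumes xy: "x \<noteq> y" "x < 2 ^ r" "y < 2 ^ r" and ab: "0 < a + b"
  defines "c \<equiv> \<lambda>s. choose_bit r x a b s" and "c' \<equiv> \<lambda>s. choose_bit r y a' b' s"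
  shows "(\<Sum>s<16 ^ r. (if c s = c' s then 2 ^ r / real (if c s then b else a) else 0))
    \<le> 16 ^ r * (2 ^ r / real (a + b) + 1)"
proof -
  define q where "q = (2::nat) ^ r"
  define T where "T = (q * b) div (a + b)"
  define T' where "T' = (q * b') div (a' + b')"
  have Tq: "T \<le> q" "T' \<le> q" unfolding T_def T'_def q_def by (rule threshold_le)+
  have q0: "0 < q" by (simp add: q_def)
  have e16: "(16::real) ^ r = 4 ^ r * (real q * real q)"
    by (simp add: q_def power_mult_distrib[symmetric])
  have s1: "c s \<longleftrightarrow> hash r s x \<in> {..<T}" "c' s \<longleftrightarrow> hash r s y \<in> {..<T'}"
    "\<not> c s \<longleftrightarrow> hash r s x \<in> {T..<q}" "\<not> c' s \<longleftrightarrow> hash r s y \<in> {T'..<q}" for s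
    using hash_less[of r s x] hash_less[of r s y]
    by (auto simp: c_def c'_def choose_bit_def T_def T'_def q_def)
  have c1: "card {s. s < 16 ^ r \<and> c s \<and> c' s} = T * T' * 4 ^ r"
    unfolding s1(1,2) using card_hash[OF xy, of "{..<T}" "{..<T'}"] Tq by (auto simp: q_def)
  have c0: "card {s. s < 16 ^ r \<and> \<not> c s \<and> \<not> c' s} = (q - T) * (q - T') * 4 ^ r"
  proof -
    have "{T..<q} \<subseteq> {..<2 ^ r}" "{T'..<q} \<subseteq> {..<2 ^ r}" by (auto simp: q_def)
    from card_hash[OF xy this] show ?thesis unfolding s1(3,4) by simp
  qed
  have "(\<Sum>s<16 ^ r. (if c s = c' s then 2 ^ r / real (if c s then b else a) else 0))
    = (\<Sum>s<16 ^ r. (if c s \<and> c' s then real q / real b else 0) + (if \<not> c s \<and> \<not> c' s then real q / real a else 0))"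
    by (rule sum.cong) (auto simp: q_def)
  also have "\<dots> = real (card {s. s < 16 ^ r \<and> c s \<and> c' s}) * (real q / real b)
      + real (card {s. s < 16 ^ r \<and> \<not> c s \<and> \<not> c' s}) * (real q / real a)"
    by (simp add: sum.distrib sum.If_cases Int_def)
  also have "\<dots> = 4 ^ r * real q * (real T' * (real T / real b) + (real q - real T') * ((real q - real T) / real a))"
    unfolding c1 c0 using Tq by (simp add: of_nat_diff field_simps)
  \<comment> \<open>For bit 1, rounding down errs in the right direction; for bit 0 the error is at
    most \<open>1 / a\<close>, hence at most 1. For an empty half the quotient is 0, as division by
    zero yields 0.\<close>
  also have "\<dots> \<le> 4 ^ r * real q * (real T' * (real q / real (a + b)) + (real q - real T') * (real q / real (a + b) + 1))"
  proof (intro mult_left_mono add_mono)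
    have Tle: "real T \<le> real q * real b / real (a + b)"
      unfolding T_def using of_nat_div_le_of_nat[of "q * b" "a + b", where 'a = real] by simp
    show "real T / real b \<le> real q / real (a + b)"
    proof (cases "b = 0")
      case False
      then have "real T / real b \<le> (real q * real b / real (a + b)) / real b"
        using Tle by (intro divide_right_mono) auto
      then show ?thesis using False by simp
    qed simp
    show "(real q - real T) / real a \<le> real q / real (a + b) + 1"
    proof (cases "a = 0")
      case False
      have "real q * real b / real (a + b) < real T + 1"
      proof -
        have "q * b < (T + 1) * (a + b)"
          using ab unfolding T_def by (metis Suc_eq_plus1 dividend_less_div_times mult_Suc add.commute)
        then have "real (q * b) < real ((T + 1) * (a + b))" by (simp only: of_nat_less_iff)
        then have "real q * real b < (real T + 1) * real (a + b)" by (simp only: of_nat_mult of_nat_add of_nat_1)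
        moreover have "0 < real (a + b)" using ab by (simp only: of_nat_0_less_iff)
        ultimately show ?thesis by (simp only: pos_divide_less_eq)
      qed
      moreover have "real q - real q * real b / real (a + b) = real q * real a / real (a + b)"
      proof -
        have "real a + real b \<noteq> 0" using ab by (simp only: of_nat_add[symmetric] of_nat_eq_0_iff)
        then show ?thesis by (simp add: field_simps)
      qed
      ultimately have "real q - real T \<le> real q * real a / real (a + b) + 1" by linarith
      then have "(real q - real T) / real a \<le> (real q * real a / real (a + b) + 1) / real a"
        by (intro divide_right_mono) auto
      also have "\<dots> = real q / real (a + b) + 1 / real a" using False by (simp add: add_divide_distrib)
      also have "\<dots> \<le> real q / real (a + b) + 1" using False by simp
      finally show ?thesis .
    qed simp
  qed (use Tq in auto)
  also have "\<dots> = 4 ^ r * real q * (real q * (real q / real (a + b)) + (real q - real T'))"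
  proof -
    have "real T' * z + (real q - real T') * (z + 1) = real q * z + (real q - real T')" for z
      by (simp add: algebra_simps)
    then show ?thesis by (simp only:)
  qed
  also have "\<dots> \<le> 4 ^ r * real q * (real q * (real q / real (a + b)) + real q)"
    by (intro mult_left_mono add_left_mono) auto
  also have "\<dots> = 16 ^ r * (2 ^ r / real (a + b) + 1)"
    unfolding e16 by (simp add: q_def algebra_simps)
  finally show ?thesis .
qed

text \<open>The terms of the potential are scaled and rounded to integers, so that their sums fit into messages and
  conditional expectations are compared exactly.\<close>

definition conflict_weight :: "nat \<Rightarrow> (nat \<Rightarrow> nat) \<Rightarrow> (nat \<Rightarrow> nat) \<Rightarrow> (nat \<Rightarrow> nat) \<Rightarrow> nat set \<Rightarrow> nat \<Rightarrow> nat \<Rightarrow> nat" where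
  "conflict_weight r lc n0 n1 S v s =
     (2 ^ r * card {u \<in> S. choose_bit r (lc u) (n0 u) (n1 u) s = choose_bit r (lc v) (n0 v) (n1 v) s})
       div (if choose_bit r (lc v) (n0 v) (n1 v) s then n1 v else n0 v)"

text \<open>One phase detached from the network: uncolored nodes \<open>U\<close>, ordered pairs
  \<open>E\<close> of neighbors with equal prefixes, hash keys \<open>lc\<close>, and the numbers
  \<open>n0\<close>, \<open>n1\<close> of colors left with next bit 0 and 1.\<close>

locale one_bit =
  fixes U :: "nat set" and E :: "(nat \<times> nat) set" and lc n0 n1 :: "nat \<Rightarrow> nat" and r :: nat
  assumes finU: "finite U" and EU: "E \<subseteq> U \<times> U"
    and lc: "\<And>v. v \<in> U \<Longrightarrow> lc v < 2 ^ r" "\<And>v u. (v, u) \<in> E \<Longrightarrow> lc v \<noteq> lc u"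
    and pos: "\<And>v. v \<in> U \<Longrightarrow> 0 < n0 v + n1 v"
begin

definition bit :: "nat \<Rightarrow> nat \<Rightarrow> bool" where
  "bit s v = choose_bit r (lc v) (n0 v) (n1 v) s"

definition size_after :: "nat \<Rightarrow> nat \<Rightarrow> nat" where
  "size_after s v = (if bit s v then n1 v else n0 v)"

definition weight :: "nat \<Rightarrow> nat" where
  "weight s = (\<Sum>v\<in>U. conflict_weight r lc n0 n1 {u. (v, u) \<in> E} v s)"

lemma finE: "finite E" using EU finU by (simp add: finite_subset)

lemma finN: "finite {u. (v, u) \<in> E}"
  using finite_imageI[OF finE, of snd] by (rule rev_finite_subset) force

lemma size_after_pos: "v \<in> U \<Longrightarrow> 0 < size_after s v"
  using choose_bit_pos[OF pos] by (simp add: size_after_def bit_def)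

lemma sum_edges: "(\<Sum>(v, u)\<in>E. f v u) = (\<Sum>v\<in>U. \<Sum>u\<in>{u. (v, u) \<in> E}. f v u)"
proof -
  have "E = Sigma U (\<lambda>v. {u. (v, u) \<in> E})" using EU by auto
  then show ?thesis using sum.Sigma[OF finU, of "\<lambda>v. {u. (v, u) \<in> E}" f] finN by auto
qed

lemma card_same_bit:
  "real (2 ^ r * card {u \<in> {u. (v, u) \<in> E}. bit s u = bit s v}) / real (size_after s v) =
    (\<Sum>u\<in>{u. (v, u) \<in> E}. if bit s v = bit s u then 2 ^ r / real (size_after s v) else 0)"
proof -
  have "{u \<in> {u. (v, u) \<in> E}. bit s u = bit s v} = {u. (v, u) \<in> E} \<inter> {u. bit s v = bit s u}" by auto
  then show ?thesis using finN[of v] by (simp add: sum.If_cases del: Int_Collect)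
qed

lemma conflict_weight_eq:
  "conflict_weight r lc n0 n1 {u. (v, u) \<in> E} v s =
    (2 ^ r * card {u \<in> {u. (v, u) \<in> E}. bit s u = bit s v}) div size_after s v"
  by (simp add: conflict_weight_def bit_def size_after_def)

text \<open>Integer division only lowers the weights, so \<open>card E\<close> stems from the
  thresholds alone, one unit per ordered pair and seed.\<close>

lemma sum_weight_le:
  "real (\<Sum>s<16 ^ r. weight s) \<le> 16 ^ r * (2 ^ r * (\<Sum>(v, u)\<in>E. 1 / real (n0 v + n1 v)) + card E)"
proof -
  have "real (\<Sum>s<16 ^ r. weight s) \<le>
      (\<Sum>s<16 ^ r. \<Sum>v\<in>U. \<Sum>u\<in>{u. (v, u) \<in> E}. if bit s v = bit s u then 2 ^ r / real (size_after s v) else 0)"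
    unfolding weight_def of_nat_sum
    by (intro sum_mono) (simp only: card_same_bit[symmetric] conflict_weight_eq of_nat_div_le_of_nat)
  also have "\<dots> = (\<Sum>s<16 ^ r. \<Sum>(v, u)\<in>E. if bit s v = bit s u then 2 ^ r / real (size_after s v) else 0)"
    by (simp only: sum_edges)
  also have "\<dots> = (\<Sum>(v, u)\<in>E. \<Sum>s<16 ^ r. if bit s v = bit s u then 2 ^ r / real (size_after s v) else 0)"
    unfolding case_prod_unfold by (rule sum.swap)
  also have "\<dots> \<le> (\<Sum>(v, u)\<in>E. 16 ^ r * (2 ^ r / real (n0 v + n1 v) + 1))"
  proof (intro sum_mono, clarify)
    fix v u assume vu: "(v, u) \<in> E"
    then have "v \<in> U" "u \<in> U" using EU by auto
    then show "(\<Sum>s<16 ^ r. if bit s v = bit s u then 2 ^ r / real (size_after s v) else 0)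
      \<le> 16 ^ r * (2 ^ r / real (n0 v + n1 v) + 1)"
      unfolding bit_def size_after_def using vu lc pos
      by (intro sum_same_bit_le) auto
  qed
  also have "\<dots> = 16 ^ r * (\<Sum>(v, u)\<in>E. 2 ^ r * (1 / real (n0 v + n1 v)) + 1)"
    by (simp add: sum_distrib_left case_prod_unfold)
  also have "(\<Sum>(v, u)\<in>E. 2 ^ r * (1 / real (n0 v + n1 v)) + 1) =
      2 ^ r * (\<Sum>(v, u)\<in>E. 1 / real (n0 v + n1 v)) + card E"
    unfolding case_prod_unfold by (simp only: sum.distrib sum_distrib_left) simp
  finally show ?thesis .
qed

text \<open>In this direction integer division works against the bound and costs at most one unit
  per node, hence \<open>card U\<close>.\<close>

lemma conflicts_after_le:
  "(\<Sum>(v, u)\<in>{(v, u) \<in> E. bit s v = bit s u}. 1 / real (size_after s v)) \<le> (real (weight s) + card U) / 2 ^ r"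
proof -
  have "(\<Sum>(v, u)\<in>{(v, u) \<in> E. bit s v = bit s u}. 1 / real (size_after s v)) =
    (\<Sum>(v, u)\<in>E. if bit s v = bit s u then 1 / real (size_after s v) else 0)"
    using finE by (simp add: sum.inter_filter[symmetric] case_prod_unfold)
  also have "\<dots> = (\<Sum>v\<in>U. \<Sum>u\<in>{u. (v, u) \<in> E}. if bit s v = bit s u then 1 / real (size_after s v) else 0)"
    by (simp only: sum_edges)
  finally have "2 ^ r * (\<Sum>(v, u)\<in>{(v, u) \<in> E. bit s v = bit s u}. 1 / real (size_after s v)) =
    (\<Sum>v\<in>U. \<Sum>u\<in>{u. (v, u) \<in> E}. if bit s v = bit s u then 2 ^ r / real (size_after s v) else 0)"
    by (simp add: sum_distrib_left if_distrib cong: if_cong)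
  also have "\<dots> \<le> (\<Sum>v\<in>U. real (conflict_weight r lc n0 n1 {u. (v, u) \<in> E} v s) + 1)"
    by (intro sum_mono) (simp only: card_same_bit[symmetric] conflict_weight_eq real_div_ge size_after_pos)
  also have "\<dots> = real (weight s) + card U" by (simp add: weight_def sum.distrib)
  finally show ?thesis by (simp add: field_simps)
qed

text \<open>A seed of at most average weight does as well as the expectation, up to the two rounding
  errors, scaled back by \<open>2 ^ r\<close>. The hypothesis avoids fractions by multiplying with
  the number of seeds.\<close>

lemma potential_step:
  assumes "weight s * 16 ^ r \<le> (\<Sum>s<16 ^ r. weight s)"
  shows "(\<Sum>(v, u)\<in>{(v, u) \<in> E. bit s v = bit s u}. 1 / real (size_after s v))
    \<le> (\<Sum>(v, u)\<in>E. 1 / real (n0 v + n1 v)) + (real (card E) + card U) / 2 ^ r"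
proof -
  have "real (weight s) * 16 ^ r = real (weight s * 16 ^ r)" by simp
  also have "\<dots> \<le> real (\<Sum>s<16 ^ r. weight s)" using assms by (simp only: of_nat_le_iff)
  also have "\<dots> \<le> 16 ^ r * (2 ^ r * (\<Sum>(v, u)\<in>E. 1 / real (n0 v + n1 v)) + card E)" by (rule sum_weight_le)
  also have "\<dots> = (2 ^ r * (\<Sum>(v, u)\<in>E. 1 / real (n0 v + n1 v)) + card E) * 16 ^ r" by (rule mult.commute)
  finally have "real (weight s) * 16 ^ r \<le> \<dots>" .
  then have "real (weight s) \<le> 2 ^ r * (\<Sum>(v, u)\<in>E. 1 / real (n0 v + n1 v)) + card E"
    by (rule mult_right_le_imp_le) simp
  then have "(real (weight s) + card U) / 2 ^ r \<le>
      (2 ^ r * (\<Sum>(v, u)\<in>E. 1 / real (n0 v + n1 v)) + card E + card U) / 2 ^ r"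
    by (intro divide_right_mono) auto
  also have "\<dots> = (\<Sum>(v, u)\<in>E. 1 / real (n0 v + n1 v)) + (real (card E) + card U) / 2 ^ r"
    by (simp add: add_divide_distrib)
  finally show ?thesis using conflicts_after_le[of s] by linarith
qed

end

section \<open>Round-based protocols\<close>

type_synonym 's round = "(node_input \<Rightarrow> 's \<Rightarrow> nat \<Rightarrow> nat) \<times> (node_input \<Rightarrow> 's \<Rightarrow> (nat \<Rightarrow> nat) \<Rightarrow> 's)"

definition encode :: "nat \<Rightarrow> nat \<Rightarrow> message" where
  "encode W x = map (Bit_Operations.bit x) [0..<W]"

definition decode :: "message \<Rightarrow> nat" where
  "decode m = horner_sum of_bool 2 m"

lemma decode_encode: "decode (encode W x) = x mod 2 ^ W"
  unfolding decode_def encode_def horner_sum_bit_eq_take_bit by (simp add: take_bit_eq_mod)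

lemma decode_Nil [simp]: "decode [] = 0"
  by (simp add: decode_def)

text \<open>Values are sent modulo \<open>2 ^ W\<close>: the bandwidth is respected even by the meaningless messages of failed
  attempts.\<close>

definition run_round :: "nat \<Rightarrow> (nat \<Rightarrow> node_input) \<Rightarrow> 's round \<Rightarrow> (nat \<Rightarrow> 's) \<Rightarrow> nat \<Rightarrow> 's" where
  "run_round W I rd c v = snd rd (I v) (c v)
     (\<lambda>u. if u \<in> neighbor_ids (I v) then fst rd (I u) (c u) v mod 2 ^ W else 0)"

abbreviation run_rounds :: "nat \<Rightarrow> (nat \<Rightarrow> node_input) \<Rightarrow> 's round list \<Rightarrow> (nat \<Rightarrow> 's) \<Rightarrow> nat \<Rightarrow> 's" where
  "run_rounds W I \<equiv> fold (run_round W I)"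

text \<open>The model gives a node its inboxes but no memory, so the state is replayed from the
  whole history.\<close>

definition state_after ::
  "(nat \<Rightarrow> 's round) \<Rightarrow> (node_input \<Rightarrow> 's) \<Rightarrow> node_input \<Rightarrow> inbox list \<Rightarrow> 's" where
  "state_after sched init I h =
     fold (\<lambda>k s. snd (sched k) I s (\<lambda>u. decode ((h ! k) u))) [0..<length h] (init I)"

lemma state_after_Nil [simp]: "state_after sched init I [] = init I"
  by (simp add: state_after_def)

lemma state_after_snoc [simp]:
  "state_after sched init I (h @ [ib]) =
    snd (sched (length h)) I (state_after sched init I h) (\<lambda>u. decode (ib u))"
proof -
  have "fold (\<lambda>k s. snd (sched k) I s (\<lambda>u. decode (((h @ [ib]) ! k) u))) [0..<length h] (init I) =
    fold (\<lambda>k s. snd (sched k) I s (\<lambda>u. decode ((h ! k) u))) [0..<length h] (init I)"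
    by (rule fold_cong) (auto simp: nth_append)
  then show ?thesis by (simp add: state_after_def)
qed

definition protocol ::
  "nat \<Rightarrow> (global_params \<Rightarrow> nat \<Rightarrow> 's round) \<Rightarrow> (global_params \<Rightarrow> node_input \<Rightarrow> 's) \<Rightarrow>
    (global_params \<Rightarrow> node_input \<Rightarrow> 's \<Rightarrow> nat option) \<Rightarrow> algorithm" where
  "protocol \<gamma> sched init out =
     \<lparr>send = \<lambda>P I h v. encode (log_bits \<gamma> (num_nodes P))
         (fst (sched P (length h)) I (state_after (sched P) (init P) I h) v),
      color_output = \<lambda>P I h. out P I (state_after (sched P) (init P) I h)\<rparr>"

lemma protocol_respects_bandwidth: "respects_bandwidth \<gamma> (protocol \<gamma> sched init out) G C L"
  by (auto simp: respects_bandwidth_def message_at_def protocol_def encode_def params_of_def)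

lemma length_history [simp]: "length (history A G C L t v) = t"
  by (induction t arbitrary: v) auto

text \<open>This turns executions of the model into folds over lists of rounds. The empty message of
  a non-neighbor decodes to 0, in agreement with \<open>run_round\<close>.\<close>

lemma state_after_history:
  fixes G C L
  defines "P \<equiv> params_of G C" and "I \<equiv> input_of G L"
  shows "state_after (sched P) (init P) (I v) (history (protocol \<gamma> sched init out) G C L t v) =
    run_rounds (log_bits \<gamma> (card (pverts G))) I (map (sched P) [0..<t]) (\<lambda>v. init P (I v)) v"
proof (induction t arbitrary: v)
  case 0
  then show ?case by simp
next
  case (Suc t)
  have "num_nodes P = card (pverts G)" by (simp add: P_def params_of_def)
  moreover have "neighbor_ids (I v) = neighbors G v" by (simp add: I_def input_of_def)
  ultimately show ?case
    using Suc.IH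
    by (auto simp: run_round_def P_def I_def protocol_def decode_encode if_distrib[of decode] cong: if_cong)
qed

lemma output_at_protocol:
  fixes G C L
  defines "P \<equiv> params_of G C" and "I \<equiv> input_of G L"
  shows "output_at (protocol \<gamma> sched init out) G C L t v = out P (I v)
    (run_rounds (log_bits \<gamma> (card (pverts G))) I (map (sched P) [0..<t]) (\<lambda>v. init P (I v)) v)"
  using state_after_history[of sched G C init L v \<gamma> out t]
  by (simp add: output_at_def P_def I_def protocol_def)

section \<open>Aggregation over a spanning tree\<close>

record 'm node_state =
  leader :: nat
  parent :: nat
  acc :: nat
  bcast :: nat
  ready :: bool
  result :: "nat option"
  inner :: 'm

definition fresh :: "(node_input \<Rightarrow> 'm) \<Rightarrow> node_input \<Rightarrow> 'm node_state" where
  "fresh init I = \<lparr>leader = own_id I, parent = own_id I, acc = 0, bcast = 0, ready = False,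
     result = None, inner = init I\<rparr>"

definition local_round :: "(node_input \<Rightarrow> 's \<Rightarrow> 's) \<Rightarrow> 's round" where
  "local_round f = (\<lambda>_ _ _. 0, \<lambda>I s _. f I s)"

text \<open>A pointer changes only when the leader strictly decreases, so a node that knows the
  minimum keeps its parent forever.\<close>

definition elect_round :: "'m node_state round" where
  "elect_round = (\<lambda>I s v. leader s,
     \<lambda>I s ib. if \<exists>u\<in>neighbor_ids I. ib u < leader s
       then let u = arg_min_on ib (neighbor_ids I) in s\<lparr>leader := ib u, parent := u\<rparr> else s)"

text \<open>A non-root hands on all it holds and keeps nothing, so the values move up in lockstep
  and only roots accumulate.\<close>

definition push_round :: "'m node_state round" where
  "push_round = (\<lambda>I s v. if v = parent s then acc s else 0,
     \<lambda>I s ib. s\<lparr>acc := (if parent s = own_id I then acc s else 0) + (\<Sum>u\<in>neighbor_ids I. ib u)\<rparr>)"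

definition pull_round :: "'m node_state round" where
  "pull_round = (\<lambda>I s v. bcast s,
     \<lambda>I s ib. s\<lparr>bcast := if parent s = own_id I then bcast s else ib (parent s)\<rparr>)"

definition aggregate_rounds :: "nat \<Rightarrow> (node_input \<Rightarrow> 'm \<Rightarrow> nat) \<Rightarrow>
    (node_input \<Rightarrow> 'm node_state \<Rightarrow> nat \<Rightarrow> 'm node_state) \<Rightarrow> 'm node_state round list" where
  "aggregate_rounds R f g =
     [local_round (\<lambda>I s. s\<lparr>acc := f I (inner s)\<rparr>)] @ replicate R push_round @
     [local_round (\<lambda>I s. s\<lparr>bcast := acc s\<rparr>)] @ replicate R pull_round @
     [local_round (\<lambda>I s. g I s (bcast s))]"

lemma replicate_Suc_snoc: "replicate (Suc t) x = replicate t x @ [x]"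
  by (simp add: replicate_append_same)

locale network =
  fixes V :: "nat set" and I :: "nat \<Rightarrow> node_input" and W :: nat
  assumes finV: "finite V"
    and own_id: "v \<in> V \<Longrightarrow> own_id (I v) = v"
    and nbrs: "v \<in> V \<Longrightarrow> neighbor_ids (I v) \<subseteq> V"
    and nbrs_irrefl: "v \<in> V \<Longrightarrow> v \<notin> neighbor_ids (I v)"
    and nbrs_sym: "v \<in> V \<Longrightarrow> u \<in> neighbor_ids (I v) \<Longrightarrow> v \<in> neighbor_ids (I u)"
begin

abbreviation nb :: "nat \<Rightarrow> nat set" where "nb v \<equiv> neighbor_ids (I v)"

abbreviation run :: "'s round list \<Rightarrow> (nat \<Rightarrow> 's) \<Rightarrow> nat \<Rightarrow> 's" where
  "run \<equiv> run_rounds W I"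

text \<open>Only locality of the pointers is demanded. The facts about pushing and pulling speak of
  iterates of p and hold even where these never reach a root.\<close>

definition forest :: "(nat \<Rightarrow> nat) \<Rightarrow> bool" where
  "forest p \<longleftrightarrow> (\<forall>v\<in>V. p v \<in> insert v (nb v))"

lemma forest_in: "forest p \<Longrightarrow> v \<in> V \<Longrightarrow> p v \<in> V"
  using nbrs[of v] unfolding forest_def by fastforce

lemma forest_funpow_in: "forest p \<Longrightarrow> v \<in> V \<Longrightarrow> (p ^^ t) v \<in> V"
  by (induction t) (auto intro: forest_in)

lemma fin_nb: "v \<in> V \<Longrightarrow> finite (nb v)"
  using nbrs finV finite_subset by blast

lemma run_local: "run_round W I (local_round f) c v = f (I v) (c v)"
  by (simp add: run_round_def local_round_def)

lemma run_append: "run (xs @ ys) c = run ys (run xs c)"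
  by simp

lemma funpow_cong_on:
  assumes "forest p" "\<And>v. v \<in> V \<Longrightarrow> p' v = p v" "v \<in> V"
  shows "(p' ^^ t) v = (p ^^ t) v"
  by (induction t) (use assms forest_funpow_in in auto)

text \<open>\<open>(p ^^ t) u\<close> is the place to which the value of u has moved after t rounds.
  The bound on the total makes every partial sum survive the reduction modulo
  \<open>2 ^ W\<close>.\<close>

lemma run_push:
  fixes c :: "nat \<Rightarrow> 'm node_state"
  defines "p \<equiv> \<lambda>v. parent (c v)"
  assumes p: "forest p" and small: "(\<Sum>u\<in>V. acc (c u)) < 2 ^ W" and "v \<in> V"
  shows "run (replicate t push_round) c v = (c v)\<lparr>acc := \<Sum>u\<in>{u\<in>V. (p ^^ t) u = v}. acc (c u)\<rparr>"
  using \<open>v \<in> V\<close>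
proof (induction t arbitrary: v)
  case 0
  have "{u \<in> V. u = v} = {v}" using 0 by auto
  then show ?case by simp
next
  case (Suc t)
  define d where "d = run (replicate t push_round) c"
  define X where "X = (\<lambda>v. \<Sum>u\<in>{u\<in>V. (p ^^ t) u = v}. acc (c u))"
  have d: "d w = (c w)\<lparr>acc := X w\<rparr>" if "w \<in> V" for w
    using Suc.IH[OF that] by (simp add: d_def X_def)
  have X_small: "X w < 2 ^ W" for w
  proof -
    have "X w \<le> (\<Sum>u\<in>V. acc (c u))"
      unfolding X_def using finV by (intro sum_mono2) auto
    then show ?thesis using small by simp
  qed
  have nbv: "u \<in> V" if "u \<in> nb v" for u using nbrs Suc.prems that by blast
  have "(\<Sum>u\<in>nb v. (if v = parent (d u) then acc (d u) else 0) mod 2 ^ W) = (\<Sum>u\<in>nb v. if p u = v then X u else 0)"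
    by (rule sum.cong) (use nbv d X_small in \<open>auto simp: p_def\<close>)
  also have "\<dots> = (\<Sum>u\<in>{u \<in> nb v. p u = v}. X u)"
    using fin_nb[OF Suc.prems] by (simp add: sum.inter_filter)
  finally have s1: "(\<Sum>u\<in>nb v. (if v = parent (d u) then acc (d u) else 0) mod 2 ^ W) = (\<Sum>u\<in>{u \<in> nb v. p u = v}. X u)" .
  have children: "{u \<in> V. p u = v} = {u \<in> nb v. p u = v} \<union> (if p v = v then {v} else {})"
  proof (intro equalityI subsetI)
    fix u assume u: "u \<in> {u \<in> V. p u = v}"
    then have "v = u \<or> v \<in> nb u" using p unfolding forest_def by blast
    then have "v = u \<or> u \<in> nb v" using nbrs_sym[of u v] u by blast
    then show "u \<in> {u \<in> nb v. p u = v} \<union> (if p v = v then {v} else {})" using u by auto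
  next
    fix u assume "u \<in> {u \<in> nb v. p u = v} \<union> (if p v = v then {v} else {})"
    then show "u \<in> {u \<in> V. p u = v}" using nbv Suc.prems by (auto split: if_splits)
  qed
  have "acc (run [push_round] d v) = (if p v = v then X v else 0) + (\<Sum>u\<in>{u \<in> nb v. p u = v}. X u)"
    using s1 d[OF Suc.prems] own_id[OF Suc.prems]
    by (simp add: run_round_def push_round_def p_def)
  also have "\<dots> = (\<Sum>u\<in>{u \<in> V. p u = v}. X u)"
    unfolding children using fin_nb[OF Suc.prems] nbrs_irrefl[OF Suc.prems] by (simp add: sum.insert)
  \<comment> \<open>Values that are at v after one more round are grouped by the node that held them
    before.\<close>
  also have "\<dots> = (\<Sum>u\<in>{w \<in> V. p w = v}. sum (\<lambda>u. acc (c u)) {w \<in> {w \<in> V. (p ^^ Suc t) w = v}. (p ^^ t) w = u})"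
    unfolding X_def by (rule sum.cong) (auto intro!: sum.cong)
  also have "\<dots> = (\<Sum>u\<in>{w\<in>V. (p ^^ Suc t) w = v}. acc (c u))"
    by (rule sum.group) (use finV p forest_funpow_in in auto)
  finally have "acc (run [push_round] d v) = (\<Sum>u\<in>{w\<in>V. (p ^^ Suc t) w = v}. acc (c u))" .
  moreover have "run [push_round] d v = (c v)\<lparr>acc := acc (run [push_round] d v)\<rparr>"
    using d[OF Suc.prems] by (simp add: run_round_def push_round_def)
  ultimately show ?case unfolding replicate_Suc_snoc run_append d_def[symmetric] by simp
qed

lemma run_pull:
  fixes c :: "nat \<Rightarrow> 'm node_state"
  defines "p \<equiv> \<lambda>v. parent (c v)"
  assumes p: "forest p" and small: "\<And>v. v \<in> V \<Longrightarrow> bcast (c v) < 2 ^ W" and "v \<in> V"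
  shows "run (replicate t pull_round) c v = (c v)\<lparr>bcast := bcast (c ((p ^^ t) v))\<rparr>"
  using \<open>v \<in> V\<close>
proof (induction t arbitrary: v)
  case (Suc t)
  define d where "d = run (replicate t pull_round) c"
  have d: "d w = (c w)\<lparr>bcast := bcast (c ((p ^^ t) w))\<rparr>" if "w \<in> V" for w
    using Suc.IH[OF that] by (simp add: d_def)
  have "p v \<in> insert v (nb v)" using p Suc.prems by (simp add: forest_def)
  moreover have "p v \<in> V" using p Suc.prems forest_in by blast
  ultimately have "run [pull_round] d v = (c v)\<lparr>bcast := bcast (c ((p ^^ t) (p v)))\<rparr>"
    using d[OF Suc.prems] d[of "p v"] own_id[OF Suc.prems] small forest_funpow_in[OF p]
    by (auto simp: run_round_def pull_round_def p_def)
  then show ?case unfolding replicate_Suc_snoc run_append d_def[symmetric]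
    by (simp add: funpow_swap1)
qed simp

text \<open>A node learns the sum over its class, the nodes with the same R-th iterate; this is the
  total only if there is a single class. What is left in \<open>acc\<close> stays
  unspecified.\<close>

lemma run_aggregate:
  fixes c :: "nat \<Rightarrow> 'm node_state"
  defines "p \<equiv> \<lambda>v. parent (c v)"
  assumes p: "forest p" and small: "(\<Sum>u\<in>V. f (I u) (inner (c u))) < 2 ^ W"
  shows "\<exists>a b. \<forall>v\<in>V. run (aggregate_rounds R f g) c v = g (I v) ((c v)\<lparr>acc := a v, bcast := b v\<rparr>) (b v) \<and>
    b v = (\<Sum>u\<in>{u\<in>V. (p ^^ R) u = (p ^^ R) v}. f (I u) (inner (c u)))"
proof -
  define c1 where "c1 = run [local_round (\<lambda>I s. s\<lparr>acc := f I (inner s)\<rparr>)] c"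
  have c1: "c1 v = (c v)\<lparr>acc := f (I v) (inner (c v))\<rparr>" for v by (simp add: c1_def run_local)
  have p1: "(\<lambda>v. parent (c1 v)) = p" by (simp add: c1 p_def)
  define a where "a v = (\<Sum>u\<in>{u\<in>V. (p ^^ R) u = v}. f (I u) (inner (c u)))" for v
  define c2 where "c2 = run (replicate R push_round) c1"
  have c2: "c2 v = (c v)\<lparr>acc := a v\<rparr>" if "v \<in> V" for v
    unfolding c2_def using run_push[of c1 v R, unfolded p1] p small that by (simp add: c1 a_def)
  define c3 where "c3 = run [local_round (\<lambda>I s. s\<lparr>bcast := acc s\<rparr>)] c2"
  have c3: "c3 v = (c v)\<lparr>acc := a v, bcast := a v\<rparr>" if "v \<in> V" for v
    using c2[OF that] by (simp add: c3_def run_local)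
  have p3: "parent (c3 v) = p v" if "v \<in> V" for v using c3[OF that] by (simp add: p_def)
  have f3: "forest (\<lambda>v. parent (c3 v))" using p p3 by (simp add: forest_def)
  have a_small: "a v < 2 ^ W" for v
  proof -
    have "a v \<le> (\<Sum>u\<in>V. f (I u) (inner (c u)))"
      unfolding a_def using finV by (intro sum_mono2) auto
    then show ?thesis using small by simp
  qed
  define c4 where "c4 = run (replicate R pull_round) c3"
  have c4: "c4 v = (c v)\<lparr>acc := a v, bcast := a ((p ^^ R) v)\<rparr>" if "v \<in> V" for v
  proof -
    have "bcast (c3 w) < 2 ^ W" if "w \<in> V" for w using c3[OF that] a_small by simp
    from run_pull[OF f3 this that]
    have "c4 v = (c3 v)\<lparr>bcast := bcast (c3 (((\<lambda>v. parent (c3 v)) ^^ R) v))\<rparr>" by (simp add: c4_def)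
    also have "((\<lambda>v. parent (c3 v)) ^^ R) v = (p ^^ R) v"
      by (rule funpow_cong_on[OF p]) (use p3 that in auto)
    finally show ?thesis using c3[OF that] c3[of "(p ^^ R) v"] forest_funpow_in[OF p that] by simp
  qed
  have "run (aggregate_rounds R f g) c = run [local_round (\<lambda>I s. g I s (bcast s))] c4"
    unfolding aggregate_rounds_def run_append c1_def c2_def c3_def c4_def ..
  then have "run (aggregate_rounds R f g) c v = g (I v) (c4 v) (bcast (c4 v))" for v
    by (simp add: run_local)
  then show ?thesis
    by (intro exI[of _ a] exI[of _ "\<lambda>v. a ((p ^^ R) v)"]) (use c4 in \<open>auto simp: a_def\<close>)
qed

end

section \<open>Scripts of global operations\<close>

datatype 'm op =
  Exchange "node_input \<Rightarrow> 'm \<Rightarrow> nat" "node_input \<Rightarrow> 'm \<Rightarrow> (nat \<Rightarrow> nat) \<Rightarrow> 'm"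
| Aggregate "node_input \<Rightarrow> 'm \<Rightarrow> nat" "node_input \<Rightarrow> 'm \<Rightarrow> nat \<Rightarrow> 'm"

fun compile :: "nat \<Rightarrow> 'm op \<Rightarrow> 'm node_state round list" where
  "compile R (Exchange f g) =
     [(\<lambda>I s _. f I (inner s), \<lambda>I s ib. s\<lparr>inner := g I (inner s) ib\<rparr>)]"
| "compile R (Aggregate f g) = aggregate_rounds R f (\<lambda>I s x. s\<lparr>inner := g I (inner s) x\<rparr>)"

text \<open>The reset by \<open>fresh\<close> erases everything that a rejected attempt has left
  behind.\<close>

definition setup_rounds :: "nat \<Rightarrow> (node_input \<Rightarrow> 'm) \<Rightarrow> nat \<Rightarrow> 'm node_state round list" where
  "setup_rounds n init R =
     [local_round (\<lambda>I _. fresh init I)] @ replicate R elect_round @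
     aggregate_rounds R (\<lambda>_ _. 1) (\<lambda>_ s x. s\<lparr>ready := (x = n)\<rparr>)"

definition output_round :: "(node_input \<Rightarrow> 'm \<Rightarrow> nat) \<Rightarrow> 'm node_state round" where
  "output_round out = local_round (\<lambda>I s. s\<lparr>result := if ready s then Some (out I (inner s)) else None\<rparr>)"

definition attempt_rounds ::
  "nat \<Rightarrow> (node_input \<Rightarrow> 'm) \<Rightarrow> 'm op list \<Rightarrow> nat \<Rightarrow> 'm node_state round list" where
  "attempt_rounds n init script R = setup_rounds n init R @ concat (map (compile R) script)"

lemma length_aggregate_rounds: "length (aggregate_rounds R f g) = 2 * R + 3"
  by (simp add: aggregate_rounds_def)

lemma length_compile: "length (compile R x) \<le> 2 * R + 3"
  by (cases x) (auto simp: length_aggregate_rounds)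

lemma length_attempt_rounds:
  "length (attempt_rounds n init script R) \<le> (3 * R + 4) + length script * (2 * R + 3)"
proof -
  have "length (concat (map (compile R) script)) \<le> length script * (2 * R + 3)"
  proof (induction script)
    case (Cons x script)
    then show ?case using length_compile[of R x] by simp
  qed simp
  then show ?thesis by (simp add: attempt_rounds_def setup_rounds_def length_aggregate_rounds)
qed

text \<open>Outputs are irrevocable, so none may appear in the middle of an attempt; this is left to
  \<open>output_round\<close>.\<close>

definition quiet :: "'m node_state round \<Rightarrow> bool" where
  "quiet rd \<longleftrightarrow> (\<forall>I s ib. result s = None \<longrightarrow> result (snd rd I s ib) = None)"

lemma quiet_attempt_rounds:
  assumes "rd \<in> set (attempt_rounds n init script R)"
  shows "quiet rd"
proof -
  have agg: "quiet rd" if "rd \<in> set (aggregate_rounds R f g)" "\<And>I s x. result (g I s x) = result s" for rd f and g :: "node_input \<Rightarrow> 'a node_state \<Rightarrow> nat \<Rightarrow> 'a node_state"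
    using that by (auto simp: aggregate_rounds_def quiet_def local_round_def push_round_def pull_round_def)
  have "quiet rd" if "rd \<in> set (compile R x)" for x
    using that by (cases x) (auto simp: quiet_def[of "(_, _)"] intro!: agg)
  moreover have "quiet (local_round (\<lambda>I _. fresh init I))" "quiet elect_round"
    by (auto simp: quiet_def local_round_def fresh_def elect_round_def Let_def)
  moreover have "quiet rd" if "rd \<in> set (aggregate_rounds R (\<lambda>_ _. 1) (\<lambda>_ s x. s\<lparr>ready := (x = n)\<rparr>))"
    by (rule agg[OF that]) simp
  moreover from assms consider "rd = local_round (\<lambda>I _. fresh init I)" | "rd = elect_round"
    | "rd \<in> set (aggregate_rounds R (\<lambda>_ _. 1) (\<lambda>_ s x. s\<lparr>ready := (x = n)\<rparr>))"
    | x where "rd \<in> set (compile R x)"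
    unfolding attempt_rounds_def setup_rounds_def by (auto split: if_splits)
  ultimately show ?thesis by metis
qed

lemma ready_compile:
  assumes "rd \<in> set (compile R x)"
  shows "ready (snd rd I s ib) = ready s"
proof -
  have agg: "ready (snd rd I s ib) = ready s" if "rd \<in> set (aggregate_rounds R f g)"
    "\<And>I s x. ready (g I s x) = ready s" for rd f and g :: "node_input \<Rightarrow> 'a node_state \<Rightarrow> nat \<Rightarrow> 'a node_state"
    using that by (auto simp: aggregate_rounds_def local_round_def push_round_def pull_round_def)
  show ?thesis using assms by (cases x) (auto intro!: agg)
qed

context network
begin

text \<open>Ideal semantics, with untruncated messages and sums over all of \<open>V\<close>.
  \<open>op_fits\<close> is the condition under which the compiled rounds agree with it, given a
  common root.\<close>

fun run_op :: "'m op \<Rightarrow> (nat \<Rightarrow> 'm) \<Rightarrow> nat \<Rightarrow> 'm" where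
  "run_op (Exchange f g) d = (\<lambda>v. g (I v) (d v) (\<lambda>u. if u \<in> nb v then f (I u) (d u) else 0))"
| "run_op (Aggregate f g) d = (\<lambda>v. g (I v) (d v) (\<Sum>u\<in>V. f (I u) (d u)))"

fun op_fits :: "'m op \<Rightarrow> (nat \<Rightarrow> 'm) \<Rightarrow> bool" where
  "op_fits (Exchange f g) d = (\<forall>u\<in>V. f (I u) (d u) < 2 ^ W)"
| "op_fits (Aggregate f g) d = ((\<Sum>u\<in>V. f (I u) (d u)) < 2 ^ W)"

abbreviation run_script :: "'m op list \<Rightarrow> (nat \<Rightarrow> 'm) \<Rightarrow> nat \<Rightarrow> 'm" where
  "run_script \<equiv> fold run_op"

fun script_fits :: "'m op list \<Rightarrow> (nat \<Rightarrow> 'm) \<Rightarrow> bool" where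
  "script_fits [] d = True"
| "script_fits (x # xs) d = (op_fits x d \<and> script_fits xs (run_op x d))"

definition rooted :: "nat \<Rightarrow> (nat \<Rightarrow> nat) \<Rightarrow> bool" where
  "rooted R p \<longleftrightarrow> forest p \<and> (\<forall>u\<in>V. \<forall>v\<in>V. (p ^^ R) u = (p ^^ R) v)"

lemma rooted_cong:
  assumes "rooted R p" "\<And>v. v \<in> V \<Longrightarrow> p' v = p v"
  shows "rooted R p'"
proof -
  have p: "forest p" using assms(1) by (simp add: rooted_def)
  have eq: "(p' ^^ R) v = (p ^^ R) v" if "v \<in> V" for v using funpow_cong_on[OF p assms(2) that] .
  have "forest p'" using p assms(2) by (simp add: forest_def)
  moreover have "(p' ^^ R) u = (p' ^^ R) v" if "u \<in> V" "v \<in> V" for u v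
  proof -
    have "(p ^^ R) u = (p ^^ R) v" using assms(1) that unfolding rooted_def by blast
    then show ?thesis unfolding eq[OF that(1)] eq[OF that(2)] .
  qed
  ultimately show ?thesis unfolding rooted_def by blast
qed

definition same_frame :: "(nat \<Rightarrow> 'm node_state) \<Rightarrow> (nat \<Rightarrow> 'm node_state) \<Rightarrow> bool" where
  "same_frame c c' \<longleftrightarrow> (\<forall>v\<in>V. parent (c' v) = parent (c v) \<and> ready (c' v) = ready (c v))"

lemma run_compile:
  assumes root: "rooted R (\<lambda>v. parent (c v))" and fits: "op_fits x d"
    and d: "\<And>v. v \<in> V \<Longrightarrow> inner (c v) = d v"
  shows "same_frame c (run (compile R x) c) \<and> (\<forall>v\<in>V. inner (run (compile R x) c v) = run_op x d v)"
proof (cases x)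
  case (Exchange f g)
  have "(\<lambda>u. if u \<in> nb v then f (I u) (inner (c u)) mod 2 ^ W else 0) =
    (\<lambda>u. if u \<in> nb v then f (I u) (d u) else 0)" if "v \<in> V" for v
    using nbrs[OF that] fits d by (auto simp: Exchange fun_eq_iff subset_iff)
  then show ?thesis using d by (simp add: Exchange same_frame_def run_round_def cong: if_cong)
next
  case (Aggregate f g)
  define p where "p = (\<lambda>v. parent (c v))"
  have s: "(\<Sum>u\<in>V. f (I u) (inner (c u))) = (\<Sum>u\<in>V. f (I u) (d u))"
    by (rule sum.cong) (use d in auto)
  have "(\<Sum>u\<in>V. f (I u) (inner (c u))) < 2 ^ W" using fits by (simp add: s Aggregate)
  moreover have "forest p" using root by (simp add: rooted_def p_def)
  ultimately obtain a b where ab: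
    "\<forall>v\<in>V. run (compile R x) c v =
        (\<lambda>I s x. s\<lparr>inner := g I (inner s) x\<rparr>) (I v) ((c v)\<lparr>acc := a v, bcast := b v\<rparr>) (b v) \<and>
      b v = (\<Sum>u\<in>{u\<in>V. (p ^^ R) u = (p ^^ R) v}. f (I u) (inner (c u)))"
    using run_aggregate[of c f R "\<lambda>I s x. s\<lparr>inner := g I (inner s) x\<rparr>"]
    unfolding Aggregate compile.simps p_def by blast
  have "b v = (\<Sum>u\<in>V. f (I u) (d u))" if "v \<in> V" for v
  proof -
    have "{u\<in>V. (p ^^ R) u = (p ^^ R) v} = V" using root that unfolding rooted_def p_def by blast
    then show ?thesis using ab that s by simp
  qed
  then show ?thesis using ab d unfolding same_frame_def by (simp add: Aggregate del: compile.simps)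
qed

lemma run_compile_script:
  assumes "rooted R (\<lambda>v. parent (c v))" "script_fits xs d" "\<And>v. v \<in> V \<Longrightarrow> inner (c v) = d v"
  shows "same_frame c (run (concat (map (compile R) xs)) c) \<and>
    (\<forall>v\<in>V. inner (run (concat (map (compile R) xs)) c v) = run_script xs d v)"
  using assms
proof (induction xs arbitrary: c d)
  case Nil
  then show ?case by (simp add: same_frame_def)
next
  case (Cons x xs)
  define c' where "c' = run (compile R x) c"
  have 1: "same_frame c c'" "\<forall>v\<in>V. inner (c' v) = run_op x d v"
    using run_compile[OF Cons.prems(1) _ Cons.prems(3)] Cons.prems(2) by (auto simp: c'_def)
  have "rooted R (\<lambda>v. parent (c' v))"
    by (rule rooted_cong[OF Cons.prems(1)]) (use 1 in \<open>auto simp: same_frame_def\<close>)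
  from Cons.IH[OF this, of "run_op x d"] 1 Cons.prems(2)
  show ?case by (auto simp: same_frame_def c'_def)
qed

section \<open>Leader election and the acceptance test\<close>

definition reach :: "nat \<Rightarrow> nat set" where
  "reach t = ((\<lambda>S. S \<union> {v \<in> V. nb v \<inter> S \<noteq> {}}) ^^ t) {Min V}"

lemma reach_Suc: "reach (Suc t) = reach t \<union> {v \<in> V. nb v \<inter> reach t \<noteq> {}}"
  by (simp add: reach_def)

text \<open>The last conjunct restricts the pointers of informed nodes only: their parents are
  informed, and t steps lead to the minimum. Uninformed nodes may point to any neighbor, so the
  invariant also holds for t below the diameter.\<close>

definition elected :: "(node_input \<Rightarrow> 'm) \<Rightarrow> nat \<Rightarrow> (nat \<Rightarrow> 'm node_state) \<Rightarrow> bool" where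
  "elected init t c \<longleftrightarrow>
     (\<forall>v\<in>V. leader (c v) \<in> V \<and> parent (c v) \<in> insert v (nb v) \<and>
        result (c v) = None \<and> inner (c v) = init (I v)) \<and>
     (\<forall>v\<in>reach t. leader (c v) = Min V) \<and> leader (c (Min V)) = Min V \<and> parent (c (Min V)) = Min V \<and>
     (\<forall>v\<in>V. leader (c v) = Min V \<longrightarrow> leader (c (parent (c v))) = Min V \<and>
        ((\<lambda>v. parent (c v)) ^^ t) v = Min V)"

lemma elected_step:
  assumes c: "elected init t c" and V: "V \<subseteq> {..<2 ^ W}" "V \<noteq> {}"
  shows "elected init (Suc t) (run_round W I elect_round c)"
proof -
  define l where "l = Min V"
  have l: "l \<in> V" "\<And>v. v \<in> V \<Longrightarrow> l \<le> v" using finV V by (auto simp: l_def)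
  define c' where "c' = run_round W I elect_round c"
  define p where "p = (\<lambda>v. parent (c v))"
  define p' where "p' = (\<lambda>v. parent (c' v))"
  have inv: "\<And>v. v \<in> V \<Longrightarrow> leader (c v) \<in> V \<and> p v \<in> insert v (nb v) \<and> result (c v) = None \<and> inner (c v) = init (I v)"
    "\<And>v. v \<in> reach t \<Longrightarrow> leader (c v) = l" "leader (c l) = l" "p l = l"
    "\<And>v. v \<in> V \<Longrightarrow> leader (c v) = l \<Longrightarrow> leader (c (p v)) = l \<and> (p ^^ t) v = l"
    using c unfolding elected_def l_def p_def by blast+
  have upd: "c' v = c v \<and> (\<forall>u\<in>nb v. leader (c v) \<le> leader (c u)) \<or>
    (\<exists>u\<in>nb v. c' v = (c v)\<lparr>leader := leader (c u), parent := u\<rparr> \<and> leader (c u) < leader (c v) \<and>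
       (\<forall>w\<in>nb v. leader (c u) \<le> leader (c w)))" if v: "v \<in> V" for v
  proof -
    define ib where "ib u = (if u \<in> nb v then leader (c u) mod 2 ^ W else 0)" for u
    have ib: "ib u = leader (c u)" if "u \<in> nb v" for u
    proof -
      have "u \<in> V" using nbrs[OF v] that by blast
      then have "leader (c u) < 2 ^ W" using inv(1) V by blast
      then show ?thesis using that by (simp add: ib_def)
    qed
    have c'v: "c' v = (if \<exists>u\<in>nb v. ib u < leader (c v)
       then let u = arg_min_on ib (nb v) in (c v)\<lparr>leader := ib u, parent := u\<rparr> else c v)"
    proof -
      have "(\<lambda>u. if u \<in> nb v then fst elect_round (I u) (c u) v mod 2 ^ W else 0) = ib"
        by (simp add: elect_round_def ib_def fun_eq_iff)
      then have "c' v = snd elect_round (I v) (c v) ib" by (simp only: c'_def run_round_def)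
      then show ?thesis by (simp add: elect_round_def)
    qed
    show ?thesis
    proof (cases "\<exists>u\<in>nb v. ib u < leader (c v)")
      case True
      define u where "u = arg_min_on ib (nb v)"
      have u: "u \<in> nb v" "\<not> (\<exists>x\<in>nb v. ib x < ib u)"
        using arg_min_if_finite[OF fin_nb[OF v], of ib] True by (auto simp: u_def)
      have "c' v = (c v)\<lparr>leader := leader (c u), parent := u\<rparr>"
        using c'v True ib[OF u(1)] by (simp add: u_def Let_def)
      moreover have "leader (c u) < leader (c v)" using True u ib by fastforce
      moreover have "\<forall>w\<in>nb v. leader (c u) \<le> leader (c w)" using u ib by fastforce
      ultimately show ?thesis using u(1) by blast
    next
      case False
      then show ?thesis using c'v ib by (auto simp: not_less)
    qed
  qed
  \<comment> \<open>No neighbor can offer less than the minimum, so informed nodes are frozen and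
    their pointer chains stay intact.\<close>
  have keep: "c' v = c v" if "v \<in> V" "leader (c v) = l" for v
  proof -
    have "l \<le> leader (c u)" if "u \<in> nb v" for u
      using inv(1)[of u] l nbrs \<open>v \<in> V\<close> that by blast
    then show ?thesis using upd[OF that(1)] that(2) by fastforce
  qed
  define Z where "Z = {v \<in> V. leader (c v) = l}"
  have pZ: "p v \<in> Z" if "v \<in> Z" for v
  proof -
    have v: "v \<in> V" "leader (c v) = l" using that by (auto simp: Z_def)
    then have "p v \<in> V" using inv(1)[OF v(1)] nbrs[OF v(1)] by auto
    then show ?thesis using inv(5)[OF v] by (simp add: Z_def)
  qed
  have p'Z: "p' v = p v" if "v \<in> Z" for v
    using keep that by (simp add: Z_def p_def p'_def)
  have pow: "(p' ^^ k) v = (p ^^ k) v \<and> (p ^^ k) v \<in> Z" if "v \<in> Z" for v k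
    by (induction k) (use that pZ p'Z in auto)
  have lZ: "l \<in> Z" using l inv(3) by (simp add: Z_def)
  have powZ: "(p' ^^ t) v = l" if "v \<in> Z" for v
    using pow[OF that] inv(5) that by (simp add: Z_def)
  have p'l: "p' l = l" using p'Z[OF lZ] inv(4) by simp
  \<comment> \<open>A newly informed node points to a node informed earlier, so one additional
    pointer step suffices.\<close>
  have newZ: "v \<in> Z \<or> p' v \<in> Z" if v: "v \<in> V" "leader (c' v) = l" for v
    using upd[OF v(1)] v nbrs[OF v(1)] by (auto simp: Z_def p'_def)
  have leader': "leader (c' v) = l" if "v \<in> Z" for v using keep that by (simp add: Z_def)
  show ?thesis unfolding elected_def c'_def[symmetric] l_def[symmetric]
  proof (intro conjI ballI impI)
    fix v assume v: "v \<in> V"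
    have "leader (c u) \<in> V" if "u \<in> nb v" for u using that inv(1)[of u] nbrs[OF v] by blast
    then show "leader (c' v) \<in> V" "parent (c' v) \<in> insert v (nb v)" "result (c' v) = None" "inner (c' v) = init (I v)"
      using upd[OF v] inv(1)[OF v] by (auto simp: p_def)
  next
    fix v assume "v \<in> reach (Suc t)"
    then consider "v \<in> reach t" "v \<in> V" | u where "v \<in> V" "u \<in> nb v" "u \<in> reach t" | "v \<notin> V" "v \<in> reach t"
      unfolding reach_Suc by blast
    then show "leader (c' v) = l"
    proof cases
      case 1
      then show ?thesis using inv(2) keep by simp
    next
      case 2
      then have lu: "leader (c u) = l" using inv(2) by blast
      from upd[OF 2(1)] show ?thesis
      proof
        assume a: "c' v = c v \<and> (\<forall>u\<in>nb v. leader (c v) \<le> leader (c u))"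
        then have "leader (c v) \<le> l" using 2(2) lu by fastforce
        then show ?thesis using a inv(1)[OF 2(1)] l(2) by (simp add: le_antisym)
      next
        assume "\<exists>w\<in>nb v. c' v = (c v)\<lparr>leader := leader (c w), parent := w\<rparr> \<and> leader (c w) < leader (c v) \<and>
          (\<forall>x\<in>nb v. leader (c w) \<le> leader (c x))"
        then obtain w where w: "w \<in> nb v" "leader (c' v) = leader (c w)" "leader (c w) \<le> l"
          using 2(2) lu by fastforce
        have "w \<in> V" using w(1) nbrs[OF 2(1)] by blast
        then have "l \<le> leader (c w)" using inv(1) l(2) by blast
        then show ?thesis using w by simp
      qed
    next
      case 3
      have "reach k \<subseteq> V" for k
        by (induction k) (use l in \<open>auto simp: reach_def l_def\<close>)
      then show ?thesis using 3 by blast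
    qed
  next
    show "leader (c' l) = l" using leader' lZ by blast
    show "parent (c' l) = l" using p'l by (simp add: p'_def)
  next
    fix v assume v: "v \<in> V" "leader (c' v) = l"
    from newZ[OF v] show "leader (c' (parent (c' v))) = l"
      using pZ p'Z leader' unfolding p'_def by metis
    from newZ[OF v] show "((\<lambda>v. parent (c' v)) ^^ Suc t) v = l"
      unfolding p'_def[symmetric]
    proof
      assume "v \<in> Z"
      then show "(p' ^^ Suc t) v = l" using powZ p'l by simp
    next
      assume "p' v \<in> Z"
      then show "(p' ^^ Suc t) v = l" using powZ by (simp add: funpow_swap1)
    qed
  qed
qed

lemma elected_run:
  assumes V: "V \<subseteq> {..<2 ^ W}" "V \<noteq> {}" and c: "\<And>v. c v = fresh init (I v)"
  shows "elected init t (run (replicate t elect_round) c)"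
proof (induction t)
  case 0
  have "Min V \<in> V" using finV V by simp
  then show ?case using own_id by (auto simp: elected_def c fresh_def reach_def)
next
  case (Suc t)
  from elected_step[OF this V] show ?case unfolding replicate_Suc_snoc by simp
qed

text \<open>The test is exact, and \<open>rooted\<close> does not mention a particular node, so all
  nodes reach the same verdict: after an attempt either all of them answer or none does.\<close>

lemma run_setup:
  fixes c :: "nat \<Rightarrow> 'm node_state" and init :: "node_input \<Rightarrow> 'm" and R :: nat
  assumes V: "V \<subseteq> {..<2 ^ W}" "V \<noteq> {}" "card V < 2 ^ W"
  defines "c' \<equiv> run (setup_rounds (card V) init R) c"
  defines "p \<equiv> \<lambda>v. parent (c' v)"
  shows "reach R = V \<Longrightarrow> rooted R p"
    and "\<And>v. v \<in> V \<Longrightarrow> ready (c' v) \<longleftrightarrow> rooted R p"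
    and "\<And>v. v \<in> V \<Longrightarrow> inner (c' v) = init (I v)"
    and "\<And>v. v \<in> V \<Longrightarrow> result (c' v) = None"
proof -
  define c1 where "c1 = run_round W I (local_round (\<lambda>I _. fresh init I)) c"
  define c2 where "c2 = run (replicate R elect_round) c1"
  have c2: "elected init R c2"
    unfolding c2_def by (rule elected_run[OF V(1,2)]) (simp add: c1_def run_local)
  define q where "q = (\<lambda>v. parent (c2 v))"
  have fq: "forest q" using c2 by (simp add: elected_def forest_def q_def)
  have "(\<Sum>u\<in>V. 1) < (2::nat) ^ W" using V(3) by simp
  from run_aggregate[OF fq[unfolded q_def], of "\<lambda>_ _. 1", OF this, of R "\<lambda>_ s x. s\<lparr>ready := (x = card V)\<rparr>"]
  obtain a b where ab: "\<forall>v\<in>V. c' v = (c2 v)\<lparr>acc := a v, bcast := b v, ready := (b v = card V)\<rparr> \<and>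
    b v = (\<Sum>u\<in>{u\<in>V. (q ^^ R) u = (q ^^ R) v}. 1)"
    unfolding c'_def setup_rounds_def run_append c2_def c1_def q_def by auto
  have pq: "p v = q v" if "v \<in> V" for v using ab that by (simp add: p_def q_def)
  have fp: "forest p" using fq pq by (simp add: forest_def)
  have pow: "(p ^^ R) v = (q ^^ R) v" if "v \<in> V" for v using funpow_cong_on[OF fq pq that] .
  have rooted_q: "rooted R p \<longleftrightarrow> (\<forall>u\<in>V. \<forall>w\<in>V. (q ^^ R) u = (q ^^ R) w)"
    unfolding rooted_def using fp pow by metis
  show "ready (c' v) \<longleftrightarrow> rooted R p" if v: "v \<in> V" for v
  proof -
    have "ready (c' v) \<longleftrightarrow> card {u\<in>V. (q ^^ R) u = (q ^^ R) v} = card V"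
      using ab v by simp
    also have "\<dots> \<longleftrightarrow> {u\<in>V. (q ^^ R) u = (q ^^ R) v} = V"
    proof
      assume c: "card {u\<in>V. (q ^^ R) u = (q ^^ R) v} = card V"
      show "{u\<in>V. (q ^^ R) u = (q ^^ R) v} = V"
        by (rule card_subset_eq[OF finV _ c]) blast
    qed (simp only:)
    also have "\<dots> \<longleftrightarrow> (\<forall>u\<in>V. (q ^^ R) u = (q ^^ R) v)" by blast
    also have "\<dots> \<longleftrightarrow> (\<forall>u\<in>V. \<forall>w\<in>V. (q ^^ R) u = (q ^^ R) w)" using v by metis
    finally show ?thesis unfolding rooted_q .
  qed
  show "rooted R p" if "reach R = V"
    using c2 that unfolding rooted_q elected_def q_def by metis
  show "inner (c' v) = init (I v)" "result (c' v) = None" if "v \<in> V" for v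
    using ab c2 that by (auto simp: elected_def)
qed

end

section \<open>Schedules\<close>

text \<open>As no block is empty, entry i lies within the first i + 1 blocks. So each round of the
  infinite schedule can be read off a finite prefix, and longer prefixes agree with it.\<close>

lemma concat_blocks_nth:
  fixes block :: "nat \<Rightarrow> 'a list"
  assumes ne: "\<And>k. block k \<noteq> []" and i: "i < length (concat (map block [0..<k]))"
  shows "concat (map block [0..<Suc i]) ! i = concat (map block [0..<k]) ! i"
proof -
  define f where "f m = concat (map block [0..<m])" for m
  have add: "\<exists>ys. f (m + d) = f m @ ys" for m d
    by (induction d) (auto simp: f_def)
  have len: "m \<le> length (f m)" for m
  proof (induction m)
    case (Suc m)
    then show ?case using ne[of m] by (cases "block m") (auto simp: f_def)
  qed simp
  have "f (Suc i) ! i = f k ! i"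
  proof (cases "Suc i \<le> k")
    case True
    then obtain ys where "f k = f (Suc i) @ ys" using add[of "Suc i" "k - Suc i"] by auto
    then show ?thesis using len[of "Suc i"] by (simp add: nth_append)
  next
    case False
    then obtain ys where "f (Suc i) = f k @ ys" using add[of k "Suc i - k"] by auto
    then show ?thesis using i by (simp add: f_def nth_append)
  qed
  then show ?thesis by (simp add: f_def)
qed

definition attempt :: "(global_params \<Rightarrow> node_input \<Rightarrow> 'm) \<Rightarrow> (global_params \<Rightarrow> 'm op list) \<Rightarrow>
    (node_input \<Rightarrow> 'm \<Rightarrow> nat) \<Rightarrow> global_params \<Rightarrow> nat \<Rightarrow> 'm node_state round list" where
  "attempt init script out P k =
     attempt_rounds (num_nodes P) (init P) (script P) (2 ^ k) @ [output_round out]"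

definition schedule :: "(global_params \<Rightarrow> node_input \<Rightarrow> 'm) \<Rightarrow> (global_params \<Rightarrow> 'm op list) \<Rightarrow>
    (node_input \<Rightarrow> 'm \<Rightarrow> nat) \<Rightarrow> global_params \<Rightarrow> nat \<Rightarrow> 'm node_state round" where
  "schedule init script out P t = concat (map (attempt init script out P) [0..<Suc t]) ! t"

text \<open>A single node must answer before the first round, since the diameter is then 0.\<close>

definition script_protocol :: "nat \<Rightarrow> (global_params \<Rightarrow> node_input \<Rightarrow> 'm) \<Rightarrow>
    (global_params \<Rightarrow> 'm op list) \<Rightarrow> (node_input \<Rightarrow> 'm \<Rightarrow> nat) \<Rightarrow> algorithm" where
  "script_protocol \<gamma> init script out =
     protocol \<gamma> (schedule init script out) (\<lambda>P. fresh (init P))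
       (\<lambda>P I s. if num_nodes P = 1 then Some (Min (color_list I)) else result s)"

lemma map_schedule:
  assumes "t \<le> length (concat (map (attempt init script out P) [0..<k]))"
  shows "map (schedule init script out P) [0..<t] = take t (concat (map (attempt init script out P) [0..<k]))"
proof (rule nth_equalityI)
  fix i assume "i < length (map (schedule init script out P) [0..<t])"
  then have i: "i < t" by simp
  then have "schedule init script out P i = concat (map (attempt init script out P) [0..<k]) ! i"
    unfolding schedule_def by (intro concat_blocks_nth) (use assms in \<open>auto simp: attempt_def\<close>)
  then show "map (schedule init script out P) [0..<t] ! i = take t (concat (map (attempt init script out P) [0..<k])) ! i"
    using i by simp
qed (use assms in simp)

lemma length_attempt:
  "length (attempt init script out P k) \<le> 2 ^ k * (8 + 5 * length (script P))"
proof -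
  have 1: "1 \<le> (2::nat) ^ k" by simp
  have "length (attempt init script out P k) \<le> (3 * 2 ^ k + 5) + length (script P) * (2 * 2 ^ k + 3)"
    using length_attempt_rounds[of "num_nodes P" "init P" "script P" "2 ^ k"] by (simp add: attempt_def)
  also have "\<dots> \<le> 8 * 2 ^ k + length (script P) * (5 * 2 ^ k)"
    using 1 by (intro add_mono mult_left_mono) linarith+
  finally show ?thesis by (simp add: algebra_simps)
qed

text \<open>The guesses \<open>2 ^ 0\<close> to \<open>2 ^ (k - 1)\<close> sum up to less than
  \<open>2 ^ k\<close>.\<close>

lemma length_attempts:
  "length (concat (map (attempt init script out P) [0..<k])) \<le> 2 ^ k * (8 + 5 * length (script P))"
proof (induction k)
  case (Suc k)
  then show ?case using length_attempt[of init script out P k] by simp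
qed simp

section \<open>Networks from graphs\<close>

lemma network_input_of:
  assumes "pair_graph G"
  shows "network (pverts G) (input_of G L)"
proof -
  interpret pair_graph G by fact
  show ?thesis
  proof
    show "finite (pverts G)" by (rule pair_finite_verts)
    fix v assume "v \<in> pverts G"
    show "own_id (input_of G L v) = v" by (simp add: input_of_def)
    show "neighbor_ids (input_of G L v) \<subseteq> pverts G"
      by (auto simp: input_of_def neighbors_def dest: arc_snd_in_verts)
    show "v \<notin> neighbor_ids (input_of G L v)"
      using pair_no_loops by (fastforce simp: input_of_def neighbors_def)
    fix u assume "u \<in> neighbor_ids (input_of G L v)"
    then show "v \<in> neighbor_ids (input_of G L u)"
      by (auto simp: input_of_def neighbors_def intro: arcs_symmetric)
  qed
qed

lemma neighbor_ids_input_of [simp]: "neighbor_ids (input_of G L v) = neighbors G v"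
  and own_id_input_of [simp]: "own_id (input_of G L v) = v"
  and color_list_input_of [simp]: "color_list (input_of G L v) = L v"
  by (simp_all add: input_of_def)

lemma deg_eq_card_neighbors:
  "deg G v = card (neighbors G v)"
proof -
  have "out_arcs (with_proj G) v = Pair v ` neighbors G v"
    by (auto simp: out_arcs_def neighbors_def)
  then show ?thesis by (simp add: out_degree_def card_image inj_on_def)
qed

lemma deg_le_max_degree:
  assumes "pair_graph G" "v \<in> pverts G"
  shows "deg G v \<le> max_degree G"
proof -
  interpret pair_graph G by fact
  show ?thesis unfolding max_degree_def using assms(2) pair_finite_verts by (intro Max_ge) auto
qed

lemma graph_dist_le_diameter:
  assumes "pair_graph G" "u \<in> pverts G" "v \<in> pverts G"
  shows "graph_dist G u v \<le> diameter G"
proof -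
  interpret pair_graph G by fact
  have "finite ((\<lambda>(u, v). graph_dist G u v) ` (pverts G \<times> pverts G))"
    using pair_finite_verts by blast
  also have "(\<lambda>(u, v). graph_dist G u v) ` (pverts G \<times> pverts G) =
      {graph_dist G u v | u v. u \<in> pverts G \<and> v \<in> pverts G}" by auto
  finally show ?thesis unfolding diameter_def using assms(2,3) by (intro Max_ge) auto
qed

lemma obtain_short_awalk:
  assumes G: "pair_graph G" "connected (with_proj G)" and uv: "u \<in> pverts G" "v \<in> pverts G"
  obtains p where "pre_digraph.awalk (with_proj G) u p v" "length p \<le> diameter G"
proof -
  interpret pair_graph G by fact
  have sym: "symmetric (with_proj G)" by (rule sym_arcs)
  have "u \<rightarrow>\<^sup>*\<^bsub>mk_symmetric (with_proj G)\<^esub> v"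
    using G(2) uv unfolding connected_def strongly_connected_def by auto
  then have "u \<rightarrow>\<^sup>*\<^bsub>with_proj G\<^esub> v" using reachable_mk_symmetric_eq[OF sym] by simp
  then have "\<exists>k p. awalk u p v \<and> length p = k" by (auto simp: reachable_awalk)
  from LeastI_ex[OF this] obtain p where "awalk u p v" "length p = graph_dist G u v"
    unfolding graph_dist_def by blast
  then show ?thesis using graph_dist_le_diameter[OF G(1) uv] by (intro that) auto
qed

text \<open>The claimed bound is proportional to the diameter without an additive term, so two or
  more nodes must not have diameter 0.\<close>

lemma diameter_pos:
  assumes G: "pair_graph G" "connected (with_proj G)" and "2 \<le> card (pverts G)"
  shows "1 \<le> diameter G"
proof (rule ccontr)
  assume "\<not> ?thesis"
  then have D: "diameter G = 0" by simp
  have "u = v" if uv: "u \<in> pverts G" "v \<in> pverts G" for u v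
  proof -
    obtain p where p: "pre_digraph.awalk (with_proj G) u p v" "length p \<le> diameter G"
      using obtain_short_awalk[OF G uv] .
    then have "p = []" using D by simp
    then show ?thesis using p(1) by (simp add: pre_digraph.awalk_def pre_digraph.cas.simps)
  qed
  then have "card (pverts G) \<le> 1" by (metis card.infinite card_le_Suc0_iff_eq One_nat_def le0)
  then show False using assms(3) by simp
qed

lemma reach_diameter:
  fixes L
  assumes G: "pair_graph G" "connected (with_proj G)" and t: "diameter G \<le> t"
  shows "network.reach (pverts G) (input_of G L) t = pverts G"
proof -
  interpret pair_graph G by fact
  interpret network "pverts G" "input_of G L" by (rule network_input_of[OF G(1)])
  have ne: "pverts G \<noteq> {}" using G(2) by (auto simp: connected_def strongly_connected_def)
  define l where "l = Min (pverts G)"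
  have l: "l \<in> pverts G" using finV ne by (simp add: l_def)
  have sub: "reach k \<subseteq> pverts G" for k
    by (induction k) (use l in \<open>auto simp: reach_def l_def\<close>)
  have mono: "reach k \<subseteq> reach (k + d)" for k d
    by (induction d) (auto simp: reach_Suc)
  have walk: "v \<in> reach (length p)" if "awalk v p l" for v p
    using that
  proof (induction p arbitrary: v)
    case Nil
    then show ?case by (simp add: awalk_Nil_iff reach_def l_def)
  next
    case (Cons e p)
    then have e: "e \<in> parcs G" "v = fst e" "awalk (snd e) p l" by (auto simp: awalk_Cons_iff)
    then have "snd e \<in> nb v" by (auto simp: neighbors_def)
    moreover have "v \<in> pverts G" using e by auto
    ultimately show ?case using Cons.IH[OF e(3)] by (auto simp: reach_Suc)
  qed
  have "v \<in> reach t" if v: "v \<in> pverts G" for v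
  proof -
    obtain p where p: "awalk v p l" "length p \<le> diameter G"
      using obtain_short_awalk[OF G v l] .
    then show ?thesis using walk[OF p(1)] mono[of "length p" "t - length p"] t by auto
  qed
  then show ?thesis using sub by blast
qed

section \<open>Correctness of the compiled protocol\<close>

text \<open>Until the end of the first accepted attempt \<open>result\<close> is \<open>None\<close>
  everywhere; then all nodes answer at once. Later attempts do no harm, since only first outputs
  count.\<close>

lemma script_protocol_solves:
  fixes G C L \<gamma> and init :: "global_params \<Rightarrow> node_input \<Rightarrow> 'm" and script out
  defines "P \<equiv> params_of G C" and "I \<equiv> input_of G L" and "V \<equiv> pverts G"
    and "W \<equiv> log_bits \<gamma> (card (pverts G))"
  assumes G: "pair_graph G" "connected (with_proj G)" and n: "2 \<le> card V"
    and ids: "V \<subseteq> {..<2 ^ W}" and cardV: "card V < 2 ^ W"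
    and fits: "network.script_fits V I W (script P) (\<lambda>v. init P (I v))"
    and good: "list_coloring G L (\<lambda>v. out (I v) (network.run_script V I (script P) (\<lambda>v. init P (I v)) v))"
    and T: "real (4 * diameter G * (8 + 5 * length (script P))) \<le> T"
  shows "solves_within (script_protocol \<gamma> init script out) G C L T"
proof -
  interpret network V I W unfolding V_def I_def by (rule network_input_of[OF G(1)])
  define f where "f k = concat (map (attempt init script out P) [0..<k])" for k
  define c0 where "c0 v = fresh (init P) (I v)" for v
  define A where "A k = attempt_rounds (num_nodes P) (init P) (script P) (2 ^ k)" for k
  have fS: "f (Suc k) = f k @ A k @ [output_round out]" for k by (simp add: f_def A_def attempt_def)
  have numP: "num_nodes P = card V" by (simp add: P_def params_of_def V_def)
  have Vne: "V \<noteq> {}" using n by auto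
  define c where "c k = run (f k) c0" for k
  define s where "s k = run (setup_rounds (card V) (init P) (2 ^ k)) (c k)" for k
  define ok where "ok k = rooted (2 ^ k) (\<lambda>v. parent (s k v))" for k
  have runA: "run (A k) (c k) = run (concat (map (compile (2 ^ k)) (script P))) (s k)" for k
    by (simp add: A_def attempt_rounds_def numP s_def)
  note su = run_setup[OF ids Vne cardV, where init = "init P"]
  \<comment> \<open>A guess of at least the diameter is certain to be accepted, and
    \<open>2 ^ K\<close> exceeds it by a factor of at most 2. The first accepted guess
    \<open>k\<close> may be smaller; the geometric sum contributes another factor 2 to the final
    4.\<close>
  define K where "K = bits (diameter G)"
  have D1: "1 \<le> diameter G" using diameter_pos[OF G] n by (simp add: V_def)
  have K: "diameter G \<le> 2 ^ K" "2 ^ K \<le> 2 * diameter G"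
    using less_two_power_bits[of "diameter G"] two_power_bits_le[of "diameter G"] D1 by (auto simp: K_def)
  have "reach (2 ^ K) = V" using reach_diameter[OF G K(1)] by (simp add: V_def I_def)
  then have okK: "ok K" unfolding ok_def s_def by (rule su(1))
  define k where "k = (LEAST k. ok k)"
  have okk: "ok k" unfolding k_def using okK by (rule LeastI)
  have nok: "\<not> ok j" if "j < k" for j using that unfolding k_def by (rule not_less_Least)
  have kK: "k \<le> K" unfolding k_def using okK by (rule Least_le)
  have quiet_run: "result (run xs d v) = None" if "\<forall>rd\<in>set xs. quiet rd" "result (d v) = None" for xs d v
    using that by (induction xs arbitrary: d) (auto simp: quiet_def run_round_def)
  have ready_run: "ready (run xs d v) = ready (d v)"
    if "\<forall>rd\<in>set xs. \<forall>I s ib. ready (snd rd I s ib) = ready s"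
    for xs :: "'m node_state round list" and d v
    using that by (induction xs arbitrary: d) (auto simp: run_round_def)
  have readyA: "ready (run (A j) (c j) v) = ready (s j v)" for j v
    unfolding runA
  proof (rule ready_run, intro ballI allI)
    fix rd and I s ib assume "rd \<in> set (concat (map (compile (2 ^ j)) (script P)))"
    then obtain x where "rd \<in> set (compile (2 ^ j) x)" by auto
    then show "ready (snd rd I s ib) = ready s" by (rule ready_compile)
  qed
  have take_f: "run (take t (f j)) c0 = run (take t (f j')) c0" if "t \<le> length (f j)" "t \<le> length (f j')" for t j j'
    using that unfolding f_def by (simp only: map_schedule[symmetric])
  have none_A: "result (run (take i (A j)) (c j) v) = None"
    if "result (c j v) = None" for i j v
  proof -
    have "\<forall>rd\<in>set (take i (A j)). quiet rd"
      using quiet_attempt_rounds in_set_takeD unfolding A_def by fastforce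
    from quiet_run[of _ "c j" v, OF this that] show ?thesis .
  qed
  have run_out: "result (run (f (Suc j)) c0 v) =
      (if ready (s j v) then Some (out (I v) (inner (run (A j) (c j) v))) else None)" for j v
    using readyA[of j v] by (simp add: fS c_def output_round_def run_local)
  have none_step: "result (run (take t (f (Suc j))) c0 v) = None"
    if t: "length (f j) \<le> t" "t < length (f (Suc j))" and "result (c j v) = None" for j t v
  proof -
    have "take t (f (Suc j)) = f j @ take (t - length (f j)) (A j)"
      using t by (auto simp: fS)
    then show ?thesis using none_A[OF that(3)] by (simp add: c_def)
  qed
  have none: "\<forall>t\<le>length (f j). \<forall>v\<in>V. result (run (take t (f j)) c0 v) = None" if "j \<le> k" for j
    using that
  proof (induction j)
    case 0
    then show ?case by (simp add: f_def c0_def fresh_def)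
  next
    case (Suc j)
    have IH: "result (run (take t (f j)) c0 v) = None" if "t \<le> length (f j)" "v \<in> V" for t v
      using Suc that by auto
    have cN: "result (c j v) = None" if "v \<in> V" for v
      using IH[OF order_refl that] by (simp add: c_def)
    show ?case
    proof (intro allI ballI impI)
      fix t v assume t: "t \<le> length (f (Suc j))" and v: "v \<in> V"
      consider "t \<le> length (f j)" | "length (f j) \<le> t" "t < length (f (Suc j))" | "t = length (f (Suc j))"
        using t by linarith
      then show "result (run (take t (f (Suc j))) c0 v) = None"
      proof cases
        case 1
        then show ?thesis using take_f[OF 1 t] IH[OF 1 v] by simp
      next
        case 2
        then show ?thesis using none_step cN[OF v] by blast
      next
        case 3
        have "\<not> ready (s j v)"
          using nok[of j] Suc.prems su(2)[OF v, of "2 ^ j" "c j"] by (simp add: ok_def s_def)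
        then show ?thesis using 3 run_out[of j v] by simp
      qed
    qed
  qed
  have outk: "result (run (f (Suc k)) c0 v) = Some (out (I v) (run_script (script P) (\<lambda>v. init P (I v)) v))" if v: "v \<in> V" for v
  proof -
    have "ready (s k v)" using okk su(2)[OF v, of "2 ^ k" "c k"] by (simp add: ok_def s_def)
    moreover have "inner (run (A k) (c k) v) = run_script (script P) (\<lambda>v. init P (I v)) v"
      using run_compile_script[OF okk[unfolded ok_def] fits] su(3) v by (simp add: runA s_def)
    ultimately show ?thesis using run_out[of k v] by simp
  qed
  have out_at: "output_at (script_protocol \<gamma> init script out) G C L t v = result (run (take t (f j)) c0 v)"
    if "t \<le> length (f j)" for t j v
  proof -
    have "num_nodes P \<noteq> 1" using n numP by simp
    then show ?thesis
      unfolding script_protocol_def output_at_protocol P_def[symmetric] I_def[symmetric] W_def[symmetric]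
      using map_schedule[OF that[unfolded f_def]] by (simp add: f_def c0_def[abs_def])
  qed
  define t where "t = length (f (Suc k))"
  have "t \<le> 2 ^ Suc k * (8 + 5 * length (script P))"
    unfolding t_def f_def by (rule length_attempts)
  also have "\<dots> \<le> 4 * diameter G * (8 + 5 * length (script P))"
  proof (rule mult_right_mono)
    have "(2::nat) ^ k \<le> 2 ^ K" using kK by (intro power_increasing) auto
    also note K(2)
    finally show "2 ^ Suc k \<le> 4 * diameter G" unfolding power_Suc by linarith
  qed simp
  finally have "real t \<le> T" using T by linarith
  moreover have "output_at (script_protocol \<gamma> init script out) G C L t v =
      Some (out (I v) (run_script (script P) (\<lambda>v. init P (I v)) v))" if "v \<in> V" for v
    using out_at[of t "Suc k" v] outk[OF that] by (simp add: t_def)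
  moreover have "output_at (script_protocol \<gamma> init script out) G C L u v = None" if "v \<in> V" "u < t" for u v
  proof (cases "u \<le> length (f k)")
    case True
    then show ?thesis using out_at[OF True] none that by simp
  next
    case False
    have "result (c k v) = None" using none[of k] that(1) by (auto simp: c_def)
    then show ?thesis using out_at[of u "Suc k" v] none_step[of k u v] that(2) False by (simp add: t_def)
  qed
  ultimately show ?thesis unfolding solves_within_def using good by (fold V_def) blast
qed

lemma script_protocol_solves_single:
  assumes "card (pverts G) = 1" "coloring_instance a b G C L" "0 \<le> T"
  shows "solves_within (script_protocol \<gamma> init script out) G C L T"
proof -
  obtain x where x: "pverts G = {x}" using assms(1) card_1_singletonE by blast
  interpret pair_graph G using assms(2) by (simp add: coloring_instance_def)
  have "parcs G = {}"
  proof (rule ccontr)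
    assume "parcs G \<noteq> {}"
    then obtain u v where "(u, v) \<in> parcs G" by auto
    then show False using arc_fst_in_verts arc_snd_in_verts pair_no_loops x by fastforce
  qed
  moreover have "Min (L x) \<in> L x"
  proof (rule Min_in)
    have "card (L x) \<ge> 1" using assms(2) x by (auto simp: coloring_instance_def)
    then show "finite (L x)" "L x \<noteq> {}" by (auto intro: card_ge_0_finite)
  qed
  ultimately have "list_coloring G L (\<lambda>v. Min (L v))" by (auto simp: list_coloring_def x)
  moreover have "output_at (script_protocol \<gamma> init script out) G C L 0 v = Some (Min (L v))" for v
    using assms(1) by (simp add: script_protocol_def output_at_protocol params_of_def)
  ultimately show ?thesis using assms(3) unfolding solves_within_def by (metis not_less_zero of_nat_0)
qed

lemma script_protocol_respects_bandwidth:
  "respects_bandwidth \<gamma> (script_protocol \<gamma> init script out) G C L"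
  unfolding script_protocol_def by (rule protocol_respects_bandwidth)

lemma less_two_power_mono: "x < 2 ^ a \<Longrightarrow> a \<le> b \<Longrightarrow> x < (2::nat) ^ b"
  by (meson less_le_trans one_le_numeral power_increasing)

section \<open>The coloring script\<close>

text \<open>Colors are stored incremented by one; 0 marks an uncolored node.\<close>

record color_state =
  hue :: nat
  nb_hue :: "nat \<Rightarrow> nat"
  avail :: "nat set"
  color :: nat
  prefix :: nat
  nb_prefix :: "nat \<Rightarrow> nat"
  nb_zeros :: "nat \<Rightarrow> nat"
  nb_ones :: "nat \<Rightarrow> nat"
  seed :: nat
  total :: nat

definition init_state :: "node_input \<Rightarrow> color_state" where
  "init_state I = \<lparr>hue = own_id I, nb_hue = \<lambda>_. 0, avail = color_list I, color = 0, prefix = 0,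
     nb_prefix = \<lambda>_. 0, nb_zeros = \<lambda>_. 0, nb_ones = \<lambda>_. 0, seed = 0, total = 0\<rparr>"

text \<open>The prefix consists of the leading bits of a color; its last \<open>h\<close> bits are still open.\<close>

definition slots :: "nat \<Rightarrow> color_state \<Rightarrow> nat set" where
  "slots h s = {k \<in> avail s. k div 2 ^ h = prefix s}"

definition half_slots :: "nat \<Rightarrow> nat \<Rightarrow> color_state \<Rightarrow> nat set" where
  "half_slots h b s = {k \<in> avail s. k div 2 ^ h = 2 * prefix s + b}"

definition reduce_op :: "nat \<Rightarrow> nat \<Rightarrow> color_state op" where
  "reduce_op d w = Exchange (\<lambda>_ s. hue s)
     (\<lambda>I s ib. s\<lparr>hue := reduce_color d w (hue s) (ib ` neighbor_ids I)\<rparr>)"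

definition share_hue_op :: "color_state op" where
  "share_hue_op = Exchange (\<lambda>_ s. hue s) (\<lambda>_ s ib. s\<lparr>nb_hue := ib\<rparr>)"

text \<open>Colored nodes send 0, which no successor equals, so they are never taken for conflicting
  ones.\<close>

definition share_prefix_op :: "color_state op" where
  "share_prefix_op = Exchange (\<lambda>_ s. if color s = 0 then Suc (prefix s) else 0)
     (\<lambda>_ s ib. s\<lparr>nb_prefix := ib\<rparr>)"

definition share_zeros_op :: "nat \<Rightarrow> color_state op" where
  "share_zeros_op h = Exchange (\<lambda>_ s. card (half_slots h 0 s)) (\<lambda>_ s ib. s\<lparr>nb_zeros := ib\<rparr>)"

definition share_ones_op :: "nat \<Rightarrow> color_state op" where
  "share_ones_op h = Exchange (\<lambda>_ s. card (half_slots h 1 s)) (\<lambda>_ s ib. s\<lparr>nb_ones := ib, seed := 0\<rparr>)"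

text \<open>The tables hold received data only, so the values of the node itself are patched
  in.\<close>

definition node_weight :: "nat \<Rightarrow> nat \<Rightarrow> node_input \<Rightarrow> color_state \<Rightarrow> nat \<Rightarrow> nat" where
  "node_weight r h I s x =
     (if color s = 0
      then conflict_weight r ((nb_hue s)(own_id I := hue s))
        ((nb_zeros s)(own_id I := card (half_slots h 0 s)))
        ((nb_ones s)(own_id I := card (half_slots h 1 s)))
        {u \<in> neighbor_ids I. nb_prefix s u = Suc (prefix s)} (own_id I) x
      else 0)"

text \<open>The seeds whose leading bits form x while e bits are open.\<close>

definition seed_range :: "nat \<Rightarrow> nat \<Rightarrow> nat set" where
  "seed_range e x = {x * 2 ^ e..<Suc x * 2 ^ e}"

definition range_weight :: "nat \<Rightarrow> nat \<Rightarrow> nat \<Rightarrow> nat \<Rightarrow> node_input \<Rightarrow> color_state \<Rightarrow> nat" where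
  "range_weight r h e b I s = (\<Sum>x\<in>seed_range e (2 * seed s + b). node_weight r h I s x)"

definition seed_bit_script :: "nat \<Rightarrow> nat \<Rightarrow> nat \<Rightarrow> color_state op list" where
  "seed_bit_script r h e =
     [Aggregate (range_weight r h e 0) (\<lambda>_ s y. s\<lparr>total := y\<rparr>),
      Aggregate (range_weight r h e 1)
        (\<lambda>_ s y. s\<lparr>seed := 2 * seed s + (if total s \<le> y then 0 else 1)\<rparr>)]"

text \<open>A purely local step in the guise of an exchange of dummy messages.\<close>

definition extend_op :: "nat \<Rightarrow> nat \<Rightarrow> color_state op" where
  "extend_op r h = Exchange (\<lambda>_ _. 0) (\<lambda>_ s _. s\<lparr>prefix := 2 * prefix s +
     (if choose_bit r (hue s) (card (half_slots h 0 s)) (card (half_slots h 1 s)) (seed s) then 1 else 0)\<rparr>)"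

definition phase_script :: "nat \<Rightarrow> nat \<Rightarrow> color_state op list" where
  "phase_script r h = [share_prefix_op, share_zeros_op h, share_ones_op h] @
     concat (map (\<lambda>i. seed_bit_script r h (4 * r - Suc i)) [0..<4 * r]) @ [extend_op r h]"

definition settle_op :: "color_state op" where
  "settle_op = Exchange (\<lambda>_ s. if color s = 0 then Suc (prefix s) else 0)
     (\<lambda>I s ib. if color s = 0 \<and> (\<forall>u\<in>neighbor_ids I. ib u = Suc (prefix s) \<longrightarrow> u < own_id I)
        then s\<lparr>color := Suc (prefix s)\<rparr> else s)"

definition prune_op :: "color_state op" where
  "prune_op = Exchange (\<lambda>_ s. color s)
     (\<lambda>I s ib. s\<lparr>avail := avail s - {k. \<exists>u\<in>neighbor_ids I. ib u = Suc k}, prefix := 0\<rparr>)"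

definition iteration_script :: "nat \<Rightarrow> nat \<Rightarrow> color_state op list" where
  "iteration_script r l =
     concat (map (\<lambda>i. phase_script r (l - Suc i)) [0..<l]) @ [settle_op, prune_op]"

definition coloring_script :: "nat \<Rightarrow> nat \<Rightarrow> nat \<Rightarrow> nat \<Rightarrow> nat \<Rightarrow> color_state op list" where
  "coloring_script d w r l J =
     concat (map (\<lambda>i. [reduce_op d ((reduced_width d ^^ i) w)]) [0..<w]) @ [share_hue_op] @
     concat (map (\<lambda>_. iteration_script r l) [0..<J])"

lemma length_concat_const:
  assumes "\<And>i. length (f i) = m"
  shows "length (concat (map f [0..<k])) = k * m"
  by (induction k) (use assms in auto)

lemma length_phase_script: "length (phase_script r h) = 8 * r + 4"
  unfolding phase_script_def length_append
  by (subst length_concat_const[where m = 2]) (auto simp: seed_bit_script_def)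

lemma length_iteration_script: "length (iteration_script r l) = l * (8 * r + 4) + 2"
  unfolding iteration_script_def length_append
  by (subst length_concat_const[where m = "8 * r + 4"]) (auto simp: length_phase_script)

lemma length_coloring_script:
  "length (coloring_script d w r l J) = w + 1 + J * (l * (8 * r + 4) + 2)"
  unfolding coloring_script_def length_append
  by (subst length_concat_const[where m = "l * (8 * r + 4) + 2"], simp add: length_iteration_script)
     (subst length_concat_const[where m = 1], auto)

lemma conflict_weight_cong:
  assumes "\<And>u. u \<in> insert v S \<Longrightarrow> lc u = lc' u \<and> n0 u = n0' u \<and> n1 u = n1' u"
  shows "conflict_weight r lc n0 n1 S v x = conflict_weight r lc' n0' n1' S v x"
proof -
  have "{u \<in> S. choose_bit r (lc u) (n0 u) (n1 u) x = choose_bit r (lc v) (n0 v) (n1 v) x} =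
    {u \<in> S. choose_bit r (lc' u) (n0' u) (n1' u) x = choose_bit r (lc' v) (n0' v) (n1' v) x}"
    using assms by auto
  then show ?thesis using assms[of v] by (simp add: conflict_weight_def)
qed

lemma conflict_weight_le: "finite S \<Longrightarrow> conflict_weight r lc n0 n1 S v x \<le> 2 ^ r * card S"
  unfolding conflict_weight_def by (rule order_trans[OF div_le_dividend]) (auto intro: card_mono)

section \<open>Reasoning about scripts\<close>

context network
begin

text \<open>A Hoare triple whose conclusion includes that all messages fit.\<close>

definition triple :: "((nat \<Rightarrow> 'm) \<Rightarrow> bool) \<Rightarrow> 'm op list \<Rightarrow> ((nat \<Rightarrow> 'm) \<Rightarrow> bool) \<Rightarrow> bool" where
  "triple P xs Q \<longleftrightarrow> (\<forall>c. P c \<longrightarrow> script_fits xs c \<and> Q (run_script xs c))"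

lemma tripleI: "(\<And>c. P c \<Longrightarrow> script_fits xs c \<and> Q (run_script xs c)) \<Longrightarrow> triple P xs Q"
  by (simp add: triple_def)

lemma script_fits_append: "script_fits (xs @ ys) c \<longleftrightarrow> script_fits xs c \<and> script_fits ys (run_script xs c)"
  by (induction xs arbitrary: c) auto

lemma triple_append: "triple P xs Q \<Longrightarrow> triple Q ys R \<Longrightarrow> triple P (xs @ ys) R"
  by (simp add: triple_def script_fits_append)

lemma triple_loop:
  assumes "\<And>i. i < k \<Longrightarrow> triple (Inv i) (body i) (Inv (Suc i))"
  shows "triple (Inv 0) (concat (map body [0..<k])) (Inv k)"
  using assms
proof (induction k)
  case (Suc k)
  have "triple (Inv 0) (concat (map body [0..<k]) @ body k) (Inv (Suc k))"
    by (rule triple_append) (use Suc in auto)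
  then show ?case by simp
qed (simp add: triple_def)

lemma triple_conseq:
  "triple P xs Q \<Longrightarrow> (\<And>c. P' c \<Longrightarrow> P c) \<Longrightarrow> (\<And>c. Q c \<Longrightarrow> Q' c) \<Longrightarrow> triple P' xs Q'"
  by (simp add: triple_def)

end

section \<open>Invariants of the coloring script\<close>

text \<open>\<open>width\<close> makes hues fit into messages and finally serve as hash keys,
  \<open>precise\<close> bounds the rounding errors of all l phases by 1 / 2 per uncolored node, and
  \<open>weights_fit\<close> covers the sums of weights over any range of seeds.\<close>

locale coloring_network = network +
  fixes d C w r l :: nat and L :: "nat \<Rightarrow> nat set"
  assumes d_pos: "0 < d" and deg_le: "\<And>v. v \<in> V \<Longrightarrow> card (nb v) \<le> d"
    and lists: "\<And>v. v \<in> V \<Longrightarrow> color_list (I v) = L v" "\<And>v. v \<in> V \<Longrightarrow> L v \<subseteq> {..<C}"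
      "\<And>v. v \<in> V \<Longrightarrow> card (nb v) < card (L v)"
    and ids: "V \<subseteq> {..<2 ^ w}"
    and width: "max (4 * bits d + 28) w \<le> W" "(reduced_width d ^^ w) w \<le> r"
    and Cl: "C \<le> 2 ^ l" and l: "l < W"
    and precise: "2 * l * Suc d \<le> 2 ^ r"
    and weights_fit: "card V * (16 ^ r * (2 ^ r * d)) < 2 ^ W"
begin

definition reduced :: "nat \<Rightarrow> (nat \<Rightarrow> color_state) \<Rightarrow> bool" where
  "reduced u c \<longleftrightarrow> (\<forall>v\<in>V. hue (c v) < 2 ^ u \<and> (\<forall>x\<in>nb v. hue (c x) \<noteq> hue (c v)) \<and>
     avail (c v) = L v \<and> color (c v) = 0 \<and> prefix (c v) = 0)"

lemma nbD: "v \<in> V \<Longrightarrow> u \<in> nb v \<Longrightarrow> u \<in> V \<and> v \<in> nb u \<and> u \<noteq> v"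
  using nbrs nbrs_sym nbrs_irrefl by blast

lemma reduce_triple:
  assumes "u \<le> W"
  shows "triple (reduced u) [reduce_op d u] (reduced (reduced_width d u))"
proof (rule tripleI)
  fix c assume c: "reduced u c"
  define Y where "Y v = (\<lambda>x. hue (c x)) ` nb v" for v
  have Y: "hue (c v) < 2 ^ u" "Y v \<subseteq> {..<2 ^ u} - {hue (c v)}" "card (Y v) \<le> d" if v: "v \<in> V" for v
  proof -
    show "hue (c v) < 2 ^ u" using c v by (simp add: reduced_def)
    show "Y v \<subseteq> {..<2 ^ u} - {hue (c v)}" using c v nbD[OF v] by (auto simp: reduced_def Y_def)
    show "card (Y v) \<le> d"
      unfolding Y_def using card_image_le[OF fin_nb[OF v]] deg_le[OF v] by (rule order_trans)
  qed
  have run: "run_script [reduce_op d u] c v = (c v)\<lparr>hue := reduce_color d u (hue (c v)) (Y v)\<rparr>" for v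
  proof -
    have "(\<lambda>x. if x \<in> nb v then hue (c x) else 0) ` nb v = Y v" by (auto simp: Y_def)
    then show ?thesis by (simp add: reduce_op_def)
  qed
  have "script_fits [reduce_op d u] c"
  proof -
    have "hue (c v) < 2 ^ W" if "v \<in> V" for v
      using Y(1)[OF that] assms by (rule less_two_power_mono)
    then show ?thesis by (simp add: reduce_op_def)
  qed
  moreover have "reduced (reduced_width d u) (run_script [reduce_op d u] c)"
    unfolding reduced_def run
  proof (intro ballI conjI)
    fix v assume v: "v \<in> V"
    show "hue ((c v)\<lparr>hue := reduce_color d u (hue (c v)) (Y v)\<rparr>) < 2 ^ reduced_width d u"
      using reduce_color_less[OF d_pos Y[OF v]] by simp
    fix x assume x: "x \<in> nb v"
    then have xV: "x \<in> V" and vx: "v \<in> nb x" using nbD[OF v] by auto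
    have "hue (c v) \<in> Y x" using vx by (simp add: Y_def)
    from reduce_color_proper[OF d_pos Y[OF xV] Y[OF v] this]
    show "hue ((c x)\<lparr>hue := reduce_color d u (hue (c x)) (Y x)\<rparr>) \<noteq> hue ((c v)\<lparr>hue := reduce_color d u (hue (c v)) (Y v)\<rparr>)"
      by simp
  qed (use c in \<open>auto simp: reduced_def\<close>)
  ultimately show "script_fits [reduce_op d u] c \<and> reduced (reduced_width d u) (run_script [reduce_op d u] c)" ..
qed

definition static :: "(nat \<Rightarrow> color_state) \<Rightarrow> bool" where
  "static c \<longleftrightarrow> (\<forall>v\<in>V. hue (c v) < 2 ^ r \<and>
     (\<forall>u\<in>nb v. nb_hue (c v) u = hue (c u) \<and> hue (c u) \<noteq> hue (c v)))"

definition taken :: "(nat \<Rightarrow> color_state) \<Rightarrow> nat \<Rightarrow> nat set" where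
  "taken c v = {k. \<exists>u\<in>nb v. color (c u) = Suc k}"

definition proper :: "(nat \<Rightarrow> color_state) \<Rightarrow> bool" where
  "proper c \<longleftrightarrow> (\<forall>v\<in>V. \<forall>k. color (c v) = Suc k \<longrightarrow> k \<in> L v - taken c v)"

definition uncolored :: "(nat \<Rightarrow> color_state) \<Rightarrow> nat set" where
  "uncolored c = {v \<in> V. color (c v) = 0}"

definition conflicts :: "(nat \<Rightarrow> color_state) \<Rightarrow> (nat \<times> nat) set" where
  "conflicts c = {(v, u). v \<in> uncolored c \<and> u \<in> uncolored c \<and> u \<in> nb v \<and> prefix (c u) = prefix (c v)}"

definition potential :: "nat \<Rightarrow> (nat \<Rightarrow> color_state) \<Rightarrow> real" where
  "potential h c = (\<Sum>(v, u)\<in>conflicts c. 1 / real (card (slots h (c v))))"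

definition stable :: "nat \<Rightarrow> (nat \<Rightarrow> color_state) \<Rightarrow> bool" where
  "stable m c \<longleftrightarrow> static c \<and> proper c \<and> (\<forall>v\<in>V. avail (c v) = L v - taken c v) \<and> card (uncolored c) = m"

definition start :: "nat \<Rightarrow> (nat \<Rightarrow> color_state) \<Rightarrow> bool" where
  "start m c \<longleftrightarrow> stable m c \<and> (\<forall>v\<in>V. prefix (c v) = 0)"

text \<open>With i bits chosen, i phases may each have added the rounding error
  \<open>m * Suc d / 2 ^ r\<close> to an initial potential of at most m.\<close>

definition phase :: "nat \<Rightarrow> nat \<Rightarrow> (nat \<Rightarrow> color_state) \<Rightarrow> bool" where
  "phase m i c \<longleftrightarrow> stable m c \<and> (\<forall>v\<in>uncolored c. slots (l - i) (c v) \<noteq> {}) \<and>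
     potential (l - i) c \<le> m + real i * (m * Suc d / 2 ^ r)"

lemma linial_triple:
  "triple (\<lambda>c. c = (\<lambda>v. init_state (I v)))
     (concat (map (\<lambda>i. [reduce_op d ((reduced_width d ^^ i) w)]) [0..<w]) @ [share_hue_op])
     (start (card V))"
proof (rule triple_append)
  have loop: "triple (reduced ((reduced_width d ^^ 0) w)) (concat (map (\<lambda>i. [reduce_op d ((reduced_width d ^^ i) w)]) [0..<w]))
    (reduced ((reduced_width d ^^ w) w))"
  proof (rule triple_loop[where Inv = "\<lambda>i. reduced ((reduced_width d ^^ i) w)"])
    fix i
    have "(reduced_width d ^^ i) w \<le> W" using reduced_width_iterate_le[of i d w] width(1) by arith
    from reduce_triple[OF this]
    show "triple (reduced ((reduced_width d ^^ i) w)) [reduce_op d ((reduced_width d ^^ i) w)]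
        (reduced ((reduced_width d ^^ Suc i) w))" by simp
  qed
  have init: "reduced w (\<lambda>v. init_state (I v))"
    unfolding reduced_def
  proof (intro ballI conjI)
    fix v assume v: "v \<in> V"
    show "hue (init_state (I v)) < 2 ^ w" using ids v own_id[OF v] by (auto simp: init_state_def)
    show "avail (init_state (I v)) = L v" using lists(1)[OF v] by (simp add: init_state_def)
    fix x assume "x \<in> nb v"
    then have "x \<in> V" "x \<noteq> v" using nbD[OF v] by auto
    then show "hue (init_state (I x)) \<noteq> hue (init_state (I v))"
      using own_id v by (simp add: init_state_def)
  qed (simp_all add: init_state_def)
  show "triple (\<lambda>c. c = (\<lambda>v. init_state (I v)))
     (concat (map (\<lambda>i. [reduce_op d ((reduced_width d ^^ i) w)]) [0..<w])) (reduced ((reduced_width d ^^ w) w))"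
    by (rule triple_conseq[OF loop]) (use init in simp_all)
next
  show "triple (reduced ((reduced_width d ^^ w) w)) [share_hue_op] (start (card V))"
  proof (rule tripleI)
    fix c assume c: "reduced ((reduced_width d ^^ w) w) c"
    have lt: "hue (c v) < 2 ^ r" "hue (c v) < 2 ^ W" if "v \<in> V" for v
    proof -
      have h: "hue (c v) < 2 ^ ((reduced_width d ^^ w) w)" using c that by (simp add: reduced_def)
      show "hue (c v) < 2 ^ r" using h width(2) by (rule less_two_power_mono)
      have "(reduced_width d ^^ w) w \<le> W" using reduced_width_iterate_le[of w d w] width(1) by arith
      with h show "hue (c v) < 2 ^ W" by (rule less_two_power_mono)
    qed
    have run: "run_script [share_hue_op] c v = (c v)\<lparr>nb_hue := \<lambda>u. if u \<in> nb v then hue (c u) else 0\<rparr>" for v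
      by (simp add: share_hue_op_def)
    have "script_fits [share_hue_op] c" using lt by (simp add: share_hue_op_def)
    moreover have "start (card V) (run_script [share_hue_op] c)"
    proof -
      have col: "color (c v) = 0" if "v \<in> V" for v using c that by (simp add: reduced_def)
      have tk: "taken (run_script [share_hue_op] c) v = {}" if "v \<in> V" for v
        using col nbD[OF that] by (auto simp: taken_def run simp del: fold.simps)
      have un: "uncolored (run_script [share_hue_op] c) = V"
        using col by (auto simp: uncolored_def run simp del: fold.simps)
      show ?thesis
        using c lt tk un col by (auto simp: start_def stable_def static_def proper_def run reduced_def simp del: fold.simps)
    qed
    ultimately show "script_fits [share_hue_op] c \<and> start (card V) (run_script [share_hue_op] c)" ..
  qed
qed

end

lemma half_slots_simps [simp]:
  "half_slots h b (s\<lparr>nb_prefix := f\<rparr>) = half_slots h b s"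
  "half_slots h b (s\<lparr>nb_zeros := f\<rparr>) = half_slots h b s"
  "half_slots h b (s\<lparr>nb_ones := f\<rparr>) = half_slots h b s"
  "half_slots h b (s\<lparr>seed := x\<rparr>) = half_slots h b s"
  "half_slots h b (s\<lparr>total := x\<rparr>) = half_slots h b s"
  by (simp_all add: half_slots_def)

lemma node_weight_simps [simp]:
  "node_weight r h I (s\<lparr>seed := x\<rparr>) = node_weight r h I s"
  "node_weight r h I (s\<lparr>total := x\<rparr>) = node_weight r h I s"
  by (simp_all add: node_weight_def fun_eq_iff)

lemma slots_Suc: "slots (Suc h) s = half_slots h 0 s \<union> half_slots h 1 s"
proof -
  have "k div 2 ^ Suc h = p \<longleftrightarrow> k div 2 ^ h = 2 * p \<or> k div 2 ^ h = 2 * p + 1" for k p :: nat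
    unfolding power_Suc2 div_mult2_eq by linarith
  then show ?thesis by (auto simp: slots_def half_slots_def)
qed

lemma half_slots_disjoint: "half_slots h 0 s \<inter> half_slots h 1 s = {}"
  by (auto simp: half_slots_def)

lemma seed_range_Suc: "seed_range (Suc e) x = seed_range e (2 * x) \<union> seed_range e (2 * x + 1)"
  "seed_range e (2 * x) \<inter> seed_range e (2 * x + 1) = {}"
  by (auto simp: seed_range_def)

text \<open>The components on which \<open>phase\<close> depends; sharing data and fixing seed bits
  leave them alone.\<close>

definition core :: "color_state \<Rightarrow> nat \<times> (nat \<Rightarrow> nat) \<times> nat set \<times> nat \<times> nat" where
  "core s = (hue s, nb_hue s, avail s, color s, prefix s)"

context coloring_network
begin

lemma phase_cong:
  assumes "\<And>v. core (c' v) = core (c v)" "phase m i c"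
  shows "phase m i c'"
proof -
  have f: "hue (c' v) = hue (c v)" "nb_hue (c' v) = nb_hue (c v)" "avail (c' v) = avail (c v)"
    "color (c' v) = color (c v)" "prefix (c' v) = prefix (c v)" for v
    using assms(1)[of v] by (auto simp: core_def)
  have "taken c' = taken c" "uncolored c' = uncolored c" "conflicts c' = conflicts c"
    by (simp_all add: taken_def uncolored_def conflicts_def fun_eq_iff f)
  moreover have "slots h (c' v) = slots h (c v)" for h v by (simp add: slots_def f)
  ultimately show ?thesis
    using assms(2) by (simp add: phase_def stable_def static_def proper_def potential_def f)
qed

lemma fin_uncolored: "finite (uncolored c)"
  using finV by (simp add: uncolored_def)

lemma conflicts_sub: "conflicts c \<subseteq> uncolored c \<times> uncolored c"
  by (auto simp: conflicts_def)

lemma card_conflicts_le: "card (conflicts c) \<le> card (uncolored c) * d"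
proof -
  have "conflicts c \<subseteq> Sigma (uncolored c) nb" by (auto simp: conflicts_def)
  moreover have fin: "\<forall>v\<in>uncolored c. finite (nb v)" using fin_nb by (simp add: uncolored_def)
  ultimately have "card (conflicts c) \<le> card (Sigma (uncolored c) nb)"
    using fin_uncolored by (intro card_mono finite_SigmaI) auto
  also have "\<dots> = (\<Sum>v\<in>uncolored c. card (nb v))" by (rule card_SigmaI[OF fin_uncolored fin])
  also have "\<dots> \<le> (\<Sum>v\<in>uncolored c. d)" by (rule sum_mono) (simp add: deg_le uncolored_def)
  finally show ?thesis by simp
qed

lemma sym_conflicts: "sym (conflicts c)"
proof (rule symI)
  fix v u assume vu: "(v, u) \<in> conflicts c"
  then have "v \<in> nb u" using nbD[of v u] by (simp add: conflicts_def uncolored_def)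
  then show "(u, v) \<in> conflicts c" using vu by (simp add: conflicts_def)
qed

lemma irrefl_conflicts: "irrefl (conflicts c)"
proof (rule irreflI)
  fix v show "(v, v) \<notin> conflicts c"
    using nbrs_irrefl[of v] by (simp add: conflicts_def uncolored_def)
qed

lemma stable_avail: "stable m c \<Longrightarrow> v \<in> V \<Longrightarrow> avail (c v) \<subseteq> {..<C} \<and> finite (avail (c v))"
proof -
  assume "stable m c" "v \<in> V"
  then have "avail (c v) \<subseteq> {..<C}" using lists(2)[of v] by (auto simp: stable_def)
  moreover from this have "finite (avail (c v))" by (rule finite_subset) simp
  ultimately show ?thesis ..
qed

lemma fin_half_slots: "stable m c \<Longrightarrow> v \<in> V \<Longrightarrow> finite (half_slots h b (c v))"
  using stable_avail[of m c v] by (simp add: half_slots_def)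

lemma card_half_slots_less: "stable m c \<Longrightarrow> v \<in> V \<Longrightarrow> card (half_slots h b (c v)) < 2 ^ W"
proof -
  assume "stable m c" "v \<in> V"
  then have "avail (c v) \<subseteq> {..<C}" using stable_avail by blast
  then have "half_slots h b (c v) \<subseteq> {..<C}" by (auto simp: half_slots_def)
  then have "card (half_slots h b (c v)) \<le> C" using card_mono[of "{..<C}" "half_slots h b (c v)"] by simp
  also have "\<dots> \<le> 2 ^ l" by (rule Cl)
  also have "\<dots> < 2 ^ W" using l by simp
  finally show ?thesis .
qed

lemma Suc_prefix_less:
  assumes "phase m i c" "v \<in> uncolored c"
  shows "Suc (prefix (c v)) < 2 ^ W"
proof -
  obtain k where k: "k \<in> avail (c v)" "k div 2 ^ (l - i) = prefix (c v)"
    using assms by (auto simp: phase_def slots_def)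
  have "stable m c" "v \<in> V" using assms by (simp_all add: phase_def uncolored_def)
  from stable_avail[OF this] have "k < C" using k(1) by blast
  moreover have "prefix (c v) \<le> k" using k(2) div_le_dividend by metis
  ultimately have "Suc (prefix (c v)) \<le> 2 ^ l" using Cl by linarith
  also have "\<dots> < 2 ^ W" using l by simp
  finally show ?thesis .
qed

text \<open>Each colored neighbor takes at most one color from a list longer than the degree, so an
  uncolored node has more colors left than uncolored neighbors, and its terms of the potential sum
  up to at most 1.\<close>

lemma start_imp_phase:
  assumes "start m c"
  shows "phase m 0 c"
proof -
  have st: "stable m c" and p: "\<And>v. v \<in> V \<Longrightarrow> prefix (c v) = 0" using assms by (auto simp: start_def)
  have sl: "slots l (c v) = avail (c v)" if "v \<in> V" for v
  proof -
    have "k div 2 ^ l = 0" if "k \<in> avail (c v)" for k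
    proof -
      have "k < C" using stable_avail[OF st \<open>v \<in> V\<close>] that by blast
      then show ?thesis using Cl by simp
    qed
    then show ?thesis using p[OF that] by (auto simp: slots_def)
  qed
  have big: "card {u. (v, u) \<in> conflicts c} < card (avail (c v))" if v: "v \<in> uncolored c" for v
  proof -
    have vV: "v \<in> V" using v by (simp add: uncolored_def)
    let ?A = "{u \<in> nb v. color (c u) = 0}" and ?B = "{u \<in> nb v. color (c u) \<noteq> 0}"
    have f: "finite ?A" "finite ?B" using fin_nb[OF vV] by auto
    have "card {u. (v, u) \<in> conflicts c} \<le> card ?A"
      by (rule card_mono[OF f(1)]) (auto simp: conflicts_def uncolored_def)
    moreover have "taken c v \<subseteq> (\<lambda>u. color (c u) - 1) ` ?B" by (force simp: taken_def)
    then have "card (taken c v) \<le> card ?B" "finite (taken c v)"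
      using f(2) by (auto intro: surj_card_le finite_surj)
    moreover have "card (nb v) = card ?A + card ?B"
      using f by (subst card_Un_disjoint[symmetric]) (auto intro!: arg_cong[where f = card])
    moreover have "card (L v) - card (taken c v) \<le> card (L v - taken c v)"
      by (rule diff_card_le_card_Diff) fact
    moreover have "avail (c v) = L v - taken c v" using st vV by (simp add: stable_def)
    ultimately show ?thesis using lists(3)[OF vV] by simp
  qed
  have "potential l c = (\<Sum>v\<in>uncolored c. \<Sum>u\<in>{u. (v, u) \<in> conflicts c}. 1 / real (card (slots l (c v))))"
  proof -
    have "conflicts c = Sigma (uncolored c) (\<lambda>v. {u. (v, u) \<in> conflicts c})" using conflicts_sub by auto
    moreover have "\<forall>v\<in>uncolored c. finite {u. (v, u) \<in> conflicts c}"
      using fin_nb by (auto simp: conflicts_def uncolored_def)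
    ultimately show ?thesis
      unfolding potential_def
      using sum.Sigma[OF fin_uncolored, where B = "\<lambda>v. {u. (v, u) \<in> conflicts c}"
          and g = "\<lambda>v u. 1 / real (card (slots l (c v)))"] by simp
  qed
  also have "\<dots> \<le> (\<Sum>v\<in>uncolored c. 1)"
  proof (rule sum_mono)
    fix v assume v: "v \<in> uncolored c"
    have "(\<Sum>u\<in>{u. (v, u) \<in> conflicts c}. 1 / real (card (slots l (c v)))) =
        card {u. (v, u) \<in> conflicts c} / card (avail (c v))"
      using v sl by (simp add: uncolored_def)
    also have "\<dots> \<le> 1" using big[OF v] by simp
    finally show "(\<Sum>u\<in>{u. (v, u) \<in> conflicts c}. 1 / real (card (slots l (c v)))) \<le> 1" .
  qed
  also have "\<dots> = m" using st by (simp add: stable_def)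
  finally have "potential l c \<le> m" .
  moreover have "slots l (c v) \<noteq> {}" if "v \<in> uncolored c" for v
    using sl[of v] big[OF that] that by (auto simp: uncolored_def)
  ultimately show ?thesis using st by (simp add: phase_def)
qed

section \<open>Derandomizing one bit\<close>

definition shared :: "nat \<Rightarrow> (nat \<Rightarrow> color_state) \<Rightarrow> bool" where
  "shared h c \<longleftrightarrow> (\<forall>v\<in>V. \<forall>u\<in>nb v.
     nb_prefix (c v) u = (if color (c u) = 0 then Suc (prefix (c u)) else 0) \<and>
     nb_zeros (c v) u = card (half_slots h 0 (c u)) \<and> nb_ones (c v) u = card (half_slots h 1 (c u)))"

definition weight_at :: "nat \<Rightarrow> (nat \<Rightarrow> color_state) \<Rightarrow> nat \<Rightarrow> nat" where
  "weight_at h c x = (\<Sum>v\<in>V. node_weight r h (I v) (c v) x)"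

text \<open>Conditional expectations without fractions: the mean over the seeds with leading bits
  \<open>\<sigma>\<close> is at most the mean over all seeds, both multiplied by
  \<open>16 ^ r\<close>.\<close>

definition seeded :: "nat \<Rightarrow> nat \<Rightarrow> nat \<Rightarrow> (nat \<Rightarrow> color_state) \<Rightarrow> bool" where
  "seeded m i k c \<longleftrightarrow> phase m i c \<and> shared (l - Suc i) c \<and>
     (\<exists>\<sigma><2 ^ k. (\<forall>v\<in>V. seed (c v) = \<sigma>) \<and>
        (\<Sum>x\<in>seed_range (4 * r - k) \<sigma>. weight_at (l - Suc i) c x) * 2 ^ k \<le>
        (\<Sum>x<16 ^ r. weight_at (l - Suc i) c x))"

lemma share_triple:
  "triple (phase m i) [share_prefix_op, share_zeros_op h, share_ones_op h]
     (\<lambda>c. phase m i c \<and> shared h c \<and> (\<forall>v. seed (c v) = 0))"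
proof (rule tripleI)
  fix c assume c: "phase m i c"
  let ?xs = "[share_prefix_op, share_zeros_op h, share_ones_op h]"
  have st: "stable m c" using c by (simp add: phase_def)
  have run: "run_script ?xs c v = (c v)
     \<lparr>nb_prefix := \<lambda>u. if u \<in> nb v then if color (c u) = 0 then Suc (prefix (c u)) else 0 else 0,
      nb_zeros := \<lambda>u. if u \<in> nb v then card (half_slots h 0 (c u)) else 0,
      nb_ones := \<lambda>u. if u \<in> nb v then card (half_slots h 1 (c u)) else 0, seed := 0\<rparr>" for v
    by (simp add: share_prefix_op_def share_zeros_op_def share_ones_op_def cong: if_cong)
  have "script_fits ?xs c"
    using Suc_prefix_less[OF c] card_half_slots_less[OF st]
    by (simp add: share_prefix_op_def share_zeros_op_def share_ones_op_def uncolored_def)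
  moreover have "phase m i (run_script ?xs c)"
    by (rule phase_cong[OF _ c]) (simp only: run core_def, simp)
  moreover have "shared h (run_script ?xs c)"
    unfolding shared_def run by simp
  moreover have "seed (run_script ?xs c v) = 0" for v unfolding run by simp
  ultimately show "script_fits ?xs c \<and> (phase m i (run_script ?xs c) \<and> shared h (run_script ?xs c) \<and>
      (\<forall>v. seed (run_script ?xs c v) = 0))" by blast
qed

lemma node_weight_le:
  assumes "v \<in> V"
  shows "node_weight r h (I v) s x \<le> 2 ^ r * d"
proof (cases "color s = 0")
  case True
  let ?S = "{u \<in> nb v. nb_prefix s u = Suc (prefix s)}"
  have f: "finite ?S" using fin_nb[OF assms] by simp
  have "card ?S \<le> card (nb v)" by (rule card_mono[OF fin_nb[OF assms]]) auto
  then have "card ?S \<le> d" using deg_le[OF assms] by simp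
  then have "2 ^ r * card ?S \<le> 2 ^ r * d" by simp
  moreover have "node_weight r h (I v) s x \<le> 2 ^ r * card ?S"
    unfolding node_weight_def using True conflict_weight_le[OF f] by simp
  ultimately show ?thesis by linarith
qed (simp add: node_weight_def)

lemma range_weight_fits:
  assumes "e < 4 * r"
  shows "(\<Sum>v\<in>V. range_weight r h e b (I v) (c v)) < 2 ^ W"
proof -
  have "range_weight r h e b (I v) (c v) \<le> 16 ^ r * (2 ^ r * d)" if "v \<in> V" for v
  proof -
    have "range_weight r h e b (I v) (c v) \<le> (\<Sum>x\<in>seed_range e (2 * seed (c v) + b). 2 ^ r * d)"
      unfolding range_weight_def by (rule sum_mono) (rule node_weight_le[OF that])
    also have "\<dots> = 2 ^ e * (2 ^ r * d)" by (simp add: seed_range_def)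
    also have "\<dots> \<le> 2 ^ (4 * r) * (2 ^ r * d)"
      using assms by (intro mult_right_mono power_increasing) auto
    finally show ?thesis by (simp add: power_mult)
  qed
  then have "(\<Sum>v\<in>V. range_weight r h e b (I v) (c v)) \<le> (\<Sum>v\<in>V. 16 ^ r * (2 ^ r * d))"
    by (rule sum_mono)
  then show ?thesis using weights_fit by simp
qed

text \<open>The lighter half of a range carries at most half of its weight. Both weights are global
  sums, so all nodes decide alike and keep a common seed.\<close>

lemma seed_bit_triple:
  assumes k: "k < 4 * r"
  shows "triple (seeded m i k) (seed_bit_script r (l - Suc i) (4 * r - Suc k)) (seeded m i (Suc k))"
proof (rule tripleI)
  fix c assume c: "seeded m i k c"
  define h where "h = l - Suc i"
  define e where "e = 4 * r - Suc k"
  have e: "4 * r - k = Suc e" "e < 4 * r" using k by (auto simp: e_def)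
  let ?xs = "seed_bit_script r h e"
  obtain \<sigma> where \<sigma>: "\<sigma> < 2 ^ k" "\<And>v. v \<in> V \<Longrightarrow> seed (c v) = \<sigma>"
    "(\<Sum>x\<in>seed_range (Suc e) \<sigma>. weight_at h c x) * 2 ^ k \<le> (\<Sum>x<16 ^ r. weight_at h c x)"
    and ph: "phase m i c" "shared h c"
    using c e unfolding seeded_def h_def by auto
  define S where "S b = (\<Sum>x\<in>seed_range e (2 * \<sigma> + b). weight_at h c x)" for b
  have S: "(\<Sum>v\<in>V. range_weight r h e b (I v) (c' v)) = S b"
    if "\<And>v. v \<in> V \<Longrightarrow> c' v = (c v)\<lparr>total := x\<rparr> \<or> c' v = c v" for b c' x
  proof -
    have "(\<Sum>v\<in>V. range_weight r h e b (I v) (c' v)) =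
        (\<Sum>v\<in>V. \<Sum>x\<in>seed_range e (2 * \<sigma> + b). node_weight r h (I v) (c v) x)"
      unfolding range_weight_def by (rule sum.cong) (use that \<sigma>(2) in fastforce)+
    also have "\<dots> = S b" unfolding S_def weight_at_def by (rule sum.swap)
    finally show ?thesis .
  qed
  define b where "b = (if S 0 \<le> S 1 then 0 else 1 :: nat)"
  have run: "run_script ?xs c v = (c v)\<lparr>total := S 0, seed := 2 * seed (c v) + b\<rparr>" for v
    using S[of c 0 0] S[of "\<lambda>v. (c v)\<lparr>total := S 0\<rparr>" "S 0" 1] by (simp add: seed_bit_script_def b_def)
  have fits: "script_fits ?xs c"
    using range_weight_fits[OF e(2)] by (simp add: seed_bit_script_def)
  have w: "weight_at h (run_script ?xs c) = weight_at h c"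
    unfolding weight_at_def run by (simp add: fun_eq_iff)
  have "S b \<le> S (1 - b)" "b \<le> 1" by (auto simp: b_def)
  moreover have "(\<Sum>x\<in>seed_range (Suc e) \<sigma>. weight_at h c x) = S 0 + S 1"
    unfolding seed_range_Suc(1) S_def
    by (subst sum.union_disjoint) (use seed_range_Suc(2) in \<open>auto simp: seed_range_def\<close>)
  ultimately have "2 * S b \<le> (\<Sum>x\<in>seed_range (Suc e) \<sigma>. weight_at h c x)" by (auto simp: b_def)
  then have "2 * S b * 2 ^ k \<le> (\<Sum>x\<in>seed_range (Suc e) \<sigma>. weight_at h c x) * 2 ^ k"
    by (rule mult_right_mono) simp
  also note \<sigma>(3)
  finally have "S b * 2 ^ Suc k \<le> (\<Sum>x<16 ^ r. weight_at h c x)" by (simp add: mult_ac)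
  then have sum: "(\<Sum>x\<in>seed_range (4 * r - Suc k) (2 * \<sigma> + b). weight_at h (run_script ?xs c) x) * 2 ^ Suc k
      \<le> (\<Sum>x<16 ^ r. weight_at h (run_script ?xs c) x)"
    unfolding w by (simp add: S_def e_def)
  have "phase m i (run_script ?xs c)"
    by (rule phase_cong[OF _ ph(1)]) (simp only: run core_def, simp)
  moreover have "shared h (run_script ?xs c)"
    using ph(2) unfolding shared_def run by simp
  moreover have "2 * \<sigma> + b < 2 ^ Suc k" using \<sigma>(1) \<open>b \<le> 1\<close> by simp
  moreover have "seed (run_script ?xs c v) = 2 * \<sigma> + b" if "v \<in> V" for v
    unfolding run using \<sigma>(2)[OF that] by simp
  ultimately have "seeded m i (Suc k) (run_script ?xs c)"
    using sum unfolding seeded_def h_def[symmetric] by blast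
  with fits show "script_fits (seed_bit_script r (l - Suc i) (4 * r - Suc k)) c \<and>
      seeded m i (Suc k) (run_script (seed_bit_script r (l - Suc i) (4 * r - Suc k)) c)"
    by (simp add: h_def e_def)
qed

end

context coloring_network
begin

text \<open>After \<open>4 * r\<close> bits the range consists of a single seed, and the invariant
  \<open>seeded\<close> becomes the hypothesis of \<open>potential_step\<close>.\<close>

lemma extend_triple:
  assumes i: "i < l"
  shows "triple (seeded m i (4 * r)) [extend_op r (l - Suc i)] (phase m (Suc i))"
proof (rule tripleI)
  fix c assume c: "seeded m i (4 * r) c"
  define h where "h = l - Suc i"
  have h: "l - i = Suc h" using i by (simp add: h_def)
  have ph: "phase m i c" and sh: "shared h c" using c by (simp_all add: seeded_def h_def)
  have st: "stable m c" using ph by (simp add: phase_def)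
  obtain \<sigma> where \<sigma>: "\<And>v. v \<in> V \<Longrightarrow> seed (c v) = \<sigma>"
    "weight_at h c \<sigma> * 2 ^ (4 * r) \<le> (\<Sum>x<16 ^ r. weight_at h c x)"
    using c by (auto simp: seeded_def h_def seed_range_def)
  define U where "U = uncolored c"
  define E where "E = conflicts c"
  define n0 where "n0 v = card (half_slots h 0 (c v))" for v
  define n1 where "n1 v = card (half_slots h 1 (c v))" for v
  have UV: "v \<in> V" if "v \<in> U" for v using that by (simp add: U_def uncolored_def)
  have n01: "n0 v + n1 v = card (slots (Suc h) (c v))" if "v \<in> V" for v
    unfolding n0_def n1_def slots_Suc
    using fin_half_slots[OF st that] half_slots_disjoint by (simp add: card_Un_disjoint)
  interpret ob: one_bit U E "\<lambda>v. hue (c v)" n0 n1 r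
  proof
    show "finite U" "E \<subseteq> U \<times> U" using fin_uncolored conflicts_sub by (simp_all add: U_def E_def)
    show "hue (c v) < 2 ^ r" if "v \<in> U" for v
      using st UV[OF that] by (simp add: stable_def static_def)
    show "hue (c v) \<noteq> hue (c u)" if "(v, u) \<in> E" for v u
    proof -
      have "v \<in> V" "u \<in> nb v" using that by (auto simp: E_def conflicts_def uncolored_def)
      then show ?thesis using st by (fastforce simp: stable_def static_def)
    qed
    show "0 < n0 v + n1 v" if "v \<in> U" for v
    proof -
      have "slots (Suc h) (c v) \<noteq> {}" using ph that unfolding phase_def h U_def by blast
      moreover have "finite (slots (Suc h) (c v))"
        unfolding slots_Suc using fin_half_slots[OF st UV[OF that]] by blast
      ultimately show ?thesis unfolding n01[OF UV[OF that]] by (simp add: card_gt_0_iff)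
    qed
  qed
  \<comment> \<open>The weight computed from received tables is that of \<open>one_bit\<close>: the
    neighbors in conflict are exactly those that announced the same prefix.\<close>
  have nw: "node_weight r h (I v) (c v) x = (if v \<in> U then
      conflict_weight r (\<lambda>v. hue (c v)) n0 n1 {u. (v, u) \<in> E} v x else 0)" if v: "v \<in> V" for v x
  proof (cases "v \<in> U")
    case True
    then have col: "color (c v) = 0" by (simp add: U_def uncolored_def)
    have nbp: "nb_prefix (c v) u = (if color (c u) = 0 then Suc (prefix (c u)) else 0)" if "u \<in> nb v" for u
      using sh v that by (simp add: shared_def)
    have S: "{u \<in> nb v. nb_prefix (c v) u = Suc (prefix (c v))} = {u. (v, u) \<in> E}"
    proof (intro equalityI subsetI)
      fix u assume "u \<in> {u \<in> nb v. nb_prefix (c v) u = Suc (prefix (c v))}"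
      then show "u \<in> {u. (v, u) \<in> E}"
        using True nbp[of u] nbD[OF v, of u] by (auto simp: E_def conflicts_def U_def uncolored_def split: if_splits)
    next
      fix u assume "u \<in> {u. (v, u) \<in> E}"
      then show "u \<in> {u \<in> nb v. nb_prefix (c v) u = Suc (prefix (c v))}"
        using nbp[of u] by (auto simp: E_def conflicts_def uncolored_def)
    qed
    have "node_weight r h (I v) (c v) x = conflict_weight r ((nb_hue (c v))(v := hue (c v)))
        ((nb_zeros (c v))(v := n0 v)) ((nb_ones (c v))(v := n1 v)) {u. (v, u) \<in> E} v x"
      unfolding node_weight_def using col S own_id[OF v] by (simp add: n0_def n1_def)
    also have "\<dots> = conflict_weight r (\<lambda>v. hue (c v)) n0 n1 {u. (v, u) \<in> E} v x"
    proof (rule conflict_weight_cong)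
      fix u assume "u \<in> insert v {u. (v, u) \<in> E}"
      then have "u = v \<or> u \<in> nb v" by (auto simp: E_def conflicts_def)
      then show "((nb_hue (c v))(v := hue (c v))) u = hue (c u) \<and>
          ((nb_zeros (c v))(v := n0 v)) u = n0 u \<and> ((nb_ones (c v))(v := n1 v)) u = n1 u"
        using sh st v by (auto simp: shared_def stable_def static_def n0_def n1_def)
    qed
    finally show ?thesis using True by simp
  next
    case False
    then show ?thesis using v by (simp add: node_weight_def U_def uncolored_def)
  qed
  have weight: "weight_at h c x = ob.weight x" for x
  proof -
    have "weight_at h c x = (\<Sum>v\<in>V. if v \<in> U then
        conflict_weight r (\<lambda>v. hue (c v)) n0 n1 {u. (v, u) \<in> E} v x else 0)"
      unfolding weight_at_def by (rule sum.cong) (simp_all add: nw)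
    also have "\<dots> = (\<Sum>v\<in>V \<inter> U. conflict_weight r (\<lambda>v. hue (c v)) n0 n1 {u. (v, u) \<in> E} v x)"
      using finV by (simp add: sum.inter_restrict)
    also have "V \<inter> U = U" using UV by blast
    finally show ?thesis by (simp add: ob.weight_def)
  qed
  have good: "ob.weight \<sigma> * 16 ^ r \<le> (\<Sum>x<16 ^ r. ob.weight x)"
    using \<sigma>(2) by (simp add: weight power_mult)
  define c' where "c' = run_script [extend_op r h] c"
  have c'_V: "c' v = (c v)\<lparr>prefix := 2 * prefix (c v) + (if ob.bit \<sigma> v then 1 else 0)\<rparr>" if "v \<in> V" for v
    using \<sigma>(1)[OF that] by (simp add: c'_def extend_op_def ob.bit_def n0_def n1_def)
  have c'_core: "hue (c' v) = hue (c v)" "nb_hue (c' v) = nb_hue (c v)" "avail (c' v) = avail (c v)"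
    "color (c' v) = color (c v)" for v
    by (simp_all add: c'_def extend_op_def)
  have U': "uncolored c' = U" by (simp add: U_def uncolored_def c'_core)
  have "taken c' = taken c" by (simp add: taken_def c'_core fun_eq_iff)
  then have st': "stable m c'"
    using st U' by (simp add: stable_def static_def proper_def c'_core U_def)
  have E': "conflicts c' = {(v, u) \<in> E. ob.bit \<sigma> v = ob.bit \<sigma> u}"
  proof -
    have "prefix (c' u) = prefix (c' v) \<longleftrightarrow> prefix (c u) = prefix (c v) \<and> ob.bit \<sigma> v = ob.bit \<sigma> u"
      if "v \<in> U" "u \<in> U" for v u
    proof -
      have "2 * a + (if x then 1 else 0) = 2 * b + (if y then 1 else (0::nat)) \<longleftrightarrow> a = b \<and> y = x" for a b x y
        by (cases x; cases y; simp only: if_True if_False; presburger)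
      then show ?thesis using UV that by (simp add: c'_V)
    qed
    then show ?thesis unfolding conflicts_def E_def U' by (auto simp: U_def)
  qed
  have sz: "card (slots h (c' v)) = ob.size_after \<sigma> v" if "v \<in> V" for v
    using that by (simp add: slots_def c'_V ob.size_after_def n0_def n1_def half_slots_def)
  have "potential h c' = (\<Sum>(v, u)\<in>{(v, u) \<in> E. ob.bit \<sigma> v = ob.bit \<sigma> u}. 1 / real (ob.size_after \<sigma> v))"
    unfolding potential_def E'
    by (rule sum.cong) (use UV sz ob.EU in auto)
  also have "\<dots> \<le> (\<Sum>(v, u)\<in>E. 1 / real (n0 v + n1 v)) + (real (card E) + card U) / 2 ^ r"
    by (rule ob.potential_step[OF good])
  also have "(\<Sum>(v, u)\<in>E. 1 / real (n0 v + n1 v)) = potential (Suc h) c"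
    unfolding potential_def E_def[symmetric]
    by (rule sum.cong) (use UV n01 ob.EU in \<open>auto simp del: of_nat_add\<close>)
  also have "(real (card E) + card U) / 2 ^ r \<le> (m * d + m) / 2 ^ r"
  proof -
    have "card U = m" using st by (simp add: stable_def U_def)
    moreover have "card E \<le> card U * d" using card_conflicts_le by (simp add: U_def E_def)
    ultimately have "card E + card U \<le> m * d + m" by simp
    then have "real (card E + card U) \<le> real (m * d + m)" by (simp only: of_nat_le_iff)
    then show ?thesis by (intro divide_right_mono) auto
  qed
  finally have "potential h c' \<le> potential (Suc h) c + (m * d + m) / 2 ^ r" by simp
  also have "potential (Suc h) c \<le> m + real i * (m * Suc d / 2 ^ r)"
    using ph h by (simp add: phase_def)
  finally have pot: "potential h c' \<le> m + real (Suc i) * (m * Suc d / 2 ^ r)"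
    by (simp add: algebra_simps add_divide_distrib)
  have "slots h (c' v) \<noteq> {}" if "v \<in> U" for v
    using sz[OF UV[OF that]] ob.size_after_pos[OF that, of \<sigma>] by auto
  then have "phase m (Suc i) c'"
    unfolding phase_def U' using st' pot by (simp add: h_def)
  moreover have "script_fits [extend_op r h] c" by (simp add: extend_op_def)
  ultimately show "script_fits [extend_op r (l - Suc i)] c \<and> phase m (Suc i) (run_script [extend_op r (l - Suc i)] c)"
    by (simp only: c'_def h_def)
qed

lemma phase_triple:
  assumes "i < l"
  shows "triple (phase m i) (phase_script r (l - Suc i)) (phase m (Suc i))"
  unfolding phase_script_def
proof (intro triple_append)
  let ?h = "l - Suc i"
  show "triple (phase m i) [share_prefix_op, share_zeros_op ?h, share_ones_op ?h] (seeded m i 0)"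
    by (rule triple_conseq[OF share_triple]) (auto simp: seeded_def seed_range_def power_mult lessThan_atLeast0)
  show "triple (seeded m i 0) (concat (map (\<lambda>k. seed_bit_script r ?h (4 * r - Suc k)) [0..<4 * r])) (seeded m i (4 * r))"
    by (rule triple_loop) (rule seed_bit_triple)
  show "triple (seeded m i (4 * r)) [extend_op r ?h] (phase m (Suc i))"
    by (rule extend_triple[OF assms])
qed

text \<open>Once no bit is open, an uncolored node has a single candidate left, so the potential
  counts ordered conflicts and is at most m + m / 2. By \<open>card_keep_larger\<close> at least a
  quarter of the nodes keep their candidate.\<close>

lemma settle_triple:
  "triple (phase m l) [settle_op, prune_op] (\<lambda>c. \<exists>m'. start m' c \<and> 4 * m' \<le> 3 * m)"
proof (rule tripleI)
  fix c assume c: "phase m l c"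
  have st: "stable m c" using c by (simp add: phase_def)
  define U where "U = uncolored c"
  define E where "E = conflicts c"
  have UV: "v \<in> V" if "v \<in> U" for v using that by (simp add: U_def uncolored_def)
  have cardU: "card U = m" using st by (simp add: stable_def U_def)
  have sl: "slots 0 (c v) = {prefix (c v)}" "prefix (c v) \<in> avail (c v)" if "v \<in> U" for v
    using c that by (auto simp: phase_def slots_def U_def)
  have "real (card E) = potential 0 c"
  proof -
    have "potential 0 c = (\<Sum>(v, u)\<in>E. 1)"
      unfolding potential_def E_def[symmetric]
    proof (rule sum.cong)
      fix p assume "p \<in> E"
      then have "fst p \<in> U" using conflicts_sub[of c] by (cases p) (auto simp: E_def U_def)
      from sl(1)[OF this] show "(case p of (v, u) \<Rightarrow> 1 / real (card (slots 0 (c v)))) = (case p of (v, u) \<Rightarrow> 1)"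
        by (cases p) simp
    qed simp
    then show ?thesis by simp
  qed
  also have "\<dots> \<le> m + real l * (m * Suc d / 2 ^ r)" using c by (simp add: phase_def)
  also have "\<dots> \<le> m + real m / 2"
  proof -
    have "real (2 * l * Suc d) \<le> real (2 ^ r)" using precise by (simp only: of_nat_le_iff)
    then have "2 * (real l * Suc d) \<le> 2 ^ r" by (simp add: algebra_simps)
    then have "real m * (2 * (real l * Suc d)) \<le> real m * 2 ^ r" by (intro mult_left_mono) auto
    then show ?thesis by (simp add: field_simps)
  qed
  finally have "2 * real (card E) \<le> 3 * real (card U)" unfolding cardU by simp
  then have "2 * card E \<le> 3 * card U" by linarith
  define K where "K = {v \<in> U. \<forall>u. (v, u) \<in> E \<longrightarrow> u < v}"
  have cardK: "card U \<le> 4 * card K"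
    unfolding K_def U_def E_def
    by (rule card_keep_larger[OF fin_uncolored conflicts_sub sym_conflicts irrefl_conflicts])
      (use \<open>2 * card E \<le> 3 * card U\<close> in \<open>simp add: U_def E_def\<close>)
  define c1 where "c1 = run_op settle_op c"
  have c1: "c1 v = (if v \<in> K then (c v)\<lparr>color := Suc (prefix (c v))\<rparr> else c v)" if v: "v \<in> V" for v
  proof (cases "v \<in> U")
    case True
    have "(\<forall>u\<in>nb v. (if u \<in> nb v then if color (c u) = 0 then Suc (prefix (c u)) else 0 else 0) = Suc (prefix (c v)) \<longrightarrow> u < v)
        \<longleftrightarrow> (\<forall>u. (v, u) \<in> E \<longrightarrow> u < v)"
    proof
      assume a: "\<forall>u\<in>nb v. (if u \<in> nb v then if color (c u) = 0 then Suc (prefix (c u)) else 0 else 0) = Suc (prefix (c v)) \<longrightarrow> u < v"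
      show "\<forall>u. (v, u) \<in> E \<longrightarrow> u < v"
      proof (intro allI impI)
        fix u assume "(v, u) \<in> E"
        then have "u \<in> nb v" "color (c u) = 0" "prefix (c u) = prefix (c v)"
          by (auto simp: E_def conflicts_def uncolored_def)
        then show "u < v" using a by auto
      qed
    next
      assume a: "\<forall>u. (v, u) \<in> E \<longrightarrow> u < v"
      show "\<forall>u\<in>nb v. (if u \<in> nb v then if color (c u) = 0 then Suc (prefix (c u)) else 0 else 0) = Suc (prefix (c v)) \<longrightarrow> u < v"
      proof (intro ballI impI)
        fix u assume u: "u \<in> nb v"
          "(if u \<in> nb v then if color (c u) = 0 then Suc (prefix (c u)) else 0 else 0) = Suc (prefix (c v))"
        then have "color (c u) = 0" "prefix (c u) = prefix (c v)" by (auto split: if_splits)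
        then have "(v, u) \<in> E" using u(1) True nbD[OF v u(1)] by (simp add: E_def conflicts_def U_def uncolored_def)
        then show "u < v" using a by blast
      qed
    qed
    moreover have "color (c v) = 0" using True by (simp add: U_def uncolored_def)
    ultimately show ?thesis using True own_id[OF v]
      by (simp add: c1_def settle_op_def K_def)
  next
    case False
    then have "color (c v) \<noteq> 0" using v by (simp add: U_def uncolored_def)
    then show ?thesis using False by (simp add: c1_def settle_op_def K_def)
  qed
  have colK: "color (c1 v) = (if v \<in> K then Suc (prefix (c v)) else color (c v))" if "v \<in> V" for v
    using c1[OF that] by simp
  have oth: "hue (c1 v) = hue (c v)" "nb_hue (c1 v) = nb_hue (c v)" "avail (c1 v) = avail (c v)" for v
    by (simp_all add: c1_def settle_op_def)
  have avail: "avail (c v) = L v - taken c v" if "v \<in> V" for v using st that by (simp add: stable_def)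
  have KU: "v \<in> U" "color (c v) = 0" "v \<in> V" if "v \<in> K" for v
    using that by (auto simp: K_def U_def uncolored_def)
  have prop1: "proper c1"
    unfolding proper_def
  proof (intro ballI allI impI)
    fix v k assume v: "v \<in> V" and k: "color (c1 v) = Suc k"
    have "k \<in> L v"
    proof (cases "v \<in> K")
      case True
      then show ?thesis using k colK[OF v] sl(2)[of v] KU(1) avail[OF v] by auto
    next
      case False
      then show ?thesis using k colK[OF v] st v by (simp add: stable_def proper_def)
    qed
    moreover have "color (c1 u) \<noteq> Suc k" if u: "u \<in> nb v" for u
    proof
      assume k': "color (c1 u) = Suc k"
      have uV: "u \<in> V" and vu: "v \<in> nb u" using nbD[OF v u] by auto
      \<comment> \<open>Two neighbors that settle together with the same color would each need the
        larger identifier. A neighbor colored earlier cannot clash, because its color is no longer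
        available.\<close>
      consider "v \<in> K" "u \<in> K" | "v \<in> K" "u \<notin> K" | "v \<notin> K" "u \<in> K" | "v \<notin> K" "u \<notin> K" by blast
      then show False
      proof cases
        case 1
        then have "prefix (c u) = prefix (c v)" using k k' colK[OF v] colK[OF uV] by simp
        then have "(v, u) \<in> E" "(u, v) \<in> E"
          using 1 KU u vu by (auto simp: E_def conflicts_def U_def)
        then have "u < v" "v < u" using 1 by (auto simp: K_def)
        then show False by simp
      next
        case 2
        then have "k \<in> avail (c v)" using k colK[OF v] sl(2) KU(1) by auto
        moreover have "color (c u) = Suc k" using 2 k' colK[OF uV] by simp
        then have "k \<in> taken c v" using u by (auto simp: taken_def)
        ultimately show False using avail[OF v] by blast
      next
        case 3
        then have "k \<in> avail (c u)" using k' colK[OF uV] sl(2) KU(1) by auto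
        moreover have "color (c v) = Suc k" using 3 k colK[OF v] by simp
        then have "k \<in> taken c u" using vu by (auto simp: taken_def)
        ultimately show False using avail[OF uV] by blast
      next
        case 4
        then have "color (c v) = Suc k" "color (c u) = Suc k" using k k' colK[OF v] colK[OF uV] by simp_all
        then have "k \<in> taken c v" using u by (auto simp: taken_def)
        then show False using st v \<open>color (c v) = Suc k\<close> by (auto simp: stable_def proper_def)
      qed
    qed
    ultimately show "k \<in> L v - taken c1 v" by (auto simp: taken_def)
  qed
  define c2 where "c2 = run_script [settle_op, prune_op] c"
  have c2: "c2 v = (c1 v)\<lparr>avail := avail (c1 v) - taken c1 v, prefix := 0\<rparr>" for v
  proof -
    have "{k. \<exists>u\<in>nb v. (if u \<in> nb v then color (c1 u) else 0) = Suc k} = taken c1 v"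
      by (auto simp: taken_def)
    then show ?thesis by (simp add: c2_def c1_def[symmetric] prune_op_def)
  qed
  have col2: "color (c2 v) = color (c1 v)" for v by (simp add: c2)
  have tk2: "taken c2 = taken c1" by (simp add: taken_def col2 fun_eq_iff)
  have tk_mono: "taken c v \<subseteq> taken c1 v" if v: "v \<in> V" for v
  proof
    fix k assume "k \<in> taken c v"
    then obtain u where u: "u \<in> nb v" "color (c u) = Suc k" by (auto simp: taken_def)
    have "u \<in> V" using nbD[OF v u(1)] by blast
    moreover have "u \<notin> K" using u(2) KU(2)[of u] by auto
    ultimately have "color (c1 u) = Suc k" using colK u(2) by simp
    then show "k \<in> taken c1 v" using u(1) by (auto simp: taken_def)
  qed
  have un2: "uncolored c2 = U - K"
    using colK KU by (auto simp: uncolored_def col2 U_def split: if_splits)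
  have "stable (card (U - K)) c2"
    unfolding stable_def
  proof (intro conjI ballI)
    show "static c2" using st by (simp add: stable_def static_def c2 oth)
    show "proper c2" using prop1 by (simp add: proper_def tk2 col2)
    fix v assume v: "v \<in> V"
    show "avail (c2 v) = L v - taken c2 v"
      using tk_mono[OF v] avail[OF v] by (auto simp: c2 tk2 oth)
  qed (simp add: un2)
  then have "start (card (U - K)) c2" by (simp add: start_def c2)
  moreover have "4 * card (U - K) \<le> 3 * m"
  proof -
    have "K \<subseteq> U" by (auto simp: K_def)
    moreover have "finite U" using fin_uncolored by (simp add: U_def)
    ultimately have "card (U - K) = card U - card K" "card K \<le> card U"
      by (auto simp: card_Diff_subset finite_subset card_mono)
    then show ?thesis using cardK cardU by linarith
  qed
  moreover have "script_fits [settle_op, prune_op] c"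
  proof -
    have "color (c1 v) < 2 ^ W" if v: "v \<in> V" for v
    proof (cases "color (c1 v)")
      case (Suc k)
      then have "k \<in> L v" using prop1 v by (auto simp: proper_def)
      then have "k < C" using lists(2)[OF v] by blast
      then have "Suc k \<le> 2 ^ l" using Cl by simp
      also have "\<dots> < 2 ^ W" using l by simp
      finally show ?thesis using Suc by simp
    qed simp
    then have "op_fits prune_op c1" by (simp add: prune_op_def)
    moreover have "op_fits settle_op c"
      using Suc_prefix_less[OF c] by (simp add: settle_op_def uncolored_def)
    ultimately show ?thesis by (simp add: c1_def)
  qed
  ultimately show "script_fits [settle_op, prune_op] c \<and>
      (\<exists>m'. start m' (run_script [settle_op, prune_op] c) \<and> 4 * m' \<le> 3 * m)"
    unfolding c2_def by blast
qed

lemma iteration_triple: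
  "triple (start m) (iteration_script r l) (\<lambda>c. \<exists>m'. start m' c \<and> 4 * m' \<le> 3 * m)"
  unfolding iteration_script_def
proof (rule triple_append)
  have "triple (phase m 0) (concat (map (\<lambda>i. phase_script r (l - Suc i)) [0..<l])) (phase m l)"
    by (rule triple_loop) (rule phase_triple)
  then show "triple (start m) (concat (map (\<lambda>i. phase_script r (l - Suc i)) [0..<l])) (phase m l)"
    by (rule triple_conseq) (simp_all add: start_imp_phase)
  show "triple (phase m l) [settle_op, prune_op] (\<lambda>c. \<exists>m'. start m' c \<and> 4 * m' \<le> 3 * m)"
    by (rule settle_triple)
qed

text \<open>The hypothesis says that \<open>(3 / 4) ^ J\<close> times the number of nodes is below
  1, which leaves no uncolored node.\<close>

lemma coloring_triple:
  assumes J: "3 ^ J * card V < 4 ^ J"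
  shows "triple (\<lambda>c. c = (\<lambda>v. init_state (I v))) (coloring_script d w r l J)
    (\<lambda>c. proper c \<and> (\<forall>v\<in>V. color (c v) \<noteq> 0))"
proof -
  let ?Inv = "\<lambda>j c. \<exists>m. start m c \<and> 4 ^ j * m \<le> 3 ^ j * card V"
  have body: "triple (?Inv j) (iteration_script r l) (?Inv (Suc j))" for j
  proof (rule tripleI)
    fix c assume "?Inv j c"
    then obtain m where m: "start m c" "4 ^ j * m \<le> 3 ^ j * card V" by blast
    obtain m' where m': "script_fits (iteration_script r l) c" "start m' (run_script (iteration_script r l) c)" "4 * m' \<le> 3 * m"
      using iteration_triple[of m] m(1) unfolding triple_def by blast
    have "4 ^ Suc j * m' = 4 ^ j * (4 * m')" by simp
    also have "\<dots> \<le> 4 ^ j * (3 * m)" using m'(3) by (intro mult_left_mono) auto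
    also have "\<dots> = 3 * (4 ^ j * m)" by simp
    also have "\<dots> \<le> 3 * (3 ^ j * card V)" using m(2) by (intro mult_left_mono) auto
    finally have "4 ^ Suc j * m' \<le> 3 ^ Suc j * card V" by (simp add: mult.assoc)
    then show "script_fits (iteration_script r l) c \<and> ?Inv (Suc j) (run_script (iteration_script r l) c)"
      using m' by blast
  qed
  have loop: "triple (?Inv 0) (concat (map (\<lambda>_. iteration_script r l) [0..<J])) (?Inv J)"
    by (rule triple_loop) (rule body)
  have 1: "triple (\<lambda>c. c = (\<lambda>v. init_state (I v)))
     (concat (map (\<lambda>i. [reduce_op d ((reduced_width d ^^ i) w)]) [0..<w]) @ [share_hue_op]) (?Inv 0)"
    by (rule triple_conseq[OF linial_triple]) auto
  have fin: "proper c \<and> (\<forall>v\<in>V. color (c v) \<noteq> 0)" if Inv: "?Inv J c" for c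
  proof -
    obtain m where m: "start m c" "4 ^ J * m \<le> 3 ^ J * card V" using Inv by blast
    have "4 ^ J * m < 4 ^ J" using m(2) J by linarith
    then have "m = 0" by (cases m) auto
    then have "uncolored c = {}" using m(1) fin_uncolored by (simp add: start_def stable_def)
    then show ?thesis using m(1) by (auto simp: start_def stable_def uncolored_def)
  qed
  show ?thesis
    unfolding coloring_script_def append_assoc[symmetric]
    by (rule triple_append[OF 1]) (rule triple_conseq[OF loop], assumption, rule fin)
qed

end

section \<open>Choice of parameters\<close>

lemma lg_ge_1: "1 \<le> lg x"
  by (simp add: lg_def)

lemma log_le_lg: "log 2 x \<le> lg x"
  by (simp add: lg_def)

lemma bits_le_lg: "real (bits x) \<le> 1 + lg x"
proof (cases "x = 0")
  case True
  have "bits x \<le> 0" using True by (intro bits_le) simp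
  then show ?thesis using lg_ge_1[of x] by simp
next
  case False
  then have "real (2 ^ bits x) \<le> real (2 * x)" using two_power_bits_le[of x] by (simp only: of_nat_le_iff)
  then have "log 2 (2 ^ bits x) \<le> log 2 (2 * real x)" using False by (subst log_le_cancel_iff) auto
  also have "\<dots> = 1 + log 2 x" using False by (simp add: log_mult)
  finally show ?thesis using log_le_lg[of x] by simp
qed

lemma le_two_power_log_bits: "n \<le> 2 ^ log_bits 1 n"
proof (cases "n = 0")
  case False
  have "log 2 n \<le> lg n" by (rule log_le_lg)
  also have "\<dots> \<le> real (log_bits 1 n)" by (simp add: log_bits_def) linarith
  finally have "real n \<le> 2 powr real (log_bits 1 n)" using False by (simp add: log_le_iff)
  then have "real n \<le> real (2 ^ log_bits 1 n)" by (simp add: powr_realpow)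
  then show ?thesis by (simp only: of_nat_le_iff)
qed simp

lemma log_bits_1_pos: "1 \<le> log_bits 1 n"
  using lg_ge_1[of n] by (simp add: log_bits_def le_nat_iff)

lemma log_bits_1_le: "real (log_bits 1 n) \<le> 2 * lg n"
  using lg_ge_1[of n] by (simp add: log_bits_def) linarith

lemma log_bits_eq: "log_bits k n = k * log_bits 1 n"
  by (simp add: log_bits_def)

text \<open>The first summand admits the reduced colors as keys; the others provide the precision
  that keeps rounding errors within m / 2.\<close>

definition hash_width :: "nat \<Rightarrow> nat \<Rightarrow> nat \<Rightarrow> nat" where
  "hash_width d w l = (reduced_width d ^^ w) w + bits l + bits (Suc d) + 1"

lemma hash_width_precise: "2 * l * Suc d \<le> 2 ^ hash_width d w l"
proof -
  have "l * Suc d \<le> 2 ^ bits l * 2 ^ bits (Suc d)"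
    using less_two_power_bits[of l] less_two_power_bits[of "Suc d"] by (intro mult_mono) auto
  then have "2 * l * Suc d \<le> 2 * (2 ^ bits l * 2 ^ bits (Suc d))" by simp
  also have "\<dots> = 2 ^ (bits l + bits (Suc d) + 1)" by (simp add: power_add)
  also have "\<dots> \<le> 2 ^ hash_width d w l" by (intro power_increasing) (simp_all add: hash_width_def)
  finally show ?thesis .
qed

lemma hash_width_le: "hash_width d w l \<le> 4 * bits d + 28 + bits l + bits (Suc d) + 1"
  using reduced_width_iterate_le[of w d w] by (simp add: hash_width_def)

definition params_script :: "nat \<Rightarrow> global_params \<Rightarrow> color_state op list" where
  "params_script b P =
     (let d = max_deg P; w = log_bits b (num_nodes P); l = bits (num_colors P)
      in coloring_script d w (hash_width d w l) l (3 * bits (num_nodes P)))"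

definition coloring_algorithm :: "nat \<Rightarrow> nat \<Rightarrow> algorithm" where
  "coloring_algorithm a b =
     script_protocol (10 * a + b + 183) (\<lambda>_. init_state) (params_script b) (\<lambda>_ s. color s - 1)"

text \<open>Three iterations shrink the bound by 27 / 64 < 1 / 2, hence three of them per bit of
  n.\<close>

lemma three_power_less: "3 ^ (3 * bits n) * n < 4 ^ (3 * bits n)"
proof -
  have "3 ^ (3 * bits n) * n < 27 ^ bits n * 2 ^ bits n"
    unfolding power_mult using less_two_power_bits[of n] by simp
  also have "\<dots> = (54::nat) ^ bits n" by (simp add: power_mult_distrib[symmetric])
  also have "\<dots> \<le> 64 ^ bits n" by (intro power_mono) auto
  finally show ?thesis by (simp add: power_mult)
qed

lemma max_degree_bounds:
  assumes G: "pair_graph G" "connected (with_proj G)" and n: "2 \<le> card (pverts G)"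
  shows "0 < max_degree G" "max_degree G < card (pverts G)"
proof -
  interpret pair_graph G by (rule G(1))
  have ne: "pverts G \<noteq> {}" using n by auto
  have nb: "neighbors G v \<subseteq> pverts G - {v}" for v
    using pair_no_loops by (fastforce simp: neighbors_def dest: arc_snd_in_verts)
  have "deg G v < card (pverts G)" if "v \<in> pverts G" for v
  proof -
    have "card (neighbors G v) \<le> card (pverts G - {v})" using nb pair_finite_verts by (intro card_mono) auto
    then show ?thesis using that pair_finite_verts n unfolding deg_eq_card_neighbors by simp
  qed
  moreover have "max_degree G \<in> deg G ` pverts G"
    unfolding max_degree_def using ne pair_finite_verts by (intro Max_in) auto
  ultimately show "max_degree G < card (pverts G)" by auto
  obtain u v where uv: "u \<in> pverts G" "v \<in> pverts G" "u \<noteq> v"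
    using n pair_finite_verts by (metis card_le_Suc0_iff_eq not_less_eq_eq numeral_2_eq_2)
  obtain p where p: "awalk u p v" using obtain_short_awalk[OF G uv(1,2)] .
  have "p \<noteq> []" using p uv(3) by (auto simp: awalk_Nil_iff)
  then obtain e es where "p = e # es" by (cases p) auto
  then have "e \<in> parcs G" "fst e = u" using p by (auto simp: awalk_Cons_iff)
  then have "neighbors G u \<noteq> {}" by (cases e) (auto simp: neighbors_def)
  moreover have "finite (neighbors G u)" using nb pair_finite_verts by (meson finite_Diff finite_subset)
  ultimately have "0 < deg G u" unfolding deg_eq_card_neighbors by (simp add: card_gt_0_iff)
  then show "0 < max_degree G" using deg_le_max_degree[OF G(1) uv(1)] by simp
qed

lemma coloring_algorithm_solves_aux:
  assumes inst: "coloring_instance a b G C L" and n: "2 \<le> card (pverts G)"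
    and T: "real (4 * diameter G * (8 + 5 * length (params_script b (params_of G C)))) \<le> T"
  shows "solves_within (coloring_algorithm a b) G C L T"
proof -
  have G: "pair_graph G" "connected (with_proj G)" and ids: "\<forall>v\<in>pverts G. v < 2 ^ log_bits b (card (pverts G))"
    and Ca: "C \<le> a * card (pverts G) ^ a"
    and L: "\<forall>v\<in>pverts G. L v \<subseteq> {..<C} \<and> card (L v) \<ge> deg G v + 1"
    using inst by (simp_all add: coloring_instance_def)
  define N where "N = card (pverts G)"
  define d where "d = max_degree G"
  define k where "k = log_bits 1 N"
  define w where "w = log_bits b N"
  define l where "l = bits C"
  define r where "r = hash_width d w l"
  \<comment> \<open>The sums of weights are below \<open>2 ^ (5 * r + 2 * k)\<close>, and
    \<open>r \<le> 2 * (a * k) + 36 * k\<close>, which makes \<open>10 * a + 182\<close> units of k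
    bits. One more unit gives strictness, and b covers the identifiers.\<close>
  define \<gamma> where "\<gamma> = 10 * a + b + 183"
  define W where "W = log_bits \<gamma> N"
  have k1: "1 \<le> k" and Nk: "N \<le> 2 ^ k"
    unfolding k_def by (rule log_bits_1_pos, rule le_two_power_log_bits)
  have w: "w = b * k" unfolding w_def k_def by (rule log_bits_eq)
  have W: "W = \<gamma> * k" unfolding W_def k_def by (rule log_bits_eq)
  have d: "0 < d" "d < N" using max_degree_bounds[OF G n] by (simp_all add: d_def N_def)
  have bd: "bits d \<le> k" using d(2) Nk by (intro bits_le) simp
  have bSd: "bits (Suc d) \<le> k + 1" using d(2) Nk by (intro bits_le) simp
  have l_le: "l \<le> a + a * k + 1"
  proof -
    have "C \<le> a * N ^ a" using Ca by (simp add: N_def)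
    also have "\<dots> \<le> 2 ^ a * (2 ^ k) ^ a" using Nk less_exp[of a] by (intro mult_mono power_mono) auto
    also have "\<dots> = 2 ^ (a + a * k)" by (simp add: power_add power_mult[symmetric] mult.commute)
    also have "\<dots> < 2 ^ (a + a * k + 1)" by simp
    finally show ?thesis unfolding l_def by (rule bits_le)
  qed
  have bl: "bits l \<le> l" by (rule bits_le) (rule less_exp)
  have ak: "a \<le> a * k" using k1 by simp
  have r_le: "r \<le> 2 * (a * k) + 36 * k"
    using hash_width_le[of d w l] bd bSd l_le bl ak k1 unfolding r_def by linarith
  have W': "W = 10 * (a * k) + b * k + 183 * k" by (simp add: W \<gamma>_def algebra_simps)
  have "N * (16 ^ r * (2 ^ r * d)) \<le> 2 ^ k * (2 ^ (4 * r) * (2 ^ r * 2 ^ k))"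
    using Nk d(2) by (intro mult_mono) (auto simp: power_mult)
  also have "\<dots> = 2 ^ (5 * r + 2 * k)" by (simp add: power_add[symmetric])
  also have "\<dots> < 2 ^ W" using r_le k1 unfolding W' by (intro power_strict_increasing) linarith+
  finally have fit: "N * (16 ^ r * (2 ^ r * d)) < 2 ^ W" .
  interpret network "pverts G" "input_of G L" W by (rule network_input_of[OF G(1)])
  interpret coloring_network "pverts G" "input_of G L" W d C w r l L
  proof
    show "0 < d" by (rule d(1))
    show "card (nb v) \<le> d" if "v \<in> pverts G" for v
      using deg_le_max_degree[OF G(1) that] by (simp add: d_def deg_eq_card_neighbors)
    show "color_list (input_of G L v) = L v" for v by simp
    show "L v \<subseteq> {..<C}" if "v \<in> pverts G" for v using L that by blast
    show "card (nb v) < card (L v)" if "v \<in> pverts G" for v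
      using L that by (auto simp: deg_eq_card_neighbors)
    show "pverts G \<subseteq> {..<2 ^ w}" using ids by (auto simp: w_def N_def)
    show "max (4 * bits d + 28) w \<le> W" using bd k1 unfolding W' w by (auto simp: max_def)
    show "(reduced_width d ^^ w) w \<le> r" by (simp add: r_def hash_width_def)
    show "C \<le> 2 ^ l" using less_two_power_bits[of C] by (simp add: l_def)
    show "l < W" using l_le ak k1 unfolding W' by linarith
    show "2 * l * Suc d \<le> 2 ^ r" unfolding r_def by (rule hash_width_precise)
    show "card (pverts G) * (16 ^ r * (2 ^ r * d)) < 2 ^ W" using fit by (simp add: N_def)
  qed
  have script: "params_script b (params_of G C) = coloring_script d w r l (3 * bits N)"
    by (simp add: params_script_def params_of_def Let_def d_def w_def r_def l_def N_def)
  have res: "script_fits (params_script b (params_of G C)) (\<lambda>v. init_state (input_of G L v))"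
    "proper (run_script (params_script b (params_of G C)) (\<lambda>v. init_state (input_of G L v)))"
    "\<forall>v\<in>pverts G. color (run_script (params_script b (params_of G C)) (\<lambda>v. init_state (input_of G L v)) v) \<noteq> 0"
    using coloring_triple[of "3 * bits N"] three_power_less[of N]
    unfolding triple_def script N_def by blast+
  define c where "c = run_script (params_script b (params_of G C)) (\<lambda>v. init_state (input_of G L v))"
  have col: "color (c v) = Suc (color (c v) - 1)" if "v \<in> pverts G" for v
    using res(3) that by (auto simp: c_def)
  have col_ok: "color (c v) - 1 \<in> L v - taken c v" if "v \<in> pverts G" for v
    using res(2) that col[OF that] unfolding proper_def c_def[symmetric] by blast
  have good: "list_coloring G L (\<lambda>v. color (c v) - 1)"
    unfolding list_coloring_def
  proof (intro conjI ballI, goal_cases)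
    case (1 v) then show ?case using col_ok by blast
  next
    case (2 e)
    then obtain u v where e: "e = (u, v)" "(u, v) \<in> parcs G" by (cases e) auto
    interpret pair_graph G by (rule G(1))
    have uv: "u \<in> pverts G" "v \<in> pverts G" using e(2) arc_fst_in_verts arc_snd_in_verts by force+
    have "v \<in> nb u" using e(2) by (simp add: neighbors_def)
    then have "color (c u) - 1 \<noteq> color (c v) - 1"
      using col_ok[OF uv(1)] col[OF uv(2)] by (auto simp: taken_def)
    then show ?case using e by simp
  qed
  have \<gamma>b: "w \<le> W" unfolding W' w by simp
  show ?thesis
    unfolding coloring_algorithm_def \<gamma>_def[symmetric]
  proof (rule script_protocol_solves[OF G])
    show "2 \<le> card (pverts G)" by (rule n)
    show "pverts G \<subseteq> {..<2 ^ log_bits \<gamma> (card (pverts G))}"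
      using ids less_two_power_mono[OF _ \<gamma>b] by (auto simp: W_def w_def N_def)
    have "k < W" unfolding W' using k1 by simp
    then have "N < 2 ^ W" using Nk power_strict_increasing[of k W "2::nat"] by linarith
    then show "card (pverts G) < 2 ^ log_bits \<gamma> (card (pverts G))" by (simp add: N_def W_def)
    show "network.script_fits (pverts G) (input_of G L) (log_bits \<gamma> (card (pverts G)))
        (params_script b (params_of G C)) (\<lambda>v. init_state (input_of G L v))"
      using res(1) by (simp add: W_def N_def)
    show "list_coloring G L (\<lambda>v. color (network.run_script (pverts G) (input_of G L)
        (params_script b (params_of G C)) (\<lambda>v. init_state (input_of G L v)) v) - 1)"
      using good by (simp add: c_def)
    show "real (4 * diameter G * (8 + 5 * length (params_script b (params_of G C)))) \<le> T" by (rule T)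
  qed
qed

text \<open>Since \<open>Z \<ge> 2\<close>, the bound \<open>9 * Z + 37\<close> for r is at most
  \<open>28 * Z\<close>, and \<open>8 * r + 4\<close> is at most \<open>226 * Z\<close>. An
  iteration then has length at most 453 = 2 * 226 + 1 times \<open>Y * Z\<close>, all iterations
  2718 = 6 * 453 times \<open>X * Y * Z\<close>, and 13603 = 8 + 5 * (1 + 2718).\<close>

lemma length_params_script:
  assumes n: "1 \<le> N" and C: "1 \<le> C" and d: "1 \<le> d"
  defines "X \<equiv> lg N" and "Y \<equiv> lg C" and "Z \<equiv> lg d + lg (lg C)"
  shows "real (8 + 5 * length (params_script b \<lparr>num_nodes = N, num_colors = C, max_deg = d\<rparr>))
    \<le> (13603 + 10 * real b) * (X * Y * Z)"
proof -
  define w where "w = log_bits b N"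
  define l where "l = bits C"
  define r where "r = hash_width d w l"
  define J where "J = 3 * bits N"
  have X: "1 \<le> X" and Y: "1 \<le> Y" and Z: "2 \<le> Z"
    using lg_ge_1[of N] lg_ge_1[of C] lg_ge_1[of d] lg_ge_1[of "lg C"] by (simp_all add: X_def Y_def Z_def)
  have w: "real w \<le> 2 * b * X"
  proof -
    have "real w = b * real (log_bits 1 N)" unfolding w_def by (subst log_bits_eq) simp
    also have "\<dots> \<le> b * (2 * X)" unfolding X_def by (intro mult_left_mono log_bits_1_le) simp
    finally show ?thesis by simp
  qed
  have J: "real J \<le> 6 * X" using bits_le_lg[of N] X by (simp add: J_def X_def)
  have l: "real l \<le> 2 * Y" using bits_le_lg[of C] Y by (simp add: l_def Y_def)
  have bl: "real (bits l) \<le> 2 + lg (lg C)"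
  proof -
    have "lg l \<le> 1 + lg (lg C)"
    proof -
      have "C < 2 ^ l" unfolding l_def by (rule less_two_power_bits)
      then have "l \<noteq> 0" using C by (cases l) auto
      have "log 2 l \<le> log 2 (2 * lg C)"
        using \<open>l \<noteq> 0\<close> l Y by (subst log_le_cancel_iff) (auto simp: Y_def)
      also have "\<dots> = 1 + log 2 (lg C)" using Y by (simp add: log_mult Y_def)
      also have "\<dots> \<le> 1 + lg (lg C)" using log_le_lg by simp
      finally show ?thesis using lg_ge_1[of "lg C"] by (subst lg_def) simp
    qed
    then show ?thesis using bits_le_lg[of l] by simp
  qed
  have bSd: "real (bits (Suc d)) \<le> 2 + lg d"
  proof -
    have "log 2 (real (Suc d)) \<le> log 2 (2 * d)" using d by (subst log_le_cancel_iff) auto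
    also have "\<dots> = 1 + log 2 d" using d by (simp add: log_mult)
    also have "\<dots> \<le> 1 + lg d" using log_le_lg by simp
    finally have "lg (Suc d) \<le> 1 + lg d" using lg_ge_1[of d] by (subst lg_def) simp
    then show ?thesis using bits_le_lg[of "Suc d"] by simp
  qed
  have "real r \<le> real (4 * bits d + 28 + bits l + bits (Suc d) + 1)"
    unfolding r_def by (simp only: of_nat_le_iff hash_width_le)
  also have "\<dots> \<le> 9 * Z + 37"
    using bits_le_lg[of d] bl bSd lg_ge_1[of "lg C"] unfolding Z_def by simp
  finally have r: "real r \<le> 28 * Z" using Z by linarith
  have XYZ: "X \<le> X * Y * Z"
  proof -
    have "X * 1 * 1 \<le> X * Y * Z" using X Y Z by (intro mult_mono) auto
    then show ?thesis by simp
  qed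
  have YZ: "2 \<le> Y * Z" using mult_mono[of 1 Y 2 Z] Y Z by simp
  have "real (l * (8 * r + 4) + 2) \<le> 2 * Y * (226 * Z) + Y * Z"
  proof -
    have "real l * (8 * real r + 4) \<le> (2 * Y) * (226 * Z)"
      using l r Z Y by (intro mult_mono) auto
    then show ?thesis using YZ by simp
  qed
  also have "\<dots> = 453 * (Y * Z)" by simp
  finally have "real J * real (l * (8 * r + 4) + 2) \<le> (6 * X) * (453 * (Y * Z))"
    using J X by (intro mult_mono) auto
  then have "real (J * (l * (8 * r + 4) + 2)) \<le> 2718 * (X * Y * Z)" by (simp add: algebra_simps)
  moreover have "real w + 1 \<le> (2 * real b + 1) * (X * Y * Z)"
  proof -
    have "real w + 1 \<le> (2 * real b + 1) * X" using w X by (simp add: algebra_simps)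
    also have "\<dots> \<le> (2 * real b + 1) * (X * Y * Z)" using XYZ by (intro mult_left_mono) auto
    finally show ?thesis .
  qed
  moreover have "length (params_script b \<lparr>num_nodes = N, num_colors = C, max_deg = d\<rparr>) =
      w + 1 + J * (l * (8 * r + 4) + 2)"
    by (simp add: params_script_def Let_def length_coloring_script w_def l_def r_def J_def)
  ultimately have "real (8 + 5 * length (params_script b \<lparr>num_nodes = N, num_colors = C, max_deg = d\<rparr>))
      \<le> 8 + 5 * ((2 * real b + 1) * (X * Y * Z) + 2718 * (X * Y * Z))" by simp
  also have "\<dots> \<le> (13603 + 10 * real b) * (X * Y * Z)" using order_trans[OF X XYZ] by (simp add: algebra_simps)
  finally show ?thesis .
qed

lemma coloring_instance_nonempty:
  assumes "coloring_instance a b G C L"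
  shows "1 \<le> card (pverts G)" "1 \<le> C"
proof -
  interpret pair_graph G using assms by (simp add: coloring_instance_def)
  have "pverts G \<noteq> {}"
    using assms by (auto simp: coloring_instance_def connected_def strongly_connected_def)
  then obtain v where v: "v \<in> pverts G" by blast
  then show "1 \<le> card (pverts G)" using pair_finite_verts by (metis One_nat_def Suc_leI card_gt_0_iff empty_iff)
  have L: "L v \<subseteq> {..<C}" "card (L v) \<ge> 1" using assms v by (auto simp: coloring_instance_def)
  have "card (L v) \<le> C" using card_mono[OF _ L(1)] by simp
  then show "1 \<le> C" using L(2) by simp
qed

lemma coloring_algorithm_solves:
  assumes inst: "coloring_instance a b G C L"
  shows "solves_within (coloring_algorithm a b) G C L
    (4 * (13603 + 10 * real b) * real (diameter G) * lg (card (pverts G)) * lg C *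
      (lg (max_degree G) + lg (lg C)))" (is "solves_within _ _ _ _ ?T")
proof (cases "2 \<le> card (pverts G)")
  case False
  have "0 \<le> ?T"
    using lg_ge_1[of "card (pverts G)"] lg_ge_1[of C] lg_ge_1[of "max_degree G"] lg_ge_1[of "lg C"] by simp
  moreover have "card (pverts G) = 1" using False coloring_instance_nonempty[OF inst] by simp
  ultimately show ?thesis
    unfolding coloring_algorithm_def using script_protocol_solves_single inst by blast
next
  case True
  have G: "pair_graph G" "connected (with_proj G)" using inst by (simp_all add: coloring_instance_def)
  have d: "1 \<le> max_degree G" using max_degree_bounds[OF G True] by simp
  let ?len = "8 + 5 * length (params_script b (params_of G C))"
  have "real ?len \<le> (13603 + 10 * real b) * (lg (card (pverts G)) * lg C * (lg (max_degree G) + lg (lg C)))"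
    using length_params_script[OF _ _ d] coloring_instance_nonempty[OF inst] by (simp add: params_of_def)
  then have "4 * real (diameter G) * real ?len \<le> 4 * real (diameter G) *
      ((13603 + 10 * real b) * (lg (card (pverts G)) * lg C * (lg (max_degree G) + lg (lg C))))"
    by (rule mult_left_mono) simp
  moreover have "real (4 * diameter G * ?len) = 4 * real (diameter G) * real ?len" by simp
  ultimately have "real (4 * diameter G * ?len) \<le> ?T" by (simp only: mult_ac)
  then show ?thesis by (rule coloring_algorithm_solves_aux[OF inst True])
qed

section \<open>Color spaces polynomial in the maximum degree\<close>

lemma solves_within_mono: "solves_within A G C L T \<Longrightarrow> T \<le> T' \<Longrightarrow> solves_within A G C L T'"
  unfolding solves_within_def by (meson order_trans)

text \<open>For positive d, \<open>C \<le> 2 * 2 ^ q * d ^ q\<close>; the constant part 1 + q of the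
  logarithm is absorbed by \<open>lg d \<ge> 1\<close>. For d = 0 the power vanishes and C is at
  most q.\<close>

lemma lg_poly_le:
  assumes "1 \<le> C" "C \<le> q * d ^ q + q"
  shows "lg C \<le> (2 * real q + 1) * lg d"
proof -
  have q: "1 \<le> q" using assms by (cases q) auto
  have "log 2 C \<le> (2 * real q + 1) * lg d"
  proof (cases "d = 0")
    case True
    then have "real C \<le> real q" using assms(2) q by (simp add: power_0_left)
    also have "\<dots> \<le> 2 powr q" using less_exp[of q] by (simp add: powr_realpow)
    finally have "log 2 C \<le> q" using assms(1) by (simp add: log_le_iff)
    then have "log 2 C \<le> (2 * real q + 1) * 1" by simp
    also have "\<dots> \<le> (2 * real q + 1) * lg d"
      using lg_ge_1[of d] by (intro mult_left_mono) auto
    finally show ?thesis .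
  next
    case False
    have "q * 1 \<le> q * d ^ q" using False by (intro mult_left_mono) auto
    then have "C \<le> 2 * (q * d ^ q)" using assms(2) by linarith
    also have "\<dots> \<le> 2 * (2 ^ q * d ^ q)" using less_exp[of q] by (intro mult_left_mono mult_right_mono) auto
    finally have "real C \<le> real (2 * (2 ^ q * d ^ q))" by (simp only: of_nat_le_iff)
    then have "log 2 C \<le> log 2 (real (2 * (2 ^ q * d ^ q)))" using assms(1) False by (subst log_le_cancel_iff) auto
    also have "\<dots> = (1 + real q) * 1 + real q * log 2 d" using False by (simp add: log_mult log_nat_power)
    also have "\<dots> \<le> (1 + real q) * lg d + real q * lg d"
      using lg_ge_1[of d] log_le_lg[of d] by (intro add_mono mult_left_mono) auto
    finally show ?thesis by (simp add: algebra_simps)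
  qed
  moreover have "1 * 1 \<le> (2 * real q + 1) * lg d" using lg_ge_1[of d] by (intro mult_mono) auto
  ultimately show ?thesis by (simp add: lg_def[of "real C"])
qed

lemma less_two_powr: "x < 2 powr (x::real)"
proof (cases "0 \<le> x")
  case True
  define n where "n = nat \<lfloor>x\<rfloor>"
  have n: "real n \<le> x" "x < real n + 1" using True by (auto simp: n_def)
  have "n + 1 \<le> 2 ^ n" unfolding Suc_eq_plus1[symmetric] by (intro Suc_leI less_exp)
  then have "real (n + 1) \<le> real (2 ^ n)" by (simp only: of_nat_le_iff)
  then have "real n + 1 \<le> 2 powr n" by (simp add: powr_realpow)
  also have "\<dots> \<le> 2 powr x" using n by simp
  finally show ?thesis using n by linarith
qed (smt (verit) powr_gt_zero)

lemma lg_le_self: "1 \<le> x \<Longrightarrow> lg x \<le> x"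
proof -
  assume x: "1 \<le> x"
  have "x < 2 powr x" by (rule less_two_powr)
  then have "log 2 x \<le> x" using x by (simp add: log_le_iff)
  then show ?thesis using x by (simp add: lg_def)
qed

theorem theorem1p1:
  fixes a b :: nat
  shows "\<exists>(A :: algorithm) (\<beta> :: nat).
    (\<forall>G C L. coloring_instance a b G C L \<longrightarrow> respects_bandwidth \<beta> A G C L) \<and>
    (\<exists>K :: real. \<forall>G C L. coloring_instance a b G C L \<longrightarrow>
       solves_within A G C L
         (K * real (diameter G) * lg (card (pverts G)) * lg C *
           (lg (max_degree G) + lg (lg C)))) \<and>
    (\<forall>q :: nat. \<exists>K :: real. \<forall>G C L.
       coloring_instance a b G C L \<and> C \<le> q * max_degree G ^ q + q \<longrightarrow>
       solves_within A G C L
         (K * real (diameter G) * lg (card (pverts G)) * (lg (max_degree G))\<^sup>2))"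
proof (intro exI[of _ "coloring_algorithm a b"] exI[of _ "10 * a + b + 183"] conjI allI impI)
  fix G C L
  show "respects_bandwidth (10 * a + b + 183) (coloring_algorithm a b) G C L"
    unfolding coloring_algorithm_def by (rule script_protocol_respects_bandwidth)
next
  show "\<exists>K :: real. \<forall>G C L. coloring_instance a b G C L \<longrightarrow>
       solves_within (coloring_algorithm a b) G C L
         (K * real (diameter G) * lg (card (pverts G)) * lg C * (lg (max_degree G) + lg (lg C)))"
    using coloring_algorithm_solves by blast
next
  fix q :: nat
  \<comment> \<open>The factor in \<open>lg C \<le> M * lg d\<close>. Bounding
    \<open>lg (lg C)\<close> by \<open>lg C\<close> turns the last factor of the running time into
    \<open>(1 + M) * lg d\<close>.\<close>
  define M where "M = 2 * real q + 1"
  define K where "K = 4 * (13603 + 10 * real b)"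
  have "solves_within (coloring_algorithm a b) G C L
      (K * M * (1 + M) * real (diameter G) * lg (card (pverts G)) * (lg (max_degree G))\<^sup>2)"
    if inst: "coloring_instance a b G C L" and C: "C \<le> q * max_degree G ^ q + q" for G C L
  proof (rule solves_within_mono[OF coloring_algorithm_solves[OF inst]])
    define x where "x = lg (max_degree G)"
    have x: "1 \<le> x" by (simp add: x_def lg_ge_1)
    have M: "1 \<le> M" by (simp add: M_def)
    have Cx: "lg C \<le> M * x"
      unfolding M_def x_def by (rule lg_poly_le[OF coloring_instance_nonempty(2)[OF inst] C])
    have "lg (lg C) \<le> M * x" using lg_le_self[OF lg_ge_1[of C]] Cx by linarith
    then have sum: "x + lg (lg C) \<le> (1 + M) * x" by (simp add: algebra_simps)
    have "lg C * (x + lg (lg C)) \<le> (M * x) * ((1 + M) * x)"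
      using Cx sum x M lg_ge_1[of "lg C"] by (intro mult_mono) auto
    then have "(K * real (diameter G) * lg (card (pverts G))) * (lg C * (x + lg (lg C))) \<le>
        (K * real (diameter G) * lg (card (pverts G))) * ((M * x) * ((1 + M) * x))"
      by (rule mult_left_mono) (use lg_ge_1[of "card (pverts G)"] in \<open>simp add: K_def\<close>)
    then show "4 * (13603 + 10 * real b) * real (diameter G) * lg (card (pverts G)) * lg C *
        (lg (max_degree G) + lg (lg C)) \<le>
        K * M * (1 + M) * real (diameter G) * lg (card (pverts G)) * (lg (max_degree G))\<^sup>2"
      unfolding x_def[symmetric] K_def[symmetric] by (simp add: power2_eq_square mult_ac)
  qed
  then show "\<exists>K :: real. \<forall>G C L.
       coloring_instance a b G C L \<and> C \<le> q * max_degree G ^ q + q \<longrightarrow>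
       solves_within (coloring_algorithm a b) G C L
         (K * real (diameter G) * lg (card (pverts G)) * (lg (max_degree G))\<^sup>2)"
    by blast
qed

end
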